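(* Let $T$ be a non-empty set, let $X\subseteq\mathbb{R}^T$ be a reproducing kernel Banach space, and let $K : T \times T \to \mathbb{R}$ be a positive definite function. Then there exists a centered Radon Gaussian measure on $(X,\mathcal{B}(X))$ with covariance function $K$ if and only if $H(K) \subseteq X$ and the embedding $\iota : H(K) \to X$ is $\gamma$-radonifying.
   Context: All vector spaces are real; $\mathcal{B}(X)$ is the Borel $\sigma$-algebra of $X$. A Banach space $X$ that is a linear subspace of $\mathbb{R}^T$ (real functions on $T$) is a reproducing kernel Banach space if for every $t\in T$ the evaluation functional $\delta_t : X \to \mathbb{R}$, $x \mapsto x(t)$, is continuous. A function $K:T\times T\to\mathbb{R}$ is positive definite if $\sum_{s,t\in T_0}c_sc_tK(s,t)\ge 0$ for all finite $T_0\subseteq T$ and real $(c_t)_{t\in T_0}$; such functions are by convention symmetric, $K(s,t)=K(t,s)$. $H(K)$: for positive definite $K$, $H(K)\subseteq\mathbb{R}^T$ is the unique Hilbert space of functions on $T$ with $K(\cdot,t)\in H(K)$ for all $t\in T$ and $(x,K(\cdot,t))_{H(K)}=x(t)$ for all $x\in H(K)$, $t\in T$. When $H(K)\subseteq X$, $\iota:H(K)\to X$ is the inclusion (automatically continuous by the closed graph theorem). Gaussian measures: a Borel probability measure $\gamma$ on $X$ is Radon if for every $B\in\mathcal{B}(X)$ and $\varepsilon>0$ there is a compact $C\subseteq B$ with $\gamma(B\setminus C)<\varepsilon$. It is a centered Radon Gaussian measure if it is Radon and every $f\in X^*$ has a centered (possibly degenerate) Gaussian distribution under $\gamma$. Its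 covariance operator is the unique linear operator $R:X^*\to X$ with $\langle Rf,g\rangle=\int_X f(x)g(x)\,\gamma(dx)$ for all $f,g\in X^*$, where $\langle x,f\rangle=f(x)$. Its covariance function is $(s,t)\mapsto\langle R\delta_s,\delta_t\rangle$. $\gamma$-radonifying operators: let $H$ be a Hilbert space and $(\xi_k)$ a sequence of independent standard Gaussian random variables on some probability space, with expectation denoted $\mathbb{E}$. For a bounded linear $A:H\to X$ put $\|A\|_{\gamma_\infty(H,X)}=\sup\big(\mathbb{E}\|\sum_{k=1}^n\xi_kAh_k\|_X^2\big)^{1/2}$, the supremum being over all finite orthonormal systems $(h_k)_{k=1}^n$ in $H$; $\gamma_\infty(H,X)$ is the normed space of all $A$ for which this is finite. $A$ is $\gamma$-radonifying if it belongs to the closure in $\gamma_\infty(H,X)$ of the bounded finite-rank operators. *)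

theory Defs
  imports "HOL-Probability.Probability" "HOL-Library.Function_Algebras"
begin

instantiation "fun" :: (type, real_vector) real_vector
begin

definition scaleR_fun :: "real \<Rightarrow> ('a \<Rightarrow> 'b) \<Rightarrow> 'a \<Rightarrow> 'b"
  where "scaleR_fun c f = (\<lambda>t. c *\<^sub>R f t)"

instance
  by standard (auto simp: scaleR_fun_def fun_eq_iff scaleR_add_right scaleR_add_left)

end

text \<open>The non-empty set \<open>T\<close> is the type \<open>'t\<close>.  A Banach space \<open>X\<close> that is a linear subspace of
  the space of real functions on \<open>T\<close> is a Banach space type \<open>'x\<close> with an injective linear map
  \<open>emb\<close> sending an element to the function it is; then \<open>inv emb\<close> is the inclusion into \<open>X\<close>
  of any set of functions contained in \<open>range emb\<close>.\<close>

definition rkbs :: "('x::banach \<Rightarrow> 't \<Rightarrow> real) \<Rightarrow> bool"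
  where "rkbs emb \<longleftrightarrow> linear emb \<and> inj emb \<and> (\<forall>t. continuous_on UNIV (\<lambda>x. emb x t))"

definition eval_functional :: "('x::banach \<Rightarrow> 't \<Rightarrow> real) \<Rightarrow> 't \<Rightarrow> ('x \<Rightarrow>\<^sub>L real)"
  where "eval_functional emb t = Blinfun (\<lambda>x. emb x t)"

definition positive_definite :: "('t \<Rightarrow> 't \<Rightarrow> real) \<Rightarrow> bool"
  where "positive_definite K \<longleftrightarrow>
    (\<forall>s t. K s t = K t s) \<and>
    (\<forall>T0 c. finite T0 \<longrightarrow> 0 \<le> (\<Sum>s\<in>T0. \<Sum>t\<in>T0. c s * c t * K s t))"


text \<open>Hilbert spaces given by a carrier in an ambient real vector space.\<close>

definition inner_product_on :: "'h::real_vector set \<Rightarrow> ('h \<Rightarrow> 'h \<Rightarrow> real) \<Rightarrow> bool"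
  where "inner_product_on H ip \<longleftrightarrow>
    (\<forall>x\<in>H. \<forall>y\<in>H. ip x y = ip y x) \<and>
    (\<forall>x\<in>H. \<forall>y\<in>H. \<forall>z\<in>H. ip (x + y) z = ip x z + ip y z) \<and>
    (\<forall>c. \<forall>x\<in>H. \<forall>y\<in>H. ip (c *\<^sub>R x) y = c * ip x y) \<and>
    (\<forall>x\<in>H. 0 \<le> ip x x) \<and>
    (\<forall>x\<in>H. ip x x = 0 \<longrightarrow> x = 0)"

definition norm_of :: "('h \<Rightarrow> 'h \<Rightarrow> real) \<Rightarrow> 'h \<Rightarrow> real"
  where "norm_of ip x = sqrt (ip x x)"

definition hilbert_space_on :: "'h::real_vector set \<Rightarrow> ('h \<Rightarrow> 'h \<Rightarrow> real) \<Rightarrow> bool"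
  where "hilbert_space_on H ip \<longleftrightarrow>
    subspace H \<and> inner_product_on H ip \<and>
    (\<forall>x. (\<forall>n::nat. x n \<in> H) \<and>
         (\<forall>e>0. \<exists>N. \<forall>m\<ge>N. \<forall>n\<ge>N. norm_of ip (x m - x n) < e) \<longrightarrow>
         (\<exists>l\<in>H. (\<lambda>n. norm_of ip (x n - l)) \<longlonglongrightarrow> 0))"

text \<open>The last conjunct fixes the values of \<open>ip\<close> off the carrier, so that the pair is unique.\<close>

definition is_rkhs :: "('t \<Rightarrow> 't \<Rightarrow> real) \<Rightarrow>
    ('t \<Rightarrow> real) set \<times> (('t \<Rightarrow> real) \<Rightarrow> ('t \<Rightarrow> real) \<Rightarrow> real) \<Rightarrow> bool"
  where "is_rkhs K = (\<lambda>(H, ip).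
    hilbert_space_on H ip \<and>
    (\<forall>t. (\<lambda>s. K s t) \<in> H) \<and>
    (\<forall>x\<in>H. \<forall>t. ip x (\<lambda>s. K s t) = x t) \<and>
    (\<forall>x y. x \<notin> H \<or> y \<notin> H \<longrightarrow> ip x y = 0))"

definition rkhs :: "('t \<Rightarrow> 't \<Rightarrow> real) \<Rightarrow>
    ('t \<Rightarrow> real) set \<times> (('t \<Rightarrow> real) \<Rightarrow> ('t \<Rightarrow> real) \<Rightarrow> real)"
  where "rkhs K = (THE p. is_rkhs K p)"

abbreviation rkhs_space :: "('t \<Rightarrow> 't \<Rightarrow> real) \<Rightarrow> ('t \<Rightarrow> real) set"
  where "rkhs_space K \<equiv> fst (rkhs K)"

abbreviation rkhs_inner :: "('t \<Rightarrow> 't \<Rightarrow> real) \<Rightarrow> ('t \<Rightarrow> real) \<Rightarrow> ('t \<Rightarrow> real) \<Rightarrow> real"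
  where "rkhs_inner K \<equiv> snd (rkhs K)"


definition radon_probability :: "'x::topological_space measure \<Rightarrow> bool"
  where "radon_probability \<gamma> \<longleftrightarrow>
    sets \<gamma> = sets borel \<and> prob_space \<gamma> \<and>
    (\<forall>B\<in>sets borel. \<forall>e>0. \<exists>C\<subseteq>B. compact C \<and> measure \<gamma> (B - C) < e)"

definition centered_gaussian_real :: "real measure \<Rightarrow> bool"
  where "centered_gaussian_real \<nu> \<longleftrightarrow>
    \<nu> = return borel 0 \<or> (\<exists>\<sigma>>0. \<nu> = density lborel (normal_density 0 \<sigma>))"

definition centered_radon_gaussian :: "'x::banach measure \<Rightarrow> bool"
  where "centered_radon_gaussian \<gamma> \<longleftrightarrow>
    radon_probability \<gamma> \<and>
    (\<forall>f :: 'x \<Rightarrow>\<^sub>L real. centered_gaussian_real (distr \<gamma> borel (blinfun_apply f)))"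

definition covariance_operator :: "'x::banach measure \<Rightarrow> ('x \<Rightarrow>\<^sub>L real) \<Rightarrow> 'x"
  where "covariance_operator \<gamma> = (THE R. linear R \<and>
    (\<forall>f g. blinfun_apply g (R f) = (\<integral>x. blinfun_apply f x * blinfun_apply g x \<partial>\<gamma>)))"

definition covariance_function ::
    "('x::banach \<Rightarrow> 't \<Rightarrow> real) \<Rightarrow> 'x measure \<Rightarrow> 't \<Rightarrow> 't \<Rightarrow> real"
  where "covariance_function emb \<gamma> = (\<lambda>s t.
    blinfun_apply (eval_functional emb t) (covariance_operator \<gamma> (eval_functional emb s)))"


definition std_gaussian_sequence :: "'w measure \<Rightarrow> (nat \<Rightarrow> 'w \<Rightarrow> real) \<Rightarrow> bool"
  where "std_gaussian_sequence M \<xi> \<longleftrightarrow>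
    prob_space M \<and>
    prob_space.indep_vars M (\<lambda>_. borel) \<xi> UNIV \<and>
    (\<forall>k. distributed M lborel (\<xi> k) std_normal_density)"

definition orthonormal_system ::
    "'h set \<Rightarrow> ('h \<Rightarrow> 'h \<Rightarrow> real) \<Rightarrow> nat \<Rightarrow> (nat \<Rightarrow> 'h) \<Rightarrow> bool"
  where "orthonormal_system H ip n h \<longleftrightarrow>
    (\<forall>k<n. h k \<in> H) \<and> (\<forall>j<n. \<forall>k<n. ip (h j) (h k) = (if j = k then 1 else 0))"

definition bounded_linear_on ::
    "'h::real_vector set \<Rightarrow> ('h \<Rightarrow> 'h \<Rightarrow> real) \<Rightarrow> ('h \<Rightarrow> 'x::real_normed_vector) \<Rightarrow> bool"
  where "bounded_linear_on H ip A \<longleftrightarrow>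
    (\<forall>x\<in>H. \<forall>y\<in>H. A (x + y) = A x + A y) \<and>
    (\<forall>c. \<forall>x\<in>H. A (c *\<^sub>R x) = c *\<^sub>R A x) \<and>
    (\<exists>C. \<forall>x\<in>H. norm (A x) \<le> C * norm_of ip x)"

text \<open>The supremum is taken in \<open>ereal\<close> as it may be infinite.  The integrand is bounded by a
  multiple of the squared sum of the \<open>\<bar>\<xi> k\<bar>\<close>, hence integrable, so the Bochner integral
  is the genuine expectation.\<close>

definition gamma_norm :: "'w measure \<Rightarrow> (nat \<Rightarrow> 'w \<Rightarrow> real) \<Rightarrow>
    'h set \<Rightarrow> ('h \<Rightarrow> 'h \<Rightarrow> real) \<Rightarrow> ('h \<Rightarrow> 'x::real_normed_vector) \<Rightarrow> ereal"
  where "gamma_norm M \<xi> H ip A =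
    (SUP (n, h) \<in> {(n, h). orthonormal_system H ip n h}.
      ereal (sqrt (\<integral>\<omega>. (norm (\<Sum>k<n. \<xi> k \<omega> *\<^sub>R A (h k)))\<^sup>2 \<partial>M)))"

definition gamma_space :: "'w measure \<Rightarrow> (nat \<Rightarrow> 'w \<Rightarrow> real) \<Rightarrow>
    'h::real_vector set \<Rightarrow> ('h \<Rightarrow> 'h \<Rightarrow> real) \<Rightarrow> ('h \<Rightarrow> 'x::real_normed_vector) set"
  where "gamma_space M \<xi> H ip = {A. bounded_linear_on H ip A \<and> gamma_norm M \<xi> H ip A < \<infinity>}"

definition finite_rank_on :: "'h set \<Rightarrow> ('h \<Rightarrow> 'x::real_vector) \<Rightarrow> bool"
  where "finite_rank_on H A \<longleftrightarrow> (\<exists>S. finite S \<and> A ` H \<subseteq> span S)"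

definition gamma_radonifying :: "'w measure \<Rightarrow> (nat \<Rightarrow> 'w \<Rightarrow> real) \<Rightarrow>
    'h::real_vector set \<Rightarrow> ('h \<Rightarrow> 'h \<Rightarrow> real) \<Rightarrow> ('h \<Rightarrow> 'x::real_normed_vector) \<Rightarrow> bool"
  where "gamma_radonifying M \<xi> H ip A \<longleftrightarrow>
    A \<in> gamma_space M \<xi> H ip \<and>
    (\<forall>e>0. \<exists>B \<in> gamma_space M \<xi> H ip. finite_rank_on H B \<and>
       gamma_norm M \<xi> H ip (\<lambda>x. A x - B x) < ereal e)"

end

theory Submission
  imports Defs
begin

text \<open>
  \<^emph>\<open>From \<open>\<gamma>\<close> to \<open>H(K)\<close>.\<close>  A Radon measure gives full mass to a \<open>\<sigma>\<close>-compact linear subspace \<open>E\<close>, on which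
  countably many functionals form injective coordinates; laws of Gaussian vectors in \<open>X\<close> can therefore be compared
  through their one-dimensional projections in the space of real sequences, without separability of \<open>X\<close>.
  Four rotations of independent copies \<open>x\<close>, \<open>y\<close> of \<open>\<gamma>\<close> do all the work.  First, for \<open>v = R g\<close> the vector
  \<open>x - g(x) v + g(y) v\<close> has law \<open>\<gamma>\<close> (with \<open>g\<close> of unit variance), which forces \<open>R g \<in> E\<close>.  Second, \<open>(x \<plusminus> y) / \<surd>2\<close> gives
  Fernique's inequality and a finite second moment.  Third, if \<open>S\<close> is the regression of \<open>x\<close> on finitely many
  functionals, \<open>2 S - x\<close> has the law of \<open>x\<close>, so the second moment of \<open>S\<close> is at most that of \<open>x\<close>; this bounds
  \<open>\<gamma>\<close>-norms.  Fourth, \<open>S x + (y - S y)\<close> has law \<open>\<gamma>\<close> and agrees with \<open>x\<close> in the regressed coordinates, hence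
  is close to \<open>x\<close> on compact sets, and its difference from \<open>x\<close> is distributed as \<open>\<surd>2 (x - S x)\<close>; so \<open>\<iota>\<close> is a limit of
  finite-rank operators.

  \<^emph>\<open>From \<open>\<iota>\<close> to \<open>\<gamma>\<close>.\<close>  Finite-rank operators \<open>B n\<close> close to \<open>\<iota>\<close> vanish on the complement of increasing finite orthonormal sets;
  along these the sums of \<open>\<xi> e \<cdot> \<iota> e\<close> converge almost surely, uniformly on closed sets of measure close to one,
  and the law of the limit is the required Radon measure.
\<close>

section \<open>Laws of random sequences and centered Gaussian variables\<close>

text \<open>The obstacle is that \<open>'x\<close> need not be separable: addition may fail to be
  measurable for the product of two copies of its Borel \<sigma>-algebra, so that functions of sums
  of independent vectors cannot be integrated directly. Such vectors are sent by the coordinates to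
  real sequences and brought back by an inverse of the coordinates, which is Borel because the
  coordinates map compact sets to compact sets. A second difficulty is that the covariance operator
  and the kernel space are definite descriptions. Vectors representing the covariances have to be
  exhibited before the covariance function has a usable value, and the kernel space has to be
  constructed and shown unique. Finally, \<gamma>-norms are defined with the given
  \<open>\<xi>\<close>, whereas the estimates take place on \<open>\<gamma>\<close>. The two are
  connected by the fact that the second moment of a finite Gaussian sum of vectors depends on the
  coefficients only through their being jointly Gaussian and orthonormal; an orthonormal system of
  kernel functions corresponds to such coefficients on \<open>\<gamma>\<close>.\<close>

lemma Levy_uniqueness_finite:
  fixes M1 M2 :: "real measure"
  assumes "finite_measure M1" "finite_measure M2"
    and sets: "sets M1 = sets borel" "sets M2 = sets borel"
    and cos_eq: "\<And>s \<theta>. (\<integral>x. cos (s * x + \<theta>) \<partial>M1) = (\<integral>x. cos (s * x + \<theta>) \<partial>M2)"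
  shows "M1 = M2"
proof -
  interpret M1: finite_measure M1 by fact
  interpret M2: finite_measure M2 by fact
  note [measurable_cong] = sets
  have sp: "space M1 = UNIV" "space M2 = UNIV"
    using sets[THEN sets_eq_imp_space_eq] by auto
  define m where "m = measure M1 UNIV"
  have m2: "measure M2 UNIV = m"
    using cos_eq[of 0 0] by (simp add: m_def sp)
  have e1: "emeasure M1 UNIV = ennreal m" "emeasure M2 UNIV = ennreal m"
    using M1.emeasure_eq_measure[of UNIV] M2.emeasure_eq_measure[of UNIV] m2 m_def by auto
  show ?thesis
  proof (cases "m = 0")
    case True
    have "emeasure M1 A = 0" "emeasure M2 A = 0" if "A \<in> sets M1" for A
      using emeasure_mono[of A UNIV M1] emeasure_mono[of A UNIV M2] that e1 True sets by auto
    then show ?thesis by (intro measure_eqI) (auto simp: sets)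
  next
    case False
    then have mpos: "m > 0" by (simp add: m_def zero_less_measure_iff)
    have rd: "real_distribution (density M (\<lambda>_. ennreal (1/m)))"
      if "emeasure M UNIV = ennreal m" "sets M = sets borel" for M :: "real measure"
    proof -
      have [simp]: "space M = UNIV" using that(2)[THEN sets_eq_imp_space_eq] by auto
      have "prob_space (density M (\<lambda>_. ennreal (1/m)))"
        by (rule prob_spaceI)
           (use that mpos in \<open>simp add: emeasure_density ennreal_mult[symmetric]\<close>)
      then show ?thesis
        by (simp add: real_distribution_def real_distribution_axioms_def that)
    qed
    have iI: "integrable M (\<lambda>x. iexp (t * x))" "integrable M (\<lambda>x. cos (t*x+\<theta>))"
      if "finite_measure M" "sets M = sets borel" for M :: "real measure" and t \<theta>
    proof -
      interpret finite_measure M by fact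
      note [measurable_cong] = that(2)
      show "integrable M (\<lambda>x. iexp (t * x))"
        by (rule integrable_const_bound[of _ 1]) auto
      show "integrable M (\<lambda>x. cos (t*x+\<theta>))"
        by (rule integrable_const_bound[of _ 1]) auto
    qed
    \<comment> \<open>The phases 0 and -pi/2 recover the real and the imaginary part of the
      characteristic function. Cosines with a phase are preferred to exponentials because the
      product of two of them is again a sum of such cosines.\<close>
    have ch: "char (density M (\<lambda>_. ennreal (1/m))) t =
        (1/m) *\<^sub>R Complex (\<integral>x. cos (t * x + 0) \<partial>M) (\<integral>x. cos (t * x + (- pi/2)) \<partial>M)"
      if "finite_measure M" "sets M = sets borel" for M :: "real measure" and t
    proof -
      interpret finite_measure M by fact
      note [measurable_cong] = that(2)
      note iI = iI[OF that]
      have "char (density M (\<lambda>_. ennreal (1/m))) t = (\<integral>x. (1/m) *\<^sub>R iexp (t * x) \<partial>M)"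
        unfolding char_def using mpos by (subst integral_density) auto
      also have "\<dots> = (1/m) *\<^sub>R (\<integral>x. iexp (t * x) \<partial>M)" by simp
      also have "(\<integral>x. iexp (t * x) \<partial>M) = Complex (\<integral>x. cos (t * x + 0) \<partial>M) (\<integral>x. cos (t * x + (- pi/2)) \<partial>M)"
      proof (rule complex_eqI)
        show "Re (\<integral>x. iexp (t * x) \<partial>M) = Re (Complex (\<integral>x. cos (t * x + 0) \<partial>M) (\<integral>x. cos (t * x + (- pi/2)) \<partial>M))"
          using integral_Re[OF iI(1)] by (simp add: Re_exp)
        have "cos (t * x + (- pi/2)) = sin (t * x)" for x by (simp add: cos_diff)
        then show "Im (\<integral>x. iexp (t * x) \<partial>M) = Im (Complex (\<integral>x. cos (t * x + 0) \<partial>M) (\<integral>x. cos (t * x + (- pi/2)) \<partial>M))"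
          using integral_Im[OF iI(1)] by (simp add: Im_exp)
      qed
      finally show ?thesis .
    qed
    have "density M1 (\<lambda>_. ennreal (1/m)) = density M2 (\<lambda>_. ennreal (1/m))"
      by (rule Levy_uniqueness[OF rd rd])
         (auto simp: e1 sets ch[OF M1.finite_measure_axioms sets(1)] ch[OF M2.finite_measure_axioms sets(2)] fun_eq_iff cos_eq[of _ 0, simplified] cos_eq[of _ "- (pi/2)", simplified])
    then have *: "ennreal (1/m) * emeasure M1 A = ennreal (1/m) * emeasure M2 A" if "A \<in> sets borel" for A
      using emeasure_density_const[of A M1 "ennreal (1/m)"] emeasure_density_const[of A M2 "ennreal (1/m)"] that sets by auto
    have "ennreal m * (ennreal (1/m) * z) = z" for z
      using mpos by (simp add: mult.assoc[symmetric] ennreal_mult[symmetric])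
    with * have "emeasure M1 A = emeasure M2 A" if "A \<in> sets borel" for A
      using that by metis
    then show ?thesis by (intro measure_eqI) (auto simp: sets)
  qed
qed

text \<open>One-dimensional uniqueness is applied to the law of \<open>u\<close> under the nonnegative densities
  \<open>w (1 + cos (p + \<theta>))\<close>, whose Fourier transform only involves integrals of the form assumed in \<open>cos_eq\<close>.
  Iterating this step turns cosines of linear functionals into indicators of cylinder sets.\<close>

lemma weighted_cos_integral_step:
  fixes M1 :: "'a measure" and M2 :: "'b measure" and L :: "(('a \<Rightarrow> real) \<times> ('b \<Rightarrow> real)) set"
  assumes fin: "finite_measure M1" "finite_measure M2"
    and meas: "\<And>u v. (u, v) \<in> L \<Longrightarrow> u \<in> borel_measurable M1 \<and> v \<in> borel_measurable M2"
    and add: "\<And>u v u' v'. (u, v) \<in> L \<Longrightarrow> (u', v') \<in> L \<Longrightarrow> (\<lambda>x. u x + u' x, \<lambda>x. v x + v' x) \<in> L"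
    and scale: "\<And>u v c. (u, v) \<in> L \<Longrightarrow> (\<lambda>x. c * u x, \<lambda>x. c * v x) \<in> L"
    and w1: "w1 \<in> borel_measurable M1" "\<And>x. 0 \<le> w1 x \<and> w1 x \<le> (1::real)"
    and w2: "w2 \<in> borel_measurable M2" "\<And>x. 0 \<le> w2 x \<and> w2 x \<le> (1::real)"
    and cos_eq: "\<And>p q \<theta>. (p, q) \<in> L \<Longrightarrow>
      (\<integral>x. w1 x * cos (p x + \<theta>) \<partial>M1) = (\<integral>x. w2 x * cos (q x + \<theta>) \<partial>M2)"
    and uv: "(u, v) \<in> L" and A[measurable]: "A \<in> sets borel" and pq: "(p, q) \<in> L"
  shows "(\<integral>x. w1 x * indicator A (u x) * cos (p x + \<theta>) \<partial>M1) =
    (\<integral>x. w2 x * indicator A (v x) * cos (q x + \<theta>) \<partial>M2)"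
proof -
  interpret M1: finite_measure M1 by fact
  interpret M2: finite_measure M2 by fact
  note [measurable] = w1(1) w2(1)
  have *: "(\<integral>x. w1 x * (1 + cos (p x + \<theta>)) * indicator A (u x) \<partial>M1) =
    (\<integral>x. w2 x * (1 + cos (q x + \<theta>)) * indicator A (v x) \<partial>M2)" if pq: "(p, q) \<in> L" for p q \<theta>
  proof -
    have nonneg: "0 \<le> 1 + cos z" for z :: real using cos_ge_minus_one[of z] by linarith
    have le2: "1 + cos z \<le> 2" for z :: real using cos_le_one[of z] by linarith
    have gen: "finite_measure (distr (density M (\<lambda>x. ennreal (w x * (1 + cos (p x + \<theta>))))) borel u)
        \<and> (\<forall>s \<tau>. (\<integral>y. cos (s * y + \<tau>) \<partial>distr (density M (\<lambda>x. ennreal (w x * (1 + cos (p x + \<theta>))))) borel u) =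
          (\<integral>x. w x * cos (s * u x + \<tau>) \<partial>M)
          + (\<integral>x. w x * cos ((p x + s * u x) + (\<theta> + \<tau>)) \<partial>M) / 2
          + (\<integral>x. w x * cos ((p x + (-s) * u x) + (\<theta> - \<tau>)) \<partial>M) / 2)
        \<and> measure (distr (density M (\<lambda>x. ennreal (w x * (1 + cos (p x + \<theta>))))) borel u) A =
          (\<integral>x. w x * (1 + cos (p x + \<theta>)) * indicator A (u x) \<partial>M)"
      if M: "finite_measure M" and u[measurable]: "u \<in> borel_measurable M"
        and p[measurable]: "p \<in> borel_measurable M" and w[measurable]: "w \<in> borel_measurable M"
        and w01: "\<And>x. 0 \<le> w x \<and> w x \<le> 1"
      for M :: "'c measure" and u p w
    proof -
      interpret finite_measure M by fact
      define g where "g = (\<lambda>x. w x * (1 + cos (p x + \<theta>)))"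
      have g[measurable]: "g \<in> borel_measurable M" unfolding g_def by simp
      have g0: "0 \<le> g x" "g x \<le> 2" for x
        unfolding g_def using w01[of x] nonneg[of "p x + \<theta>"] le2[of "p x + \<theta>"]
          mult_mono[of "w x" 1 "1 + cos (p x + \<theta>)" 2] by auto
      have iw: "integrable M (\<lambda>x. w x * cos (h x))" if "h \<in> borel_measurable M" for h
      proof (rule integrable_const_bound[of _ 1])
        have "\<bar>w x * cos (h x)\<bar> \<le> 1 * 1" for x
          unfolding abs_mult by (intro mult_mono) (use w01[of x] in auto)
        then show "AE x in M. norm (w x * cos (h x)) \<le> 1" by simp
      qed (use that in measurable)
      have ig: "integrable M g"
        by (rule integrable_const_bound[of _ 2]) (use g0 in auto)
      have f: "finite_measure (distr (density M (\<lambda>x. ennreal (g x))) borel u)"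
      proof (rule finite_measureI)
        have "emeasure (distr (density M (\<lambda>x. ennreal (g x))) borel u) (space (distr (density M (\<lambda>x. ennreal (g x))) borel u))
          = (\<integral>\<^sup>+x. ennreal (g x) \<partial>M)"
          by (subst emeasure_distr) (auto simp: emeasure_density cong: nn_integral_cong)
        also have "\<dots> = ennreal (\<integral>x. g x \<partial>M)"
          using g0 by (intro nn_integral_eq_integral ig) auto
        finally show "emeasure (distr (density M (\<lambda>x. ennreal (g x))) borel u) (space (distr (density M (\<lambda>x. ennreal (g x))) borel u)) \<noteq> \<infinity>"
          by simp
      qed
      have c: "(\<integral>y. cos (s * y + \<tau>) \<partial>distr (density M (\<lambda>x. ennreal (g x))) borel u) =
          (\<integral>x. w x * cos (s * u x + \<tau>) \<partial>M)
          + (\<integral>x. w x * cos ((p x + s * u x) + (\<theta> + \<tau>)) \<partial>M) / 2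
          + (\<integral>x. w x * cos ((p x + (-s) * u x) + (\<theta> - \<tau>)) \<partial>M) / 2" for s \<tau>
      proof -
        have d: "(\<integral>y. cos (s * y + \<tau>) \<partial>distr (density M (\<lambda>x. ennreal (g x))) borel u)
          = (\<integral>x. g x * cos (s * u x + \<tau>) \<partial>M)"
          using g0 by (subst integral_distr) (auto simp: integral_density)
        have e: "g x * cos (s * u x + \<tau>) = w x * cos (s * u x + \<tau>)
          + w x * cos ((p x + s * u x) + (\<theta> + \<tau>)) / 2 + w x * cos ((p x + (-s) * u x) + (\<theta> - \<tau>)) / 2" for x
        proof -
          have "cos ((p x + s * u x) + (\<theta> + \<tau>)) = cos ((p x + \<theta>) + (s * u x + \<tau>))"
            "cos ((p x + (-s) * u x) + (\<theta> - \<tau>)) = cos ((p x + \<theta>) - (s * u x + \<tau>))"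
            by (simp_all add: algebra_simps)
          then have e1: "cos ((p x + s * u x) + (\<theta> + \<tau>)) + cos ((p x + (-s) * u x) + (\<theta> - \<tau>)) = 2 * (cos (p x + \<theta>) * cos (s * u x + \<tau>))"
            using cos_add[of "p x + \<theta>" "s * u x + \<tau>"] cos_diff[of "p x + \<theta>" "s * u x + \<tau>"] by simp
          have e2: "z * (1 + C) * D = z * D + z * a / 2 + z * b / 2" if "a + b = 2 * (C * D)" for a b C D z :: real
          proof -
            have "z * a / 2 + z * b / 2 = z * ((a + b) / 2)" by (simp add: field_simps)
            with that show ?thesis by (simp add: algebra_simps)
          qed
          show ?thesis unfolding g_def by (rule e2[OF e1])
        qed
        have i1: "integrable M (\<lambda>x. w x * cos (s * u x + \<tau>))"
          by (rule iw) measurable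
        have i2: "integrable M (\<lambda>x. w x * cos ((p x + s * u x) + (\<theta> + \<tau>)) / 2)"
          by (rule integrable_divide, rule iw) measurable
        have i3: "integrable M (\<lambda>x. w x * cos ((p x + (-s) * u x) + (\<theta> - \<tau>)) / 2)"
          by (rule integrable_divide, rule iw) measurable
        show ?thesis
          unfolding d e Bochner_Integration.integral_add[OF Bochner_Integration.integrable_add[OF i1 i2] i3]
            Bochner_Integration.integral_add[OF i1 i2] integral_divide_zero ..
      qed
      have "measure (distr (density M (\<lambda>x. ennreal (g x))) borel u) A = 
          (\<integral>y. indicator A y \<partial>distr (density M (\<lambda>x. ennreal (g x))) borel u)"
        by simp
      also have "\<dots> = (\<integral>x. g x * indicator A (u x) \<partial>M)"
          using g0 by (subst integral_distr) (auto simp: integral_density)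
      finally show ?thesis using f c by (simp add: g_def)
    qed
    have mm: "u \<in> borel_measurable M1" "v \<in> borel_measurable M2" "p \<in> borel_measurable M1" "q \<in> borel_measurable M2"
      using meas[OF uv] meas[OF pq] by auto
    note g1 = gen[OF fin(1) mm(1) mm(3) w1]
    note g2 = gen[OF fin(2) mm(2) mm(4) w2]
    have "distr (density M1 (\<lambda>x. ennreal (w1 x * (1 + cos (p x + \<theta>))))) borel u =
        distr (density M2 (\<lambda>x. ennreal (w2 x * (1 + cos (q x + \<theta>))))) borel v"
    proof (rule Levy_uniqueness_finite)
      fix s \<tau>
      have "(\<integral>x. w1 x * cos (s * u x + \<tau>) \<partial>M1) = (\<integral>x. w2 x * cos (s * v x + \<tau>) \<partial>M2)"
        by (rule cos_eq) (rule scale[OF uv])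
      moreover have "(\<integral>x. w1 x * cos ((p x + s * u x) + \<tau>) \<partial>M1) = (\<integral>x. w2 x * cos ((q x + s * v x) + \<tau>) \<partial>M2)" for s \<tau>
        by (rule cos_eq) (rule add[OF pq scale[OF uv]])
      ultimately show "(\<integral>x. cos (s * x + \<tau>) \<partial>distr (density M1 (\<lambda>x. ennreal (w1 x * (1 + cos (p x + \<theta>))))) borel u)
        = (\<integral>x. cos (s * x + \<tau>) \<partial>distr (density M2 (\<lambda>x. ennreal (w2 x * (1 + cos (q x + \<theta>))))) borel v)"
        unfolding g1[THEN conjunct2, THEN conjunct1, rule_format] g2[THEN conjunct2, THEN conjunct1, rule_format] by presburger
    qed (simp_all add: g1[THEN conjunct1] g2[THEN conjunct1])
    then show ?thesis
      unfolding g1[THEN conjunct2, THEN conjunct2, symmetric] g2[THEN conjunct2, THEN conjunct2, symmetric]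
      by (rule arg_cong)
  qed
  have iw: "integrable M (\<lambda>x. w x * indicator A (u x) * cos (h x))" if M: "finite_measure M" and h[measurable]: "h \<in> borel_measurable M"
      and u[measurable]: "u \<in> borel_measurable M" and w[measurable]: "w \<in> borel_measurable M"
      and w01: "\<And>x. 0 \<le> w x \<and> w x \<le> 1" for M :: "'c measure" and h u w :: "'c \<Rightarrow> real"
  proof -
    interpret finite_measure M by fact
    show ?thesis
    proof (rule integrable_const_bound[of _ 1])
      have "\<bar>w x * indicator A (u x) * cos (h x)\<bar> \<le> 1 * 1 * 1" for x
        unfolding abs_mult by (intro mult_mono) (use w01[of x] in \<open>auto split: split_indicator\<close>)
      then show "AE x in M. norm (w x * indicator A (u x) * cos (h x)) \<le> 1" by simp
    qed measurable
  qed
  have mm: "u \<in> borel_measurable M1" "v \<in> borel_measurable M2" "p \<in> borel_measurable M1" "q \<in> borel_measurable M2"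
      using meas[OF uv] meas[OF pq] by auto
  \<comment> \<open>The zero pair with phase 0 turns the factor \<open>1 + cos\<close> into the
    constant 2, so the integrals without a cosine agree. Subtracting them from \<open>*\<close>
    isolates the cosine term.\<close>
  have z: "(\<lambda>x. 0 * u x, \<lambda>x. 0 * v x) \<in> L" by (rule scale[OF uv])
  have "(\<integral>x. w1 x * indicator A (u x) \<partial>M1) = (\<integral>x. w2 x * indicator A (v x) \<partial>M2)"
    using *[OF z, of 0] by (simp add: mult.assoc mult.left_commute[of _ "2::real"])
  moreover have "w * (1 + cos z) * i = w * i + w * i * cos z" for w z i :: real
    by (simp add: algebra_simps)
  ultimately show ?thesis
    using *[OF pq, of \<theta>] iw[OF fin(1) _ mm(1) w1, of "\<lambda>x. p x + \<theta>"] iw[OF fin(2) _ mm(2) w2, of "\<lambda>x. q x + \<theta>"]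
      iw[OF fin(1) _ mm(1) w1, of "\<lambda>x. 0"] iw[OF fin(2) _ mm(2) w2, of "\<lambda>x. 0"] mm
    by simp
qed

section \<open>Finitely supported functionals and uniqueness of laws\<close>

text \<open>Defined as a span in the function space, so that closure and induction come from linear
  algebra. It is used with two kinds of index: countable ones, where its members test laws of random
  sequences, and \<open>'t\<close>, where a member is a finite combination of evaluations.\<close>

definition coord_functionals :: "(('i \<Rightarrow> real) \<Rightarrow> real) set"
  where "coord_functionals = span (range (\<lambda>i x. x i))"

lemma coord_functionals_eval: "(\<lambda>x. x i) \<in> coord_functionals"
  unfolding coord_functionals_def by (rule span_base) auto

lemma coord_functionals_add:
  "\<phi> \<in> coord_functionals \<Longrightarrow> \<psi> \<in> coord_functionals \<Longrightarrow> (\<lambda>x. \<phi> x + \<psi> x) \<in> coord_functionals"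
  using span_add[of \<phi> _ \<psi>] unfolding coord_functionals_def plus_fun_def by blast

lemma coord_functionals_scale:
  "\<phi> \<in> coord_functionals \<Longrightarrow> (\<lambda>x. c * \<phi> x) \<in> coord_functionals"
  using span_scale[of \<phi> _ c] unfolding coord_functionals_def scaleR_fun_def by (simp add: real_scaleR_def)

lemma coord_functionals_zero: "(\<lambda>x. 0) \<in> coord_functionals"
  using coord_functionals_scale[OF coord_functionals_eval, of 0] by simp

lemma coord_functionals_diff:
  "\<phi> \<in> coord_functionals \<Longrightarrow> \<psi> \<in> coord_functionals \<Longrightarrow> (\<lambda>x. \<phi> x - \<psi> x) \<in> coord_functionals"
  using coord_functionals_add[OF _ coord_functionals_scale, of \<phi> \<psi> "-1"] by simp

lemma coord_functionals_induct [consumes 1, case_names eval zero add scale]: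
  assumes "\<phi> \<in> coord_functionals"
    and "\<And>i. P (\<lambda>x. x i)" and "P (\<lambda>x. 0)"
    and "\<And>\<phi> \<psi>. \<phi> \<in> coord_functionals \<Longrightarrow> \<psi> \<in> coord_functionals \<Longrightarrow> P \<phi> \<Longrightarrow> P \<psi> \<Longrightarrow> P (\<lambda>x. \<phi> x + \<psi> x)"
    and "\<And>c \<phi>. \<phi> \<in> coord_functionals \<Longrightarrow> P \<phi> \<Longrightarrow> P (\<lambda>x. c * \<phi> x)"
  shows "P \<phi>"
proof -
  have "subspace {\<phi> \<in> coord_functionals. P \<phi>}"
    unfolding subspace_def plus_fun_def scaleR_fun_def zero_fun_def real_scaleR_def
    using assms(3-5) coord_functionals_zero coord_functionals_add coord_functionals_scale by auto
  then have "coord_functionals \<subseteq> {\<phi> \<in> coord_functionals. P \<phi>}"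
    unfolding coord_functionals_def
    by (intro span_minimal) (use assms(2) coord_functionals_eval in \<open>auto simp: coord_functionals_def\<close>)
  with assms(1) show ?thesis by auto
qed

lemma coord_functionals_linear:
  assumes "\<phi> \<in> coord_functionals"
  shows "\<phi> (a + b) = \<phi> a + \<phi> b" "\<phi> (\<lambda>i. a i + b i) = \<phi> a + \<phi> b"
    "\<phi> (c *\<^sub>R a) = c * \<phi> a" "\<phi> (\<lambda>i. c * a i) = c * \<phi> a"
    "\<phi> (a - b) = \<phi> a - \<phi> b" "\<phi> (\<lambda>i. a i - b i) = \<phi> a - \<phi> b" "\<phi> 0 = 0" "\<phi> (\<lambda>i. 0) = 0"
  using assms by (induction rule: coord_functionals_induct)
    (auto simp: scaleR_fun_def distrib_left right_diff_distrib)

lemma coord_functionals_explicit: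
  assumes "\<phi> \<in> coord_functionals"
  shows "\<exists>J c. finite J \<and> \<phi> = (\<lambda>x. \<Sum>i\<in>J. c i * x i)"
  using assms
proof (induction rule: coord_functionals_induct)
  case (eval i)
  show ?case by (rule exI[of _ "{i}"], rule exI[of _ "\<lambda>_. 1"]) auto
next
  case zero
  show ?case by (rule exI[of _ "{}"]) auto
next
  case (add \<phi> \<psi>)
  then obtain J c J' c' where *: "finite J" "\<phi> = (\<lambda>x. \<Sum>i\<in>J. c i * x i)"
    "finite J'" "\<psi> = (\<lambda>x. \<Sum>i\<in>J'. c' i * x i)" by blast
  have "(\<Sum>i\<in>J. c i * x i) = (\<Sum>i\<in>J \<union> J'. (if i \<in> J then c i else 0) * x i)" for x
    using * by (intro sum.mono_neutral_cong_left) auto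
  moreover have "(\<Sum>i\<in>J'. c' i * x i) = (\<Sum>i\<in>J \<union> J'. (if i \<in> J' then c' i else 0) * x i)" for x
    using * by (intro sum.mono_neutral_cong_left) auto
  ultimately have "(\<lambda>x. \<phi> x + \<psi> x) = (\<lambda>x. \<Sum>i\<in>J \<union> J'. ((if i \<in> J then c i else 0) + (if i \<in> J' then c' i else 0)) * x i)"
    using * by (simp add: algebra_simps sum.distrib)
  with * show ?case
    by (intro exI[of _ "J \<union> J'"] exI[of _ "\<lambda>i. (if i \<in> J then c i else 0) + (if i \<in> J' then c' i else 0)"]) simp
next
  case (scale c \<phi>)
  then obtain J d where *: "finite J" "\<phi> = (\<lambda>x. \<Sum>i\<in>J. d i * x i)" by blast
  then have "(\<lambda>x. c * \<phi> x) = (\<lambda>x. \<Sum>i\<in>J. (c * d i) * x i)" by (simp add: sum_distrib_left mult_ac)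
  with * show ?case by (intro exI[of _ J] exI[of _ "\<lambda>i. c * d i"]) simp
qed

lemma coord_functionals_continuous:
  assumes "\<phi> \<in> coord_functionals"
  shows "continuous_on A \<phi>"
  using assms
  by (induction rule: coord_functionals_induct)
     (auto intro!: continuous_intros continuous_on_subset[OF continuous_on_product_coordinates])

lemma coord_functionals_measurable:
  assumes "\<phi> \<in> coord_functionals"
  shows "\<phi> \<in> borel_measurable borel"
  using coord_functionals_continuous[OF assms] by (rule borel_measurable_continuous_onI)

text \<open>Each application of the weighted step turns one coordinate into an indicator factor
  while the cosine stays arbitrary, which keeps the induction going. The zero functional finally
  removes the cosine and leaves the measures of cylinder sets; these determine the law because for
  countably many coordinates the product and the Borel \<sigma>-algebra coincide.\<close>

lemma law_eqI:
  fixes U :: "'a \<Rightarrow> 'i::countable \<Rightarrow> real" and V :: "'b \<Rightarrow> 'i \<Rightarrow> real"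
  assumes p: "prob_space M1" "prob_space M2"
    and U[measurable]: "U \<in> borel_measurable M1" and V[measurable]: "V \<in> borel_measurable M2"
    and cos_eq: "\<And>\<phi> \<theta>. \<phi> \<in> coord_functionals \<Longrightarrow>
      (\<integral>x. cos (\<phi> (U x) + \<theta>) \<partial>M1) = (\<integral>x. cos (\<phi> (V x) + \<theta>) \<partial>M2)"
  shows "distr M1 borel U = distr M2 borel V"
proof -
  interpret M1: prob_space M1 by fact
  interpret M2: prob_space M2 by fact
  define L where "L = (\<lambda>\<phi>. (\<lambda>x. \<phi> (U x), \<lambda>x. \<phi> (V x))) ` coord_functionals"
  have Lm: "u \<in> borel_measurable M1 \<and> v \<in> borel_measurable M2" if "(u, v) \<in> L" for u v
    using that coord_functionals_measurable measurable_compose[OF U] measurable_compose[OF V]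
    unfolding L_def by auto
  have La: "(\<lambda>x. u x + u' x, \<lambda>x. v x + v' x) \<in> L" if uv: "(u, v) \<in> L" "(u', v') \<in> L" for u v u' v'
  proof -
    obtain \<phi> \<psi> where "\<phi> \<in> coord_functionals" "\<psi> \<in> coord_functionals" "u = (\<lambda>x. \<phi> (U x))" "v = (\<lambda>x. \<phi> (V x))"
      "u' = (\<lambda>x. \<psi> (U x))" "v' = (\<lambda>x. \<psi> (V x))" using uv unfolding L_def by auto
    then show ?thesis unfolding L_def using coord_functionals_add[of \<phi> \<psi>] by (intro image_eqI[of _ _ "\<lambda>x. \<phi> x + \<psi> x"]) auto
  qed
  have Ls: "(\<lambda>x. c * u x, \<lambda>x. c * v x) \<in> L" if uv: "(u, v) \<in> L" for u v c
  proof -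
    obtain \<phi> where "\<phi> \<in> coord_functionals" "u = (\<lambda>x. \<phi> (U x))" "v = (\<lambda>x. \<phi> (V x))"
      using uv unfolding L_def by auto
    then show ?thesis unfolding L_def using coord_functionals_scale[of \<phi> c] by (intro image_eqI[of _ _ "\<lambda>x. c * \<phi> x"]) auto
  qed
  have main: "(\<integral>x. (\<Prod>j\<in>J. indicator (A j) (U x j)) * cos (p x + \<theta>) \<partial>M1) =
      (\<integral>x. (\<Prod>j\<in>J. indicator (A j) (V x j)) * cos (q x + \<theta>) \<partial>M2)"
    if "finite J" "(p, q) \<in> L" and Am: "\<And>j. A j \<in> sets borel" for J p q \<theta> and A :: "'i \<Rightarrow> real set"
    using that(1,2)
  proof (induction J arbitrary: p q \<theta> rule: finite_induct)
    case empty
    then show ?case using cos_eq by (auto simp: L_def)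
  next
    case (insert i J)
    note [measurable] = Am
    have mU[measurable]: "(\<lambda>x. U x i) \<in> borel_measurable M1" "(\<lambda>x. V x i) \<in> borel_measurable M2" for i
      using measurable_product_then_coordinatewise[OF U] measurable_product_then_coordinatewise[OF V] by auto
    have b: "(0::real) \<le> (\<Prod>j\<in>J. indicator (A j) (W j)) \<and> (\<Prod>j\<in>J. indicator (A j) (W j)) \<le> (1::real)" for W :: "'i \<Rightarrow> real"
      by (auto intro!: prod_nonneg prod_le_1)
    have "(\<integral>x. (\<Prod>j\<in>J. indicator (A j) (U x j)) * indicator (A i) (U x i) * cos (p x + \<theta>) \<partial>M1) =
      (\<integral>x. (\<Prod>j\<in>J. indicator (A j) (V x j)) * indicator (A i) (V x i) * cos (q x + \<theta>) \<partial>M2)"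
    proof (rule weighted_cos_integral_step[OF M1.finite_measure_axioms M2.finite_measure_axioms Lm La Ls _ b _ b insert.IH _ Am insert.prems(1)])
      show "(\<lambda>x. U x i, \<lambda>x. V x i) \<in> L"
        unfolding L_def by (rule image_eqI[OF _ coord_functionals_eval]) auto
    qed auto
    then show ?case using insert.hyps by (simp add: mult_ac)
  qed
  have zL: "(\<lambda>x. 0, \<lambda>x. 0) \<in> L"
    unfolding L_def by (rule image_eqI[OF _ coord_functionals_zero]) auto
  have sP: "sets (PiM UNIV (\<lambda>_::'i. borel :: real measure)) = sets borel" by (rule sets_PiM_equal_borel)
  show ?thesis
  proof (rule measure_eqI_PiM_infinite[where I=UNIV and M="\<lambda>_. borel"])
    fix A :: "'i \<Rightarrow> real set" and J :: "'i set"
    assume J: "finite J" and "\<And>i. i \<in> J \<Longrightarrow> A i \<in> sets borel"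
    \<comment> \<open>\<open>main\<close> asks for Borel sets at every index, whereas
      \<open>A\<close> is controlled on \<open>J\<close> only.\<close>
    define B where "B = (\<lambda>j. if j \<in> J then A j else {})"
    have B[measurable]: "B j \<in> sets borel" for j using \<open>\<And>i. i \<in> J \<Longrightarrow> A i \<in> sets borel\<close> by (auto simp: B_def)
    define C where "C = {w::'i \<Rightarrow> real. \<forall>j\<in>J. w j \<in> B j}"
    have emb: "prod_emb UNIV (\<lambda>_. borel) J (Pi\<^sub>E J A) = C"
      by (auto simp: prod_emb_def C_def B_def PiE_def Pi_def extensional_def restrict_def)
    have C: "C \<in> sets borel"
    proof -
      have "prod_emb UNIV (\<lambda>_. borel) J (Pi\<^sub>E J A) \<in> sets (PiM UNIV (\<lambda>_::'i. borel :: real measure))"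
        using J \<open>\<And>i. i \<in> J \<Longrightarrow> A i \<in> sets borel\<close> by (intro sets_PiM_I) auto
      then show ?thesis using emb sP by auto
    qed
    have i: "(\<Prod>j\<in>J. indicator (B j) (w j)) = (indicator C w :: real)" for w
      using J by (auto simp: C_def indicator_def)
    have mC: "emeasure (distr M borel W) C = ennreal (\<integral>x. (\<Prod>j\<in>J. indicator (B j) (W x j)) * cos (0 + 0) \<partial>M)"
      if "prob_space M" and W[measurable]: "W \<in> borel_measurable M" for M :: "'c measure" and W :: "'c \<Rightarrow> 'i \<Rightarrow> real"
    proof -
      interpret prob_space M by fact
      interpret W: prob_space "distr M borel W" by (rule prob_space_distr) fact
      have "emeasure (distr M borel W) C = ennreal (\<integral>w. indicator C w \<partial>distr M borel W)"
        using C by (simp add: W.emeasure_eq_measure)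
      also have "(\<integral>w. indicator C w \<partial>distr M borel W) = (\<integral>x. indicator C (W x) \<partial>M :: real)"
        using C by (subst integral_distr) auto
      finally show ?thesis by (simp add: i)
    qed
    show "emeasure (distr M1 borel U) (prod_emb UNIV (\<lambda>_. borel) J (Pi\<^sub>E J A)) =
      emeasure (distr M2 borel V) (prod_emb UNIV (\<lambda>_. borel) J (Pi\<^sub>E J A))"
      unfolding emb mC[OF p(1) U] mC[OF p(2) V] using main[OF J zL, of B 0] B by simp
  qed (auto simp: sP M1.prob_space_distr prob_space.finite_measure)
qed

section \<open>Centered Gaussian random variables\<close>

definition cgauss :: "'a measure \<Rightarrow> ('a \<Rightarrow> real) \<Rightarrow> bool"
  where "cgauss M u \<longleftrightarrow> u \<in> borel_measurable M \<and> centered_gaussian_real (distr M borel u)"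

lemma cgauss_measurable: "cgauss M u \<Longrightarrow> u \<in> borel_measurable M"
  by (simp add: cgauss_def)

lemma char_normal_density:
  assumes "\<sigma> > 0"
  shows "char (density lborel (normal_density 0 \<sigma>)) s = complex_of_real (exp (- (s\<^sup>2 * \<sigma>\<^sup>2 / 2)))"
proof -
  interpret real_distribution std_normal_distribution by (rule real_dist_normal_dist)
  have "distributed std_normal_distribution lborel (\<lambda>x. x) std_normal_density"
    unfolding distributed_def by (auto simp: distr_id2)
  from normal_density_affine[OF this, of \<sigma> 0]
  have "density lborel (normal_density 0 \<sigma>) = distr std_normal_distribution lborel (\<lambda>x. \<sigma> * x)"
    using assms unfolding distributed_def by simp
  then have "char (density lborel (normal_density 0 \<sigma>)) s = char std_normal_distribution (s * \<sigma>)"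
    unfolding char_def by (simp add: integral_distr mult.assoc)
  then show ?thesis
    unfolding char_std_normal_distribution by (simp add: power_mult_distrib)
qed

lemma char_distr: "u \<in> borel_measurable M \<Longrightarrow> char (distr M borel u) s = (\<integral>x. iexp (s * u x) \<partial>M)"
  unfolding char_def by (subst integral_distr) auto

lemma cgauss_properties:
  assumes M: "prob_space M" and u: "cgauss M u"
  shows "integrable M (\<lambda>x. (u x)\<^sup>2)" "integrable M u" "(\<integral>x. u x \<partial>M) = 0"
    "char (distr M borel u) s = complex_of_real (exp (- (s\<^sup>2 * (\<integral>x. (u x)\<^sup>2 \<partial>M) / 2)))"
proof -
  interpret prob_space M by fact
  have um[measurable]: "u \<in> borel_measurable M" using u by (simp add: cgauss_def)
  have "integrable M (\<lambda>x. (u x)\<^sup>2) \<and> integrable M u \<and> (\<integral>x. u x \<partial>M) = 0 \<and>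
    char (distr M borel u) s = complex_of_real (exp (- (s\<^sup>2 * (\<integral>x. (u x)\<^sup>2 \<partial>M) / 2)))"
  proof (cases "distr M borel u = return borel 0")
    case True
    have "AE x in distr M borel u. x = 0" unfolding True by (subst AE_return) auto
    then have z: "AE x in M. u x = 0" by (subst (asm) AE_distr_iff) auto
    have "integrable M (\<lambda>x. (u x)\<^sup>2) = integrable M (\<lambda>x. 0::real)"
      using z by (intro integrable_cong_AE) auto
    moreover have "integrable M u = integrable M (\<lambda>x. 0::real)"
      using z by (intro integrable_cong_AE) auto
    moreover have "(\<integral>x. (u x)\<^sup>2 \<partial>M) = (\<integral>x. 0 \<partial>M)"
      using z by (intro integral_cong_AE) auto
    moreover have "(\<integral>x. u x \<partial>M) = (\<integral>x. 0 \<partial>M)"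
      using z by (intro integral_cong_AE) auto
    moreover have "char (distr M borel u) s = 1"
      unfolding True char_def by (subst integral_return) auto
    ultimately show ?thesis by simp
  next
    case False
    then obtain \<sigma> where \<sigma>: "\<sigma> > 0" "distr M borel u = density lborel (normal_density 0 \<sigma>)"
      using u unfolding cgauss_def centered_gaussian_real_def by auto
    have i: "integrable (distr M borel u) (\<lambda>x. x ^ k)" for k
      unfolding \<sigma> using integrable_normal_moment[OF \<sigma>(1), of 0 k]
      by (subst integrable_real_density) auto
    have "(\<integral>x. x ^ 2 \<partial>distr M borel u) = \<sigma>\<^sup>2"
      unfolding \<sigma> using integral_normal_moment_even[OF \<sigma>(1), of 0 1]
      by (subst integral_real_density) auto
    then have v: "(\<integral>x. (u x)\<^sup>2 \<partial>M) = \<sigma>\<^sup>2" by (subst (asm) integral_distr) auto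
    have "(\<integral>x. x ^ 1 \<partial>distr M borel u) = 0"
      unfolding \<sigma> using integral_normal_moment_odd[OF \<sigma>(1), of 0 0]
      by (subst integral_real_density) auto
    then have "(\<integral>x. u x \<partial>M) = 0" by (subst (asm) integral_distr) auto
    moreover have "integrable M (\<lambda>x. (u x)\<^sup>2)" "integrable M u"
      using i[of 2] i[of 1] by (auto simp: integrable_distr_eq)
    moreover have "char (distr M borel u) s = complex_of_real (exp (- (s\<^sup>2 * \<sigma>\<^sup>2 / 2)))"
      unfolding \<sigma>(2) by (rule char_normal_density[OF \<sigma>(1)])
    ultimately show ?thesis using v by simp
  qed
  then show "integrable M (\<lambda>x. (u x)\<^sup>2)" "integrable M u" "(\<integral>x. u x \<partial>M) = 0"
    "char (distr M borel u) s = complex_of_real (exp (- (s\<^sup>2 * (\<integral>x. (u x)\<^sup>2 \<partial>M) / 2)))" by auto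
qed

text \<open>Only the second moment of \<open>u\<close> enters the right-hand side. This is why equal
  variances of projections suffice for equal laws.\<close>

lemma cgauss_cos:
  assumes M: "prob_space M" and u: "cgauss M u"
  shows "(\<integral>x. cos (u x + \<theta>) \<partial>M) = cos \<theta> * exp (- ((\<integral>x. (u x)\<^sup>2 \<partial>M) / 2))"
proof -
  interpret prob_space M by fact
  have um[measurable]: "u \<in> borel_measurable M" using u by (simp add: cgauss_def)
  have i: "integrable M (\<lambda>x. iexp (u x))" by (rule integrable_iexp) auto
  have ic: "integrable M (\<lambda>x. cos (u x))" "integrable M (\<lambda>x. sin (u x))"
    by (rule integrable_const_bound[of _ 1]; simp)+
  have e: "(\<integral>x. iexp (u x) \<partial>M) = complex_of_real (exp (- ((\<integral>x. (u x)\<^sup>2 \<partial>M) / 2)))"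
    using cgauss_properties(4)[OF M u, of 1] by (simp add: char_distr)
  have "(\<integral>x. cos (u x) \<partial>M) = Re (\<integral>x. iexp (u x) \<partial>M)"
    using integral_Re[OF i] by (simp add: Re_exp)
  moreover have "(\<integral>x. sin (u x) \<partial>M) = Im (\<integral>x. iexp (u x) \<partial>M)"
    using integral_Im[OF i] by (simp add: Im_exp)
  ultimately show ?thesis unfolding e cos_add using ic by simp
qed

text \<open>The characteristic function identifies the law, with \<open>v = 0\<close> giving the
  point mass. Knowing that \<open>u\<close> is Gaussian, its second moment is found by comparing
  exponents at frequency 1.\<close>

lemma cgaussI:
  assumes M: "prob_space M" and um: "u \<in> borel_measurable M" and v: "0 \<le> v"
    and ch: "\<And>s. char (distr M borel u) s = complex_of_real (exp (- (s\<^sup>2 * v / 2)))"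
  shows "cgauss M u" "(\<integral>x. (u x)\<^sup>2 \<partial>M) = v"
proof -
  interpret prob_space M by fact
  note [measurable] = um
  have d: "real_distribution (distr M borel u)"
    by (simp add: real_distribution_def real_distribution_axioms_def prob_space_distr)
  have "centered_gaussian_real (distr M borel u)"
  proof (cases "v = 0")
    case True
    have r: "real_distribution (return borel (0::real))"
      by (simp add: real_distribution_def real_distribution_axioms_def prob_space_return)
    have "char (return borel (0::real)) s = 1" for s
      unfolding char_def by (subst integral_return) auto
    then have "distr M borel u = return borel 0"
      by (intro Levy_uniqueness d r) (simp add: fun_eq_iff ch True)
    then show ?thesis by (simp add: centered_gaussian_real_def)
  next
    case False
    with v have p: "sqrt v > 0" by simp
    have r: "real_distribution (density lborel (normal_density 0 (sqrt v)))"
      by (simp add: real_distribution_def real_distribution_axioms_def prob_space_normal_density[OF p])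
    have "distr M borel u = density lborel (normal_density 0 (sqrt v))"
      by (intro Levy_uniqueness d r) (use p v in \<open>simp add: fun_eq_iff ch char_normal_density\<close>)
    then show ?thesis using p unfolding centered_gaussian_real_def by blast
  qed
  then show g: "cgauss M u" by (simp add: cgauss_def)
  have "complex_of_real (exp (- (1\<^sup>2 * (\<integral>x. (u x)\<^sup>2 \<partial>M) / 2))) = complex_of_real (exp (- (1\<^sup>2 * v / 2)))"
    using ch[of 1] cgauss_properties(4)[OF M g, of 1] by metis
  then show "(\<integral>x. (u x)\<^sup>2 \<partial>M) = v" by simp
qed

lemma cgauss_scale:
  assumes M: "prob_space M" and u: "cgauss M u"
  shows "cgauss M (\<lambda>x. c * u x)"
proof -
  note um[measurable] = cgauss_measurable[OF u]
  have "char (distr M borel (\<lambda>x. c * u x)) s = complex_of_real (exp (- (s\<^sup>2 * (c\<^sup>2 * (\<integral>x. (u x)\<^sup>2 \<partial>M)) / 2)))" for s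
    using cgauss_properties(4)[OF M u, of "s * c"]
    by (simp add: char_distr mult.assoc power_mult_distrib)
  from cgaussI(1)[OF M _ _ this] show ?thesis by simp
qed

lemma cgauss_add_prod:
  assumes M: "prob_space M1" "prob_space M2" and u: "cgauss M1 u" and w: "cgauss M2 w"
  shows "cgauss (M1 \<Otimes>\<^sub>M M2) (\<lambda>z. u (fst z) + w (snd z))"
    "(\<integral>z. (u (fst z) + w (snd z))\<^sup>2 \<partial>(M1 \<Otimes>\<^sub>M M2)) = (\<integral>x. (u x)\<^sup>2 \<partial>M1) + (\<integral>x. (w x)\<^sup>2 \<partial>M2)"
proof -
  interpret M1: prob_space M1 by fact
  interpret M2: prob_space M2 by fact
  interpret P: pair_prob_space M1 M2 by standard
  note [measurable] = cgauss_measurable[OF u] cgauss_measurable[OF w]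
  have "char (distr (M1 \<Otimes>\<^sub>M M2) borel (\<lambda>z. u (fst z) + w (snd z))) s =
    complex_of_real (exp (- (s\<^sup>2 * ((\<integral>x. (u x)\<^sup>2 \<partial>M1) + (\<integral>x. (w x)\<^sup>2 \<partial>M2)) / 2)))" for s
  proof -
    have i: "integrable (M1 \<Otimes>\<^sub>M M2) (\<lambda>z. iexp (s * (u (fst z) + w (snd z))))"
      by (rule P.integrable_iexp) auto
    have "char (distr (M1 \<Otimes>\<^sub>M M2) borel (\<lambda>z. u (fst z) + w (snd z))) s =
      (\<integral>x. \<integral>y. iexp (s * (u (fst (x, y)) + w (snd (x, y)))) \<partial>M2 \<partial>M1)"
      by (subst P.integral_fst'[OF i]) (simp add: char_distr)
    also have "\<dots> = (\<integral>x. \<integral>y. iexp (s * u x) * iexp (s * w y) \<partial>M2 \<partial>M1)"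
      by (simp add: exp_add[symmetric] algebra_simps)
    also have "\<dots> = (\<integral>x. iexp (s * u x) \<partial>M1) * (\<integral>y. iexp (s * w y) \<partial>M2)"
      by simp
    also have "\<dots> = complex_of_real (exp (- (s\<^sup>2 * (\<integral>x. (u x)\<^sup>2 \<partial>M1) / 2))) * complex_of_real (exp (- (s\<^sup>2 * (\<integral>x. (w x)\<^sup>2 \<partial>M2) / 2)))"
      using cgauss_properties(4)[OF M(1) u, of s] cgauss_properties(4)[OF M(2) w, of s] by (simp add: char_distr)
    also have "\<dots> = complex_of_real (exp (- (s\<^sup>2 * (\<integral>x. (u x)\<^sup>2 \<partial>M1) / 2)) * exp (- (s\<^sup>2 * (\<integral>x. (w x)\<^sup>2 \<partial>M2) / 2)))"
      by simp
    finally show ?thesis unfolding exp_add[symmetric] by (simp add: algebra_simps add_divide_distrib)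
  qed
  note * = cgaussI[OF P.prob_space_axioms _ _ this]
  show "cgauss (M1 \<Otimes>\<^sub>M M2) (\<lambda>z. u (fst z) + w (snd z))"
    "(\<integral>z. (u (fst z) + w (snd z))\<^sup>2 \<partial>(M1 \<Otimes>\<^sub>M M2)) = (\<integral>x. (u x)\<^sup>2 \<partial>M1) + (\<integral>x. (w x)\<^sup>2 \<partial>M2)"
    by (rule *; auto)+
qed

text \<open>Characteristic functions converge by dominated convergence, exponentials being bounded.
  The second moment of the limit is then read off from its law and not from a common bound on the
  \<open>u n\<close>.\<close>

lemma cgauss_limit:
  assumes M: "prob_space M" and un: "\<And>n. cgauss M (u n)" and um: "w \<in> borel_measurable M"
    and conv: "AE x in M. (\<lambda>n. u n x) \<longlonglongrightarrow> w x"
    and v: "(\<lambda>n. \<integral>x. (u n x)\<^sup>2 \<partial>M) \<longlonglongrightarrow> v"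
  shows "cgauss M w" "(\<integral>x. (w x)\<^sup>2 \<partial>M) = v"
proof -
  interpret prob_space M by fact
  note [measurable] = um cgauss_measurable[OF un]
  have ch: "char (distr M borel w) s = complex_of_real (exp (- (s\<^sup>2 * v / 2)))" for s
  proof -
    have "(\<lambda>n. \<integral>x. iexp (s * u n x) \<partial>M) \<longlonglongrightarrow> (\<integral>x. iexp (s * w x) \<partial>M)"
    proof (rule integral_dominated_convergence[where w="\<lambda>_. 1"])
      show "AE x in M. (\<lambda>n. iexp (s * u n x)) \<longlonglongrightarrow> iexp (s * w x)"
        using conv by eventually_elim (intro tendsto_intros)
    qed auto
    moreover have "(\<integral>x. iexp (s * u n x) \<partial>M) = complex_of_real (exp (- (s\<^sup>2 * (\<integral>x. (u n x)\<^sup>2 \<partial>M) / 2)))" for n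
      using cgauss_properties(4)[OF M un] by (simp add: char_distr)
    moreover have "(\<lambda>n. complex_of_real (exp (- (s\<^sup>2 * (\<integral>x. (u n x)\<^sup>2 \<partial>M) / 2)))) \<longlonglongrightarrow> complex_of_real (exp (- (s\<^sup>2 * v / 2)))"
      by (intro tendsto_intros v) simp
    ultimately have "(\<integral>x. iexp (s * w x) \<partial>M) = complex_of_real (exp (- (s\<^sup>2 * v / 2)))"
      using LIMSEQ_unique by auto
    then show ?thesis by (simp add: char_distr)
  qed
  have "v \<ge> 0" by (rule LIMSEQ_le_const[OF v]) auto
  note * = cgaussI[OF M um this ch]
  show "cgauss M w" "(\<integral>x. (w x)\<^sup>2 \<partial>M) = v" by (fact *)+
qed

lemma cgauss_distr:
  assumes "f \<in> measurable M N" "u \<in> borel_measurable N"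
  shows "cgauss (distr M N f) u \<longleftrightarrow> cgauss M (\<lambda>x. u (f x))"
  using assms distr_distr[OF assms(2,1)] measurable_compose[OF assms]
  unfolding cgauss_def by (simp add: comp_def)

text \<open>The Cramer-Wold principle for centered Gaussian sequences: each projection has a law
  fixed by its variance.\<close>

lemma law_eq_gaussI:
  fixes U :: "'a \<Rightarrow> 'i::countable \<Rightarrow> real" and V :: "'b \<Rightarrow> 'i \<Rightarrow> real"
  assumes p: "prob_space M1" "prob_space M2"
    and U: "U \<in> borel_measurable M1" and V: "V \<in> borel_measurable M2"
    and gauss: "\<And>\<phi>. \<phi> \<in> coord_functionals \<Longrightarrow> cgauss M1 (\<lambda>x. \<phi> (U x)) \<and> cgauss M2 (\<lambda>x. \<phi> (V x))
      \<and> (\<integral>x. (\<phi> (U x))\<^sup>2 \<partial>M1) = (\<integral>x. (\<phi> (V x))\<^sup>2 \<partial>M2)"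
  shows "distr M1 borel U = distr M2 borel V"
proof (rule law_eqI[OF p U V])
  fix \<phi> :: "('i \<Rightarrow> real) \<Rightarrow> real" and \<theta> assume "\<phi> \<in> coord_functionals"
  from gauss[OF this] show "(\<integral>x. cos (\<phi> (U x) + \<theta>) \<partial>M1) = (\<integral>x. cos (\<phi> (V x) + \<theta>) \<partial>M2)"
    by (simp add: cgauss_cos[OF p(1)] cgauss_cos[OF p(2)])
qed

section \<open>Hilbert spaces on a carrier and the reproducing kernel Hilbert space\<close>

text \<open>Carrier and inner product depend on the kernel, so they are locale parameters and not a
  type; this is why the rules below carry membership assumptions.\<close>

locale ip_space =
  fixes H :: "'h::real_vector set" and ip :: "'h \<Rightarrow> 'h \<Rightarrow> real"
  assumes subspace_H: "subspace H" and inner_product_on_H: "inner_product_on H ip"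
begin

lemma mem [simp, intro]:
  "0 \<in> H" "x \<in> H \<Longrightarrow> y \<in> H \<Longrightarrow> x + y \<in> H" "x \<in> H \<Longrightarrow> c *\<^sub>R x \<in> H"
  "x \<in> H \<Longrightarrow> y \<in> H \<Longrightarrow> x - y \<in> H" "x \<in> H \<Longrightarrow> - x \<in> H"
  using subspace_H by (auto simp: subspace_0 subspace_add subspace_scale subspace_diff subspace_neg)

lemma mem_sum [intro]: "(\<And>i. i \<in> I \<Longrightarrow> x i \<in> H) \<Longrightarrow> (\<Sum>i\<in>I. x i) \<in> H"
  using subspace_sum[OF subspace_H] by blast

lemma ip_commute: "x \<in> H \<Longrightarrow> y \<in> H \<Longrightarrow> ip x y = ip y x"
  using inner_product_on_H by (auto simp: inner_product_on_def)

lemma ip_add_left: "x \<in> H \<Longrightarrow> y \<in> H \<Longrightarrow> z \<in> H \<Longrightarrow> ip (x + y) z = ip x z + ip y z"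
  using inner_product_on_H by (auto simp: inner_product_on_def)

lemma ip_scale_left: "x \<in> H \<Longrightarrow> y \<in> H \<Longrightarrow> ip (c *\<^sub>R x) y = c * ip x y"
  using inner_product_on_H by (auto simp: inner_product_on_def)

lemma ip_nonneg: "x \<in> H \<Longrightarrow> 0 \<le> ip x x"
  using inner_product_on_H by (auto simp: inner_product_on_def)

lemma ip_eq_0: "x \<in> H \<Longrightarrow> ip x x = 0 \<Longrightarrow> x = 0"
  using inner_product_on_H by (auto simp: inner_product_on_def)

lemma ip_add_right: "x \<in> H \<Longrightarrow> y \<in> H \<Longrightarrow> z \<in> H \<Longrightarrow> ip z (x + y) = ip z x + ip z y"
  using ip_add_left[of x y z] ip_commute by simp

lemma ip_scale_right: "x \<in> H \<Longrightarrow> y \<in> H \<Longrightarrow> ip y (c *\<^sub>R x) = c * ip y x"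
  using ip_scale_left[of x y c] ip_commute by simp

lemma ip_minus_left: "x \<in> H \<Longrightarrow> y \<in> H \<Longrightarrow> ip (- x) y = - ip x y"
  using ip_scale_left[of x y "-1"] by simp

lemma ip_minus_right: "x \<in> H \<Longrightarrow> y \<in> H \<Longrightarrow> ip y (- x) = - ip y x"
  using ip_scale_right[of x y "-1"] by simp

lemma ip_diff_left: "x \<in> H \<Longrightarrow> y \<in> H \<Longrightarrow> z \<in> H \<Longrightarrow> ip (x - y) z = ip x z - ip y z"
  using ip_add_left[of x "-y" z] ip_minus_left[of y z] by simp

lemma ip_diff_right: "x \<in> H \<Longrightarrow> y \<in> H \<Longrightarrow> z \<in> H \<Longrightarrow> ip z (x - y) = ip z x - ip z y"
  using ip_add_right[of x "-y" z] ip_minus_right[of y z] by simp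

lemma ip_zero_left [simp]: "x \<in> H \<Longrightarrow> ip 0 x = 0"
  using ip_scale_left[of x x 0] by simp

lemma ip_zero_right [simp]: "x \<in> H \<Longrightarrow> ip x 0 = 0"
  using ip_scale_right[of x x 0] by simp

lemmas ip_bilinear = ip_add_left ip_add_right ip_scale_left ip_scale_right ip_diff_left ip_diff_right

lemma ip_sum_left:
  assumes "\<And>i. i \<in> I \<Longrightarrow> x i \<in> H" "y \<in> H"
  shows "ip (\<Sum>i\<in>I. x i) y = (\<Sum>i\<in>I. ip (x i) y)"
  using assms
proof (induction I rule: infinite_finite_induct)
  case (insert i I)
  then show ?case using ip_add_left[of "x i" "\<Sum>i\<in>I. x i" y] by (simp add: mem_sum)
qed auto

lemma ip_sum_right:
  assumes "\<And>i. i \<in> I \<Longrightarrow> x i \<in> H" "y \<in> H"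
  shows "ip y (\<Sum>i\<in>I. x i) = (\<Sum>i\<in>I. ip y (x i))"
  using ip_sum_left[OF assms] assms ip_commute[OF assms(2)] by (simp add: mem_sum)

abbreviation nrm where "nrm \<equiv> norm_of ip"

lemma nrm_nonneg [simp]: "x \<in> H \<Longrightarrow> 0 \<le> nrm x"
  by (simp add: norm_of_def ip_nonneg)

lemma nrm_sq: "x \<in> H \<Longrightarrow> (nrm x)\<^sup>2 = ip x x"
  by (simp add: norm_of_def ip_nonneg)

lemma nrm_zero [simp]: "nrm 0 = 0"
  by (simp add: norm_of_def)

lemma nrm_eq_0: "x \<in> H \<Longrightarrow> nrm x = 0 \<Longrightarrow> x = 0"
  using ip_eq_0[of x] by (simp add: norm_of_def)

lemma nrm_scale: "x \<in> H \<Longrightarrow> nrm (c *\<^sub>R x) = \<bar>c\<bar> * nrm x"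
  by (simp add: norm_of_def ip_scale_left ip_scale_right real_sqrt_mult mult.assoc[symmetric])

lemma Cauchy_Schwarz:
  assumes "x \<in> H" "y \<in> H"
  shows "\<bar>ip x y\<bar> \<le> nrm x * nrm y"
proof (cases "ip y y = 0")
  case True
  then have "y = 0" using assms ip_eq_0 by blast
  then show ?thesis using assms by simp
next
  case False
  then have p: "ip y y > 0" using ip_nonneg[OF assms(2)] by simp
  have "0 \<le> ip (x - (ip x y / ip y y) *\<^sub>R y) (x - (ip x y / ip y y) *\<^sub>R y)"
    using assms by (intro ip_nonneg) auto
  also have "\<dots> = ip x x - (ip x y)\<^sup>2 / ip y y"
    using assms p ip_commute[OF assms] by (simp add: ip_bilinear power2_eq_square field_simps)
  finally have "(ip x y)\<^sup>2 \<le> ip x x * ip y y" using p by (simp add: field_simps)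
  then have "(ip x y)\<^sup>2 \<le> (nrm x * nrm y)\<^sup>2" using assms by (simp add: power_mult_distrib nrm_sq)
  then show ?thesis using assms by (metis abs_le_square_iff abs_of_nonneg mult_nonneg_nonneg nrm_nonneg)
qed

lemma nrm_triangle:
  assumes "x \<in> H" "y \<in> H"
  shows "nrm (x + y) \<le> nrm x + nrm y"
proof (rule power2_le_imp_le)
  have "(nrm (x + y))\<^sup>2 = (nrm x)\<^sup>2 + 2 * ip x y + (nrm y)\<^sup>2"
    using assms ip_commute[OF assms] by (simp add: nrm_sq ip_bilinear)
  also have "\<dots> \<le> (nrm x + nrm y)\<^sup>2"
    using Cauchy_Schwarz[OF assms] by (simp add: power2_sum abs_le_iff)
  finally show "(nrm (x + y))\<^sup>2 \<le> (nrm x + nrm y)\<^sup>2" .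
qed (use assms in auto)

lemma nrm_minus: "x \<in> H \<Longrightarrow> nrm (- x) = nrm x"
  using nrm_scale[of x "-1"] by simp

lemma nrm_diff_commute: "x \<in> H \<Longrightarrow> y \<in> H \<Longrightarrow> nrm (x - y) = nrm (y - x)"
  using nrm_minus[of "x - y"] by simp

lemma nrm_triangle_diff: "x \<in> H \<Longrightarrow> y \<in> H \<Longrightarrow> z \<in> H \<Longrightarrow> nrm (x - z) \<le> nrm (x - y) + nrm (y - z)"
  using nrm_triangle[of "x - y" "y - z"] by simp

lemma nrm_triangle_rev: "x \<in> H \<Longrightarrow> y \<in> H \<Longrightarrow> \<bar>nrm x - nrm y\<bar> \<le> nrm (x - y)"
  using nrm_triangle[of "x - y" y] nrm_triangle[of "y - x" x] nrm_diff_commute[of x y] by auto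

lemma ip_diff_scale:
  assumes "y \<in> H" "w \<in> H"
  shows "ip (y - s *\<^sub>R w) (y - s *\<^sub>R w) = ip y y - 2 * s * ip y w + s\<^sup>2 * ip w w"
  using assms ip_commute[OF assms] by (simp add: ip_bilinear power2_eq_square algebra_simps)

lemma ip_tendsto:
  assumes "\<And>n. x n \<in> H" "l \<in> H" "y \<in> H" "(\<lambda>n. nrm (x n - l)) \<longlonglongrightarrow> 0"
  shows "(\<lambda>n. ip (x n) y) \<longlonglongrightarrow> ip l y"
proof -
  have "(\<lambda>n. ip (x n) y - ip l y) \<longlonglongrightarrow> 0"
  proof (rule Lim_null_comparison)
    show "\<forall>\<^sub>F n in sequentially. norm (ip (x n) y - ip l y) \<le> nrm (x n - l) * nrm y"
      using Cauchy_Schwarz[of "x _ - l" y] assms by (simp add: ip_bilinear)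
    show "(\<lambda>n. nrm (x n - l) * nrm y) \<longlonglongrightarrow> 0"
      using tendsto_mult_left_zero[OF assms(4)] by simp
  qed
  then show ?thesis by (simp add: LIM_zero_iff)
qed

end

locale hilbert_space = ip_space +
  assumes complete: "\<And>x. (\<And>n::nat. x n \<in> H) \<Longrightarrow>
    (\<And>e. e > 0 \<Longrightarrow> \<exists>N. \<forall>m\<ge>N. \<forall>n\<ge>N. norm_of ip (x m - x n) < e) \<Longrightarrow>
    \<exists>l\<in>H. (\<lambda>n. norm_of ip (x n - l)) \<longlonglongrightarrow> 0"

lemma hilbert_space_on_iff: "hilbert_space_on H ip \<longleftrightarrow> hilbert_space H ip"
  unfolding hilbert_space_on_def hilbert_space_def hilbert_space_axioms_def ip_space_def by blast

context hilbert_space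
begin

text \<open>The point of \<open>V\<close> nearest to \<open>h\<close> exists by completeness.
  Closedness is phrased with sequences in \<open>nrm\<close>, since no topology is assumed on the
  ambient space.\<close>

lemma projection:
  assumes V: "subspace V" "V \<subseteq> H"
    and closed: "\<And>v l. (\<And>n::nat. v n \<in> V) \<Longrightarrow> l \<in> H \<Longrightarrow> (\<lambda>n. nrm (v n - l)) \<longlonglongrightarrow> 0 \<Longrightarrow> l \<in> V"
    and h: "h \<in> H"
  shows "\<exists>u\<in>V. \<forall>v\<in>V. ip (h - u) v = 0"
proof -
  define f where "f = (\<lambda>v. ip (h - v) (h - v))"
  define d where "d = Inf (f ` V)"
  have V0: "0 \<in> V" using V by (simp add: subspace_0)
  have VH: "v \<in> H" if "v \<in> V" for v using that V by auto
  have f0: "0 \<le> f v" if "v \<in> V" for v unfolding f_def using VH[OF that] h by (intro ip_nonneg) auto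
  have bdd: "bdd_below (f ` V)" using f0 by (intro bdd_belowI2[of _ 0]) auto
  have dle: "d \<le> f v" if "v \<in> V" for v unfolding d_def by (intro cInf_lower bdd) (use that in auto)
  have "\<exists>v\<in>V. f v < d + 1 / real (Suc n)" for n
  proof -
    have "\<exists>x\<in>f ` V. x < d + 1 / real (Suc n)"
      unfolding d_def using V0 by (intro cInf_lessD) (auto simp: d_def[symmetric])
    then show ?thesis by auto
  qed
  then obtain v where v: "\<And>n. v n \<in> V" "\<And>n. f (v n) < d + 1 / real (Suc n)" by metis
  have vH: "v n \<in> H" for n using v VH by auto
  \<comment> \<open>The parallelogram identity: the midpoint of two near-minimisers cannot beat the
    infimum, so near-minimisers are close to each other.\<close>
  have key: "ip (v m - v n) (v m - v n) \<le> 2 / real (Suc m) + 2 / real (Suc n)" for m n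
  proof -
    have "(1/2) *\<^sub>R (v m + v n) \<in> V" using v V by (simp add: subspace_add subspace_scale)
    then have "d \<le> f ((1/2) *\<^sub>R (v m + v n))" by (rule dle)
    moreover have "4 * f ((1/2) *\<^sub>R (v m + v n)) + ip (v m - v n) (v m - v n) = 2 * f (v m) + 2 * f (v n)"
      unfolding f_def using vH h by (simp add: ip_bilinear algebra_simps ip_commute)
    ultimately show ?thesis using v(2)[of m] v(2)[of n] by simp
  qed
  have "\<exists>l\<in>H. (\<lambda>n. nrm (v n - l)) \<longlonglongrightarrow> 0"
  proof (rule complete)
    fix e :: real assume e: "e > 0"
    then obtain N where N: "real (Suc N) > 4 / e\<^sup>2" by (meson reals_Archimedean2 less_trans of_nat_less_iff lessI)
    have "nrm (v m - v n) < e" if mn: "m \<ge> N" "n \<ge> N" for m n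
    proof -
      have "2 / real (Suc m) \<le> 2 / real (Suc N)" "2 / real (Suc n) \<le> 2 / real (Suc N)"
        using mn by (auto intro!: divide_left_mono)
      moreover have "4 / real (Suc N) < e\<^sup>2" using N e by (simp add: field_simps)
      ultimately have "ip (v m - v n) (v m - v n) < e\<^sup>2" using key[of m n] by simp
      then show ?thesis unfolding norm_of_def using e by (metis real_sqrt_less_mono real_sqrt_abs abs_of_pos)
    qed
    then show "\<exists>N. \<forall>m\<ge>N. \<forall>n\<ge>N. nrm (v m - v n) < e" by blast
  qed (rule vH)
  then obtain u where u: "u \<in> H" "(\<lambda>n. nrm (v n - u)) \<longlonglongrightarrow> 0" by blast
  have uV: "u \<in> V" by (rule closed[OF v(1) u])
  have fu: "f u \<le> d"
  proof -
    have lim: "(\<lambda>n. sqrt (d + 1 / real (Suc n)) + nrm (v n - u)) \<longlonglongrightarrow> sqrt (d + 0) + 0"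
      by (intro tendsto_intros u LIMSEQ_Suc[OF lim_1_over_n])
    have "nrm (h - u) \<le> sqrt (d + 1 / real (Suc n)) + nrm (v n - u)" for n
    proof -
      have "nrm (h - v n) \<le> sqrt (d + 1 / real (Suc n))"
        unfolding norm_of_def using v(2)[of n] by (simp add: f_def)
      then show ?thesis using nrm_triangle_diff[OF h vH u(1), of n] by simp
    qed
    then have "nrm (h - u) \<le> sqrt (d + 0) + 0" using LIMSEQ_le_const[OF lim] by auto
    then have "sqrt (f u) \<le> sqrt d" by (simp add: norm_of_def f_def)
    then show ?thesis by simp
  qed
  have "ip (h - u) w = 0" if w: "w \<in> V" for w
  proof -
    define c where "c = ip (h - u) w"
    have wH: "w \<in> H" by (rule VH[OF w])
    have "0 \<le> s\<^sup>2 * ip w w - 2 * s * c" for s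
    proof -
      have "u + s *\<^sub>R w \<in> V" using V uV w by (simp add: subspace_add subspace_scale)
      then have "f u \<le> f (u + s *\<^sub>R w)" using dle fu by fastforce
      moreover have "f (u + s *\<^sub>R w) = f u - 2 * s * c + s\<^sup>2 * ip w w"
      proof -
        have "f (u + s *\<^sub>R w) = ip ((h - u) - s *\<^sub>R w) ((h - u) - s *\<^sub>R w)"
          by (simp add: f_def algebra_simps)
        also have "\<dots> = f u - 2 * s * c + s\<^sup>2 * ip w w"
          unfolding f_def c_def using h u(1) wH by (intro ip_diff_scale) auto
        finally show ?thesis .
      qed
      ultimately show ?thesis by simp
    qed
    \<comment> \<open>The quadratic is minimal at \<open>c / ip w w\<close>. Adding 1 to the
      denominator covers \<open>w = 0\<close>, and the value is still negative unless
      \<open>c = 0\<close>.\<close>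
    from this[of "c / (ip w w + 1)"] have "0 \<le> (c / (ip w w + 1))\<^sup>2 * ip w w - 2 * (c / (ip w w + 1)) * c" .
    moreover have "(c / (ip w w + 1))\<^sup>2 * ip w w - 2 * (c / (ip w w + 1)) * c = - (c\<^sup>2 * (ip w w + 2) / (ip w w + 1)\<^sup>2)"
      using ip_nonneg[OF wH] by (simp add: power2_eq_square divide_simps) (simp add: algebra_simps)
    ultimately have "c\<^sup>2 * (ip w w + 2) / (ip w w + 1)\<^sup>2 \<le> 0" by simp
    moreover have "ip w w + 2 > 0" "(ip w w + 1)\<^sup>2 > 0" using ip_nonneg[OF wH] by auto
    ultimately have "c\<^sup>2 \<le> 0" by (simp add: divide_le_0_iff mult_le_0_iff)
    then show ?thesis by (simp add: c_def)
  qed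
  then show ?thesis using uV by blast
qed

end

text \<open>The difference \<open>g\<close> from the linear map vanishes at the integers, so it has
  period 1 and is bounded everywhere. Since \<open>g (n * c)\<close> is \<open>n * g c\<close>,
  boundedness forces \<open>g = 0\<close>.\<close>

lemma additive_bounded_imp_linear:
  fixes f :: "real \<Rightarrow> real"
  assumes add: "\<And>a b. f (a + b) = f a + f b" and bnd: "\<And>c. \<bar>c\<bar> \<le> 1 \<Longrightarrow> \<bar>f c\<bar> \<le> A"
  shows "f c = c * f 1"
proof -
  define g where "g = (\<lambda>c. f c - c * f 1)"
  have ga: "g (a + b) = g a + g b" for a b by (simp add: g_def add algebra_simps)
  have g0: "g 0 = 0" using ga[of 0 0] by simp
  have gn: "g (real n * c) = real n * g c" for n c
    by (induction n) (auto simp: g0 ga distrib_right)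
  have gm: "g (- c) = - g c" for c using ga[of c "-c"] g0 by simp
  have g1: "g 1 = 0" by (simp add: g_def)
  have gi: "g (of_int k) = 0" for k
    by (cases k rule: int_cases2) (use gn[of _ 1] gm[of "real _"] g1 in auto)
  have gb: "\<bar>g c\<bar> \<le> A + \<bar>f 1\<bar>" for c
  proof -
    have "g c = g (frac c)" using ga[of "of_int \<lfloor>c\<rfloor>" "frac c"] gi by (simp add: frac_def)
    moreover have fr: "\<bar>frac c\<bar> \<le> 1" using frac_ge_0[of c] frac_lt_1[of c] by simp
    moreover have "\<bar>frac c * f 1\<bar> \<le> 1 * \<bar>f 1\<bar>"
      unfolding abs_mult by (intro mult_right_mono fr) auto
    ultimately show ?thesis using bnd[OF fr] by (simp add: g_def)
  qed
  have "\<bar>g c\<bar> \<le> 0"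
  proof (rule LIMSEQ_le_const)
    show "(\<lambda>n. (A + \<bar>f 1\<bar>) * (1 / real (Suc n))) \<longlonglongrightarrow> 0"
      using tendsto_mult_right_zero[OF LIMSEQ_Suc[OF lim_1_over_n]] by simp
    have "\<bar>g c\<bar> \<le> (A + \<bar>f 1\<bar>) * (1 / real (Suc n))" for n
      using gb[of "real (Suc n) * c"] unfolding gn abs_mult by (simp add: field_simps)
    then show "\<exists>N. \<forall>n\<ge>N. \<bar>g c\<bar> \<le> (A + \<bar>f 1\<bar>) * (1 / real (Suc n))" by blast
  qed
  then show ?thesis by (simp add: g_def)
qed

text \<open>Stated for the squared norm \<open>N\<close>, which is what a supremum of gains
  provides; there is no triangle inequality among the assumptions. Homogeneity of \<open>ip\<close>
  comes from additivity together with a bound for scalars of modulus at most 1, and that bound is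
  the parallelogram identity combined with \<open>N \<ge> 0\<close>.\<close>

lemma Jordan_von_Neumann:
  fixes H :: "'h::real_vector set"
  assumes H: "subspace H"
    and nonneg: "\<And>x. x \<in> H \<Longrightarrow> 0 \<le> N x"
    and definite: "\<And>x. x \<in> H \<Longrightarrow> N x = 0 \<Longrightarrow> x = 0"
    and scale: "\<And>x c. x \<in> H \<Longrightarrow> N (c *\<^sub>R x) = c\<^sup>2 * N x"
    and par: "\<And>x y. x \<in> H \<Longrightarrow> y \<in> H \<Longrightarrow> N (x + y) + N (x - y) = 2 * N x + 2 * N y"
    and ip: "\<And>x y. x \<in> H \<Longrightarrow> y \<in> H \<Longrightarrow> ip x y = (N (x + y) - N (x - y)) / 4"
  shows "inner_product_on H ip" "\<And>x. x \<in> H \<Longrightarrow> ip x x = N x"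
proof -
  note mem = subspace_add[OF H] subspace_diff[OF H] subspace_scale[OF H] subspace_0[OF H]
  have neg: "N (- x) = N x" if "x \<in> H" for x using scale[OF that, of "-1"] by simp
  have N0: "N 0 = 0" using scale[OF mem(4), of 0] by simp
  show ipxx: "ip x x = N x" if "x \<in> H" for x
    using ip[OF that that] scale[OF that, of 2] N0 by (simp add: scaleR_2)
  have add: "ip (x + y) z = ip x z + ip y z" if h: "x \<in> H" "y \<in> H" "z \<in> H" for x y z
  proof -
    \<comment> \<open>In \<open>a + b - c - d\<close> the mixed terms \<open>N (x + z - y)\<close>
      and \<open>N (y + z - x)\<close> cancel; \<open>e\<close> and \<open>f\<close> match them up
      to sign.\<close>
    have a: "N (x + y + z) + N (x + z - y) = 2 * N (x + z) + 2 * N y"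
      using par[of "x + z" y] h mem by (simp add: add_ac)
    have b: "N (x + y + z) + N (y + z - x) = 2 * N (y + z) + 2 * N x"
      using par[of "y + z" x] h mem by (simp add: add_ac)
    have c: "N (x + y - z) + N (x - z - y) = 2 * N (x - z) + 2 * N y"
      using par[of "x - z" y] h mem by (simp add: algebra_simps)
    have d: "N (x + y - z) + N (y - z - x) = 2 * N (y - z) + 2 * N x"
      using par[of "y - z" x] h mem by (simp add: algebra_simps)
    have e: "N (y - z - x) = N (x + z - y)" using neg[of "x + z - y"] h mem by (simp add: algebra_simps)
    have f: "N (x - z - y) = N (y + z - x)" using neg[of "y + z - x"] h mem by (simp add: algebra_simps)
    have "ip (x + y) z = (N (x + y + z) - N (x + y - z)) / 4" "ip x z = (N (x + z) - N (x - z)) / 4"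
      "ip y z = (N (y + z) - N (y - z)) / 4" by (rule ip; use h mem in auto)+
    moreover have "N (x + y + z) - N (x + y - z) = (N (x + z) - N (x - z)) + (N (y + z) - N (y - z))"
      using a b c[unfolded f] d[unfolded e] by linarith
    ultimately show ?thesis by (simp add: diff_divide_distrib add_divide_distrib)
  qed
  have sc: "ip (c *\<^sub>R x) y = c * ip x y" if h: "x \<in> H" "y \<in> H" for c x y
  proof -
    have "ip (c *\<^sub>R x) y = c * ip (1 *\<^sub>R x) y"
    proof (rule additive_bounded_imp_linear[where f="\<lambda>c. ip (c *\<^sub>R x) y"])
      show "ip ((a + b) *\<^sub>R x) y = ip (a *\<^sub>R x) y + ip (b *\<^sub>R x) y" for a b
        using add[of "a *\<^sub>R x" "b *\<^sub>R x" y] h mem by (simp add: scaleR_add_left)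
      fix c :: real assume c: "\<bar>c\<bar> \<le> 1"
      have "\<bar>ip (c *\<^sub>R x) y\<bar> \<le> (N (c *\<^sub>R x + y) + N (c *\<^sub>R x - y)) / 4"
        using nonneg[of "c *\<^sub>R x + y"] nonneg[of "c *\<^sub>R x - y"] h mem by (simp add: ip)
      also have "\<dots> = (c\<^sup>2 * N x + N y) / 2" using par[of "c *\<^sub>R x" y] h mem by (simp add: scale)
      also have "\<dots> \<le> (1 * N x + N y) / 2"
        using c nonneg[OF h(1)] by (intro divide_right_mono add_mono mult_right_mono) (auto simp: abs_square_le_1)
      finally show "\<bar>ip (c *\<^sub>R x) y\<bar> \<le> (N x + N y) / 2" by simp
    qed
    then show ?thesis by simp
  qed
  show "inner_product_on H ip"
    unfolding inner_product_on_def
  proof (intro conjI ballI allI impI)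
    fix x y assume h: "x \<in> H" "y \<in> H"
    show "ip x y = ip y x" using neg[of "x - y"] h mem by (simp add: ip add.commute)
  qed (use add sc ipxx nonneg definite in auto)
qed

section \<open>The reproducing kernel Hilbert space of a positive definite kernel\<close>

text \<open>The representer of \<open>\<phi>\<close> in the kernel space: if \<open>\<phi>\<close>
  is a combination of evaluations at points \<open>t\<close>, this is the same combination of the
  functions \<open>\<lambda>s. K s t\<close>.\<close>

definition kernel_fun :: "('t \<Rightarrow> 't \<Rightarrow> real) \<Rightarrow> (('t \<Rightarrow> real) \<Rightarrow> real) \<Rightarrow> 't \<Rightarrow> real"
  where "kernel_fun K \<phi> = (\<lambda>s. \<phi> (K s))"

definition rk_gain :: "('t \<Rightarrow> 't \<Rightarrow> real) \<Rightarrow> ('t \<Rightarrow> real) \<Rightarrow> (('t \<Rightarrow> real) \<Rightarrow> real) \<Rightarrow> real"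
  where "rk_gain K x \<phi> = 2 * \<phi> x - \<phi> (kernel_fun K \<phi>)"

text \<open>In the reproducing kernel Hilbert space one has
  \<open>2 \<phi> x - \<phi> (kernel_fun K \<phi>) = \<parallel>x\<parallel>\<^sup>2 - \<parallel>x - kernel_fun K \<phi>\<parallel>\<^sup>2\<close>, so the supremum of
  the left-hand side over all \<open>\<phi>\<close> is the squared norm of \<open>x\<close>.\<close>

definition rk_carrier :: "('t \<Rightarrow> 't \<Rightarrow> real) \<Rightarrow> ('t \<Rightarrow> real) set"
  where "rk_carrier K = {x. bdd_above (rk_gain K x ` coord_functionals)}"

definition rk_sqnorm :: "('t \<Rightarrow> 't \<Rightarrow> real) \<Rightarrow> ('t \<Rightarrow> real) \<Rightarrow> real"
  where "rk_sqnorm K x = (SUP \<phi>\<in>coord_functionals. rk_gain K x \<phi>)"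

text \<open>Polarisation of the squared norm. The value 0 off the carrier is the convention by which
  \<open>is_rkhs\<close> makes the pair unique.\<close>

definition rk_ip :: "('t \<Rightarrow> 't \<Rightarrow> real) \<Rightarrow> ('t \<Rightarrow> real) \<Rightarrow> ('t \<Rightarrow> real) \<Rightarrow> real"
  where "rk_ip K x y = (if x \<in> rk_carrier K \<and> y \<in> rk_carrier K
    then (rk_sqnorm K (x + y) - rk_sqnorm K (x - y)) / 4 else 0)"

lemma kernel_fun_eval: "kernel_fun K (\<lambda>x. x t) = (\<lambda>s. K s t)"
  by (simp add: kernel_fun_def)

lemma kernel_fun_add: "kernel_fun K (\<lambda>x. \<phi> x + \<psi> x) = kernel_fun K \<phi> + kernel_fun K \<psi>"
  by (simp add: kernel_fun_def plus_fun_def)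

lemma kernel_fun_diff: "kernel_fun K (\<lambda>x. \<phi> x - \<psi> x) = kernel_fun K \<phi> - kernel_fun K \<psi>"
  by (simp add: kernel_fun_def fun_diff_def)

lemma kernel_fun_scale: "kernel_fun K (\<lambda>x. c * \<phi> x) = c *\<^sub>R kernel_fun K \<phi>"
  by (simp add: kernel_fun_def scaleR_fun_def)

lemma kernel_fun_zero: "kernel_fun K (\<lambda>x. 0) = 0"
  by (simp add: kernel_fun_def zero_fun_def)

lemma coord_functionals_tendsto:
  assumes "\<phi> \<in> coord_functionals" and "\<And>t. (\<lambda>n. x n t) \<longlonglongrightarrow> l t"
  shows "(\<lambda>n. \<phi> (x n)) \<longlonglongrightarrow> \<phi> l"
  using assms(1) by (induction rule: coord_functionals_induct) (auto intro!: tendsto_intros assms(2))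

locale pd_kernel =
  fixes K :: "'t \<Rightarrow> 't \<Rightarrow> real"
  assumes pd: "positive_definite K"
begin

lemma K_commute: "K s t = K t s"
  using pd by (auto simp: positive_definite_def)

lemma kernel_commute:
  assumes "\<phi> \<in> coord_functionals" "\<psi> \<in> coord_functionals"
  shows "\<psi> (kernel_fun K \<phi>) = \<phi> (kernel_fun K \<psi>)"
  using assms(2)
proof (induction rule: coord_functionals_induct)
  case (eval t)
  then show ?case by (simp add: kernel_fun_def K_commute[of _ t])
qed (simp_all add: kernel_fun_add kernel_fun_scale kernel_fun_zero coord_functionals_linear[OF assms(1)])

lemma kernel_nonneg:
  assumes "\<phi> \<in> coord_functionals"
  shows "0 \<le> \<phi> (kernel_fun K \<phi>)"
proof -
  obtain J c where *: "finite J" "\<phi> = (\<lambda>x. \<Sum>i\<in>J. c i * x i)"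
    using coord_functionals_explicit[OF assms] by blast
  have "0 \<le> (\<Sum>s\<in>J. \<Sum>t\<in>J. c s * c t * K s t)" using pd * by (auto simp: positive_definite_def)
  also have "\<dots> = \<phi> (kernel_fun K \<phi>)"
    by (simp add: *(2) kernel_fun_def sum_distrib_left mult_ac)
  finally show ?thesis .
qed

lemma kernel_sq_add:
  assumes "\<phi> \<in> coord_functionals" "\<psi> \<in> coord_functionals"
  shows "(\<lambda>x. \<phi> x + c * \<psi> x) (kernel_fun K (\<lambda>x. \<phi> x + c * \<psi> x)) =
    \<phi> (kernel_fun K \<phi>) + 2 * c * \<phi> (kernel_fun K \<psi>) + c\<^sup>2 * \<psi> (kernel_fun K \<psi>)"
  using kernel_commute[OF assms]
  by (simp add: kernel_fun_add kernel_fun_scale coord_functionals_linear[OF assms(1)]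
      coord_functionals_linear[OF assms(2)] algebra_simps power2_eq_square)

lemma gain_upper: "x \<in> rk_carrier K \<Longrightarrow> \<phi> \<in> coord_functionals \<Longrightarrow> rk_gain K x \<phi> \<le> rk_sqnorm K x"
  unfolding rk_sqnorm_def rk_carrier_def by (auto intro: cSUP_upper)

lemma gain_least:
  assumes "\<And>\<phi>. \<phi> \<in> coord_functionals \<Longrightarrow> rk_gain K x \<phi> \<le> C"
  shows "x \<in> rk_carrier K" "rk_sqnorm K x \<le> C"
proof -
  show "x \<in> rk_carrier K" unfolding rk_carrier_def using assms by (auto intro!: bdd_aboveI2)
  show "rk_sqnorm K x \<le> C" unfolding rk_sqnorm_def
    using assms coord_functionals_zero by (intro cSUP_least) auto
qed

lemma gain_zero: "rk_gain K x (\<lambda>x. 0) = 0"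
  by (simp add: rk_gain_def)

lemma sqnorm_nonneg: "x \<in> rk_carrier K \<Longrightarrow> 0 \<le> rk_sqnorm K x"
  using gain_upper[OF _ coord_functionals_zero] by (simp add: gain_zero)

text \<open>Replacing test functionals \<open>\<phi>\<close> and \<open>\<psi>\<close> by their half
  sum and half difference is an identity between gains; the suprema over \<open>\<phi>\<close> and
  \<open>\<psi>\<close> are then taken one after the other. The opposite inequality is this one
  applied to \<open>x + y\<close> and \<open>x - y\<close>.\<close>

lemma parallelogram_le:
  assumes "x \<in> rk_carrier K" "y \<in> rk_carrier K"
  shows "x + y \<in> rk_carrier K" "x - y \<in> rk_carrier K"
    "rk_sqnorm K (x + y) + rk_sqnorm K (x - y) \<le> 2 * rk_sqnorm K x + 2 * rk_sqnorm K y"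
proof -
  let ?C = "2 * rk_sqnorm K x + 2 * rk_sqnorm K y"
  have le: "rk_gain K (x + y) \<phi> + rk_gain K (x - y) \<psi> \<le> ?C"
    if \<phi>: "\<phi> \<in> coord_functionals" and \<psi>: "\<psi> \<in> coord_functionals" for \<phi> \<psi>
  proof -
    define \<alpha> where "\<alpha> = (\<lambda>x. (1/2) * (\<phi> x + \<psi> x))"
    define \<beta> where "\<beta> = (\<lambda>x. (1/2) * (\<phi> x - \<psi> x))"
    have m: "\<alpha> \<in> coord_functionals" "\<beta> \<in> coord_functionals" unfolding \<alpha>_def \<beta>_def
      by (intro coord_functionals_scale coord_functionals_add coord_functionals_diff \<phi> \<psi>)+
    have "rk_gain K (x + y) \<phi> + rk_gain K (x - y) \<psi> = 2 * rk_gain K x \<alpha> + 2 * rk_gain K y \<beta>"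
      unfolding rk_gain_def \<alpha>_def \<beta>_def kernel_fun_scale kernel_fun_add kernel_fun_diff
      by (simp add: coord_functionals_linear[OF \<phi>] coord_functionals_linear[OF \<psi>] kernel_commute[OF \<phi> \<psi>])
         (simp add: field_simps)
    then show ?thesis using gain_upper[OF assms(1) m(1)] gain_upper[OF assms(2) m(2)] by simp
  qed
  show xy: "x + y \<in> rk_carrier K"
    using le[OF _ coord_functionals_zero] by (intro gain_least(1)) (auto simp: gain_zero)
  show xy': "x - y \<in> rk_carrier K"
    using le[OF coord_functionals_zero] by (intro gain_least(1)) (auto simp: gain_zero)
  have "rk_sqnorm K (x + y) \<le> ?C - rk_gain K (x - y) \<psi>" if "\<psi> \<in> coord_functionals" for \<psi>
    using le[OF _ that] by (intro gain_least(2)) (auto simp: algebra_simps)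
  then have "rk_sqnorm K (x - y) \<le> ?C - rk_sqnorm K (x + y)"
    by (intro gain_least(2)) (auto simp: algebra_simps)
  then show "rk_sqnorm K (x + y) + rk_sqnorm K (x - y) \<le> ?C" by simp
qed

lemma zero_mem: "0 \<in> rk_carrier K" and sqnorm_zero: "rk_sqnorm K 0 = 0"
proof -
  have *: "rk_gain K 0 \<phi> \<le> 0" if "\<phi> \<in> coord_functionals" for \<phi>
    using kernel_nonneg[OF that] by (simp add: rk_gain_def coord_functionals_linear[OF that])
  show z: "0 \<in> rk_carrier K" by (rule gain_least(1)[OF *])
  show "rk_sqnorm K 0 = 0" using gain_least(2)[OF *] sqnorm_nonneg[OF z] by simp
qed

lemma sqnorm_scale:
  assumes "x \<in> rk_carrier K"
  shows "c *\<^sub>R x \<in> rk_carrier K" "rk_sqnorm K (c *\<^sub>R x) = c\<^sup>2 * rk_sqnorm K x"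
proof -
  have le: "rk_gain K (c *\<^sub>R x) \<phi> \<le> c\<^sup>2 * rk_sqnorm K x"
    if x: "x \<in> rk_carrier K" and c: "c \<noteq> 0" and \<phi>: "\<phi> \<in> coord_functionals" for x c \<phi>
  proof -
    have m: "(\<lambda>x. (1/c) * \<phi> x) \<in> coord_functionals" by (rule coord_functionals_scale[OF \<phi>])
    have "rk_gain K (c *\<^sub>R x) \<phi> = c\<^sup>2 * rk_gain K x (\<lambda>x. (1/c) * \<phi> x)"
      unfolding rk_gain_def kernel_fun_scale using c
      by (simp add: coord_functionals_linear[OF \<phi>] power2_eq_square field_simps)
    then show ?thesis using gain_upper[OF x m] by (simp add: mult_left_mono)
  qed
  have "c *\<^sub>R x \<in> rk_carrier K \<and> rk_sqnorm K (c *\<^sub>R x) = c\<^sup>2 * rk_sqnorm K x"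
  proof (cases "c = 0")
    case True
    then show ?thesis using zero_mem sqnorm_zero by simp
  next
    case False
    have m: "c *\<^sub>R x \<in> rk_carrier K" "rk_sqnorm K (c *\<^sub>R x) \<le> c\<^sup>2 * rk_sqnorm K x"
      using gain_least[OF le[OF assms False]] by auto
    have "rk_sqnorm K ((1/c) *\<^sub>R (c *\<^sub>R x)) \<le> (1/c)\<^sup>2 * rk_sqnorm K (c *\<^sub>R x)"
      using gain_least(2)[OF le[OF m(1), of "1/c"]] False by simp
    then have "c\<^sup>2 * rk_sqnorm K x \<le> rk_sqnorm K (c *\<^sub>R x)"
      using False by (simp add: field_simps)
    with m show ?thesis by simp
  qed
  then show "c *\<^sub>R x \<in> rk_carrier K" "rk_sqnorm K (c *\<^sub>R x) = c\<^sup>2 * rk_sqnorm K x" by auto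
qed

lemma subspace_rk_carrier: "subspace (rk_carrier K)"
  unfolding subspace_def using zero_mem parallelogram_le(1) sqnorm_scale(1) by auto

lemma sqnorm_parallelogram:
  assumes "x \<in> rk_carrier K" "y \<in> rk_carrier K"
  shows "rk_sqnorm K (x + y) + rk_sqnorm K (x - y) = 2 * rk_sqnorm K x + 2 * rk_sqnorm K y"
proof -
  note p = parallelogram_le[OF assms]
  have e: "(x + y) + (x - y) = 2 *\<^sub>R x" "(x + y) - (x - y) = 2 *\<^sub>R y" by (auto simp: scaleR_2)
  have "4 * rk_sqnorm K x + 4 * rk_sqnorm K y \<le> 2 * rk_sqnorm K (x + y) + 2 * rk_sqnorm K (x - y)"
    using parallelogram_le(3)[OF p(1,2)] unfolding e using sqnorm_scale(2)[OF assms(1), of 2] sqnorm_scale(2)[OF assms(2), of 2]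
    by simp
  then show ?thesis using p(3) by simp
qed

text \<open>Testing with \<open>s\<close> times the evaluation at \<open>t\<close> yields a
  quadratic in \<open>s\<close>, best at \<open>x t / K t t\<close>. If \<open>K t t = 0\<close> it
  is linear in \<open>s\<close>, and a nonzero slope would exceed any bound.\<close>

lemma eval_bound:
  assumes "x \<in> rk_carrier K"
  shows "(x t)\<^sup>2 \<le> rk_sqnorm K x * K t t"
proof -
  have *: "2 * s * x t - s\<^sup>2 * K t t \<le> rk_sqnorm K x" for s
    using gain_upper[OF assms coord_functionals_scale[OF coord_functionals_eval], of s t]
    by (simp add: rk_gain_def kernel_fun_scale kernel_fun_eval scaleR_fun_def power2_eq_square mult_ac)
  have Kt: "0 \<le> K t t" using kernel_nonneg[OF coord_functionals_eval, of t] by (simp add: kernel_fun_eval)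
  show ?thesis
  proof (cases "K t t = 0")
    case True
    have "x t = 0"
    proof (rule ccontr)
      assume "x t \<noteq> 0"
      then show False using *[of "(rk_sqnorm K x + 1) / x t"] sqnorm_nonneg[OF assms] True by simp
    qed
    then show ?thesis using True by simp
  next
    case False
    with *[of "x t / K t t"] Kt show ?thesis by (simp add: power2_eq_square field_simps)
  qed
qed

lemma sqnorm_eq_0: "x \<in> rk_carrier K \<Longrightarrow> rk_sqnorm K x = 0 \<Longrightarrow> x = 0"
  using eval_bound[of x] by (auto simp: fun_eq_iff)

lemma rk_ip_facts: "inner_product_on (rk_carrier K) (rk_ip K)" "x \<in> rk_carrier K \<Longrightarrow> rk_ip K x x = rk_sqnorm K x"
proof -
  have ip: "rk_ip K x y = (rk_sqnorm K (x + y) - rk_sqnorm K (x - y)) / 4"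
    if "x \<in> rk_carrier K" "y \<in> rk_carrier K" for x y using that by (simp add: rk_ip_def)
  note J = Jordan_von_Neumann[where H="rk_carrier K" and N="rk_sqnorm K" and ip="rk_ip K",
      OF subspace_rk_carrier sqnorm_nonneg sqnorm_eq_0 sqnorm_scale(2) sqnorm_parallelogram ip]
  show "inner_product_on (rk_carrier K) (rk_ip K)" by (rule J(1))
  show "rk_ip K x x = rk_sqnorm K x" if x: "x \<in> rk_carrier K"
    unfolding ip[OF x x] using sqnorm_scale(2)[OF x, of 2] sqnorm_zero by (simp add: scaleR_2)
qed

lemma ip_space: "ip_space (rk_carrier K) (rk_ip K)"
  by standard (fact subspace_rk_carrier, fact rk_ip_facts(1))

sublocale ip_space "rk_carrier K" "rk_ip K" by (rule ip_space)

lemma norm_rk: "x \<in> rk_carrier K \<Longrightarrow> norm_of (rk_ip K) x = sqrt (rk_sqnorm K x)"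
  by (simp add: norm_of_def rk_ip_facts(2))

lemma kernel_mem:
  shows "(\<lambda>s. K s t) \<in> rk_carrier K"
proof (rule gain_least(1))
  fix \<phi> :: "('t \<Rightarrow> real) \<Rightarrow> real" assume \<phi>: "\<phi> \<in> coord_functionals"
  have "0 \<le> (\<lambda>x. \<phi> x + (-1) * x t) (kernel_fun K (\<lambda>x. \<phi> x + (-1) * x t))"
    by (intro kernel_nonneg coord_functionals_add coord_functionals_scale coord_functionals_eval \<phi>)
  then show "rk_gain K (\<lambda>s. K s t) \<phi> \<le> K t t"
    unfolding kernel_sq_add[OF \<phi> coord_functionals_eval] by (simp add: rk_gain_def kernel_fun_eval)
qed

text \<open>Shifting the test functional by \<open>-c\<close> times the evaluation at
  \<open>t\<close> changes all gains by one constant, so the suprema differ by it; the reverse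
  inequality undoes the shift. The linear term \<open>2 * c * x t\<close> becomes the reproducing
  property after polarisation.\<close>

lemma sqnorm_add_kernel:
  assumes "x \<in> rk_carrier K"
  shows "rk_sqnorm K (x + c *\<^sub>R (\<lambda>s. K s t)) = rk_sqnorm K x + 2 * c * x t + c\<^sup>2 * K t t"
proof -
  have le: "rk_sqnorm K (x + c *\<^sub>R (\<lambda>s. K s t)) \<le> rk_sqnorm K x + 2 * c * x t + c\<^sup>2 * K t t"
    if x: "x \<in> rk_carrier K" for x c
  proof (rule gain_least(2))
    fix \<phi> :: "('t \<Rightarrow> real) \<Rightarrow> real" assume \<phi>: "\<phi> \<in> coord_functionals"
    have m: "(\<lambda>x. \<phi> x + (-c) * x t) \<in> coord_functionals"
      by (intro coord_functionals_add coord_functionals_scale coord_functionals_eval \<phi>)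
    have "rk_gain K (x + c *\<^sub>R (\<lambda>s. K s t)) \<phi> = rk_gain K x (\<lambda>x. \<phi> x + (-c) * x t) + 2 * c * x t + c\<^sup>2 * K t t"
      unfolding rk_gain_def kernel_sq_add[OF \<phi> coord_functionals_eval]
      by (simp add: coord_functionals_linear[OF \<phi>] kernel_fun_eval algebra_simps power2_eq_square)
    then show "rk_gain K (x + c *\<^sub>R (\<lambda>s. K s t)) \<phi> \<le> rk_sqnorm K x + 2 * c * x t + c\<^sup>2 * K t t"
      using gain_upper[OF x m] by simp
  qed
  have m: "x + c *\<^sub>R (\<lambda>s. K s t) \<in> rk_carrier K" by (intro mem assms kernel_mem)
  have "rk_sqnorm K x \<le> rk_sqnorm K (x + c *\<^sub>R (\<lambda>s. K s t)) - 2 * c * x t - c\<^sup>2 * K t t"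
  proof -
    have "(x + c *\<^sub>R (\<lambda>s. K s t)) + (- c) *\<^sub>R (\<lambda>s. K s t) = x" by simp
    then show ?thesis using le[OF m, of "-c"]
      by (simp only:) (simp add: scaleR_fun_def algebra_simps power2_eq_square)
  qed
  with le[OF assms, of c] show ?thesis by simp
qed

lemma reproducing:
  assumes "x \<in> rk_carrier K"
  shows "rk_ip K x (\<lambda>s. K s t) = x t"
  using sqnorm_add_kernel[OF assms, of 1 t] sqnorm_add_kernel[OF assms, of "-1" t] assms kernel_mem[of t]
  by (simp add: rk_ip_def)

text \<open>Evaluations are bounded, which gives a pointwise limit. The gain of a fixed functional
  is continuous under pointwise convergence, so the squared norm is lower semicontinuous and the
  Cauchy estimate survives the limit.\<close>

lemma rk_complete:
  assumes x: "\<And>n::nat. x n \<in> rk_carrier K"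
    and cauchy: "\<And>e. e > 0 \<Longrightarrow> \<exists>N. \<forall>m\<ge>N. \<forall>n\<ge>N. norm_of (rk_ip K) (x m - x n) < e"
  shows "\<exists>l\<in>rk_carrier K. (\<lambda>n. norm_of (rk_ip K) (x n - l)) \<longlonglongrightarrow> 0"
proof -
  have xm: "x m - x n \<in> rk_carrier K" for m n using x by auto
  have Ca: "\<exists>N. \<forall>m\<ge>N. \<forall>n\<ge>N. rk_sqnorm K (x m - x n) < e\<^sup>2" if e: "e > 0" for e
  proof -
    obtain N where "\<forall>m\<ge>N. \<forall>n\<ge>N. norm_of (rk_ip K) (x m - x n) < e" using cauchy[OF e] by blast
    then have "\<forall>m\<ge>N. \<forall>n\<ge>N. rk_sqnorm K (x m - x n) < e\<^sup>2"
      unfolding norm_rk[OF xm] using sqnorm_nonneg[OF xm] e by (metis real_sqrt_less_iff real_sqrt_abs abs_of_pos)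
    then show ?thesis by blast
  qed
  have "Cauchy (\<lambda>n. x n t)" for t
  proof (rule metric_CauchyI)
    fix e :: real assume e: "e > 0"
    have Kt: "0 \<le> K t t" using kernel_nonneg[OF coord_functionals_eval, of t] by (simp add: kernel_fun_eval)
    define d where "d = e / sqrt (K t t + 1)"
    have d: "d > 0" "d\<^sup>2 * (K t t + 1) = e\<^sup>2" using e Kt by (auto simp: d_def power_divide)
    obtain N where N: "\<forall>m\<ge>N. \<forall>n\<ge>N. rk_sqnorm K (x m - x n) < d\<^sup>2" using Ca[OF d(1)] by blast
    have "dist (x m t) (x n t) < e" if "m \<ge> N" "n \<ge> N" for m n
    proof -
      have "((x m - x n) t)\<^sup>2 \<le> rk_sqnorm K (x m - x n) * K t t" by (rule eval_bound[OF xm])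
      also have "\<dots> \<le> d\<^sup>2 * K t t" by (rule mult_right_mono) (use N that Kt in \<open>auto intro: less_imp_le\<close>)
      also have "\<dots> < e\<^sup>2" using d(2)[symmetric] zero_less_power[OF d(1), of 2] by (simp add: distrib_left)
      finally show ?thesis using e by (simp add: dist_real_def abs_square_less_1 power2_less_imp_less[of "\<bar>x m t - x n t\<bar>" e])
    qed
    then show "\<exists>M. \<forall>m\<ge>M. \<forall>n\<ge>M. dist (x m t) (x n t) < e" by blast
  qed
  then have "\<exists>l. (\<lambda>n. x n t) \<longlonglongrightarrow> l" for t by (simp add: Cauchy_convergent_iff convergent_def)
  then obtain l where l: "\<And>t. (\<lambda>n. x n t) \<longlonglongrightarrow> l t" by metis
  have dl: "x m - l \<in> rk_carrier K \<and> rk_sqnorm K (x m - l) \<le> e\<^sup>2"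
    if N: "\<forall>m\<ge>N. \<forall>n\<ge>N. rk_sqnorm K (x m - x n) < e\<^sup>2" and m: "m \<ge> N" for e N m
  proof -
    have "rk_gain K (x m - l) \<phi> \<le> e\<^sup>2" if \<phi>: "\<phi> \<in> coord_functionals" for \<phi>
    proof (rule LIMSEQ_le_const2)
      show "(\<lambda>n. rk_gain K (x m - x n) \<phi>) \<longlonglongrightarrow> rk_gain K (x m - l) \<phi>"
        unfolding rk_gain_def coord_functionals_linear[OF \<phi>]
        by (intro tendsto_intros coord_functionals_tendsto[OF \<phi> l])
      show "\<exists>N. \<forall>n\<ge>N. rk_gain K (x m - x n) \<phi> \<le> e\<^sup>2"
        using gain_upper[OF xm \<phi>] N m by (intro exI[of _ N]) (meson less_imp_le order_trans)
    qed
    then show ?thesis using gain_least[of "x m - l" "e\<^sup>2"] by blast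
  qed
  obtain N where "\<forall>m\<ge>N. \<forall>n\<ge>N. rk_sqnorm K (x m - x n) < 1\<^sup>2" using Ca[of 1] by auto
  from dl[OF this, of N] have "x N - l \<in> rk_carrier K" by blast
  then have "x N - (x N - l) \<in> rk_carrier K" by (rule mem(4)[OF x])
  then have lH: "l \<in> rk_carrier K" by simp
  have "(\<lambda>n. norm_of (rk_ip K) (x n - l)) \<longlonglongrightarrow> 0"
  proof (rule LIMSEQ_I)
    fix r :: real assume r: "r > 0"
    obtain N where N: "\<forall>m\<ge>N. \<forall>n\<ge>N. rk_sqnorm K (x m - x n) < (r/2)\<^sup>2" using Ca[of "r/2"] r by auto
    have "norm_of (rk_ip K) (x n - l) < r" if "n \<ge> N" for n
    proof -
      have "norm_of (rk_ip K) (x n - l) \<le> sqrt ((r/2)\<^sup>2)"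
        using dl[OF N that] by (simp only: norm_rk real_sqrt_le_iff)
      then show ?thesis using r by simp
    qed
    then show "\<exists>N. \<forall>n\<ge>N. norm (norm_of (rk_ip K) (x n - l) - 0) < r"
      using x lH by (intro exI[of _ N]) auto
  qed
  then show ?thesis using lH by blast
qed

lemma is_rkhs_rk: "is_rkhs K (rk_carrier K, rk_ip K)"
  unfolding is_rkhs_def hilbert_space_on_def
  using subspace_rk_carrier rk_ip_facts(1) rk_complete kernel_mem reproducing
  by (auto simp: rk_ip_def)

lemma kernel_fun_mem_gen:
  assumes H: "is_rkhs K (H, ip)" and \<phi>: "\<phi> \<in> coord_functionals"
  shows "kernel_fun K \<phi> \<in> H" "x \<in> H \<Longrightarrow> ip x (kernel_fun K \<phi>) = \<phi> x"
proof -
  interpret H: hilbert_space H ip using H by (simp add: is_rkhs_def hilbert_space_on_iff)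
  have "kernel_fun K \<phi> \<in> H \<and> (\<forall>x\<in>H. ip x (kernel_fun K \<phi>) = \<phi> x)"
    using \<phi>
  proof (induction rule: coord_functionals_induct)
    case (eval t)
    then show ?case using H by (simp add: is_rkhs_def kernel_fun_eval)
  next
    case zero
    show ?case unfolding kernel_fun_zero by (intro conjI ballI H.mem(1) H.ip_zero_right)
  next
    case (add \<phi> \<psi>)
    then show ?case unfolding kernel_fun_add by (intro conjI ballI H.mem(2)) (auto simp only: H.ip_add_right)
  next
    case (scale c \<phi>)
    then show ?case unfolding kernel_fun_scale by (simp add: H.ip_scale_right)
  qed
  then show "kernel_fun K \<phi> \<in> H" "x \<in> H \<Longrightarrow> ip x (kernel_fun K \<phi>) = \<phi> x" by auto
qed

text \<open>The squared distance from \<open>x\<close> to \<open>kernel_fun K \<phi>\<close> is the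
  squared norm minus the gain, so almost maximal functionals give good approximations.\<close>

lemma kernel_funs_dense_rk:
  assumes x: "x \<in> rk_carrier K" and e: "e > 0"
  shows "\<exists>\<phi>\<in>coord_functionals. norm_of (rk_ip K) (x - kernel_fun K \<phi>) < e"
proof -
  have "\<exists>y\<in>rk_gain K x ` coord_functionals. rk_sqnorm K x - e\<^sup>2 < y"
    unfolding rk_sqnorm_def using x e coord_functionals_zero
    by (intro less_cSupD) (auto simp: rk_carrier_def)
  then obtain \<phi> where \<phi>: "\<phi> \<in> coord_functionals" "rk_sqnorm K x - e\<^sup>2 < rk_gain K x \<phi>" by auto
  note k = kernel_fun_mem_gen[OF is_rkhs_rk \<phi>(1)]
  have "rk_ip K (x - kernel_fun K \<phi>) (x - kernel_fun K \<phi>) = rk_sqnorm K x - rk_gain K x \<phi>"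
    using x k(1) k(2)[OF x] k(2)[OF k(1)] ip_commute[OF x k(1)]
    by (simp add: ip_bilinear rk_ip_facts(2)[symmetric] rk_gain_def)
  also have "\<dots> < e\<^sup>2" using \<phi>(2) by simp
  finally have "norm_of (rk_ip K) (x - kernel_fun K \<phi>) < e"
    unfolding norm_of_def using e by (metis real_sqrt_less_mono real_sqrt_abs abs_of_pos)
  with \<phi>(1) show ?thesis by blast
qed

text \<open>In any candidate the gain of \<open>x\<close> is at most \<open>ip x x\<close>, being
  this number minus a squared distance; hence \<open>H\<close> lies in the carrier. Conversely, both
  inner products agree on kernel functions, and these approximate every \<open>x\<close> of the
  carrier. Such an approximating sequence is Cauchy in the candidate too, and its limit there is
  \<open>x\<close> because both norms control point values. Equal squared norms polarise to equal
  inner products.\<close>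

lemma is_rkhs_unique:
  assumes H: "is_rkhs K (H, ip)"
  shows "H = rk_carrier K" "ip = rk_ip K"
proof -
  interpret H: hilbert_space H ip using H by (simp add: is_rkhs_def hilbert_space_on_iff)
  note kH = kernel_fun_mem_gen[OF H] and kR = kernel_fun_mem_gen[OF is_rkhs_rk]
  have sub: "x \<in> rk_carrier K" if x: "x \<in> H" for x
  proof (rule gain_least(1))
    fix \<phi> :: "('t \<Rightarrow> real) \<Rightarrow> real" assume \<phi>: "\<phi> \<in> coord_functionals"
    have "ip (x - kernel_fun K \<phi>) (x - kernel_fun K \<phi>) = ip x x - rk_gain K x \<phi>"
      using x kH(1)[OF \<phi>] kH(2)[OF \<phi> x] kH(2)[OF \<phi> kH(1)[OF \<phi>]] H.ip_commute[OF x kH(1)[OF \<phi>]]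
      by (simp add: H.ip_bilinear rk_gain_def)
    moreover have "0 \<le> ip (x - kernel_fun K \<phi>) (x - kernel_fun K \<phi>)" using x kH[OF \<phi>] by (intro H.ip_nonneg) auto
    ultimately show "rk_gain K x \<phi> \<le> ip x x" by simp
  qed
  have eq: "x \<in> H \<and> ip x x = rk_sqnorm K x" if x: "x \<in> rk_carrier K" for x
  proof -
    have "\<exists>\<phi>\<in>coord_functionals. norm_of (rk_ip K) (x - kernel_fun K \<phi>) < 1 / real (Suc n)" for n
      by (rule kernel_funs_dense_rk[OF x]) auto
    then obtain \<phi> where \<phi>: "\<And>n. \<phi> n \<in> coord_functionals"
      "\<And>n. norm_of (rk_ip K) (x - kernel_fun K (\<phi> n)) < 1 / real (Suc n)" by metis
    define k where "k = (\<lambda>n. kernel_fun K (\<phi> n))"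
    have kn: "k n \<in> H" "k n \<in> rk_carrier K" for n unfolding k_def using kH \<phi> kR by auto
    have ipk: "ip (k m) (k n) = rk_ip K (k m) (k n)" for m n
      unfolding k_def using kH(2)[OF \<phi>(1), of "k m" n] kR(2)[OF \<phi>(1), of "k m" n] kn by (simp add: k_def)
    have nk: "norm_of ip (k m - k n) = norm_of (rk_ip K) (k m - k n)" for m n
      unfolding norm_of_def using kn by (simp add: H.ip_bilinear ip_bilinear ipk)
    have lim0: "(\<lambda>n. norm_of (rk_ip K) (k n - x)) \<longlonglongrightarrow> 0"
    proof (rule Lim_null_comparison)
      show "\<forall>\<^sub>F n in sequentially. norm (norm_of (rk_ip K) (k n - x)) \<le> 1 / real (Suc n)"
        using \<phi>(2) kn x nrm_diff_commute[OF x kn(2)] by (auto simp: k_def intro!: always_eventually less_imp_le)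
    qed (rule LIMSEQ_Suc[OF lim_1_over_n])
    have "\<exists>l\<in>H. (\<lambda>n. norm_of ip (k n - l)) \<longlonglongrightarrow> 0"
    proof (rule H.complete)
      fix e :: real assume "e > 0"
      then obtain N where "\<forall>n\<ge>N. norm (norm_of (rk_ip K) (k n - x) - 0) < e/2"
        using LIMSEQ_D[OF lim0, of "e/2"] by auto
      then have N: "norm_of (rk_ip K) (k n - x) < e/2" if "n \<ge> N" for n
        using that by (auto simp: abs_less_iff)
      have "norm_of ip (k m - k n) < e" if "m \<ge> N" "n \<ge> N" for m n
        using nrm_triangle_diff[OF kn(2) x kn(2), of m n] N[OF that(1)] N[OF that(2)] nrm_diff_commute[OF x kn(2), of n]
        by (simp add: nk)
      then show "\<exists>N. \<forall>m\<ge>N. \<forall>n\<ge>N. norm_of ip (k m - k n) < e" by blast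
    qed (rule kn)
    then obtain y where y: "y \<in> H" "(\<lambda>n. norm_of ip (k n - y)) \<longlonglongrightarrow> 0" by blast
    have repr: "ip z (\<lambda>s. K s t) = z t" "(\<lambda>s. K s t) \<in> H" if "z \<in> H" for z t
      using H that by (auto simp: is_rkhs_def)
    have "x = y"
    proof
      fix t
      have a: "(\<lambda>n. k n t) \<longlonglongrightarrow> y t"
        using H.ip_tendsto[OF kn(1) y(1) repr(2)[OF y(1)] y(2), of t] repr kn y(1) by simp
      have b: "(\<lambda>n. k n t) \<longlonglongrightarrow> x t"
        using ip_tendsto[OF kn(2) x kernel_mem lim0, of t] reproducing kn x by simp
      show "x t = y t" by (rule LIMSEQ_unique[OF b a])
    qed
    have n1: "(\<lambda>n. norm_of ip (k n)) \<longlonglongrightarrow> norm_of ip y"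
    proof (rule Lim_transform[OF tendsto_const])
      show "(\<lambda>n. norm_of ip (k n) - norm_of ip y) \<longlonglongrightarrow> 0"
        using H.nrm_triangle_rev[OF kn(1) y(1)] by (intro Lim_null_comparison[OF _ y(2)]) auto
    qed
    have n2: "(\<lambda>n. norm_of (rk_ip K) (k n)) \<longlonglongrightarrow> norm_of (rk_ip K) x"
    proof (rule Lim_transform[OF tendsto_const])
      show "(\<lambda>n. norm_of (rk_ip K) (k n) - norm_of (rk_ip K) x) \<longlonglongrightarrow> 0"
        using nrm_triangle_rev[OF kn(2) x] by (intro Lim_null_comparison[OF _ lim0]) auto
    qed
    have "norm_of ip (k n) = norm_of (rk_ip K) (k n)" for n by (simp add: norm_of_def ipk)
    then have "norm_of ip y = norm_of (rk_ip K) x" using LIMSEQ_unique[OF n1] n2 by simp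
    then have "ip y y = rk_ip K x x"
      using H.nrm_sq[OF y(1)] nrm_sq[OF x] by simp
    then show ?thesis using \<open>x = y\<close> y(1) rk_ip_facts(2)[OF x] by simp
  qed
  show HH: "H = rk_carrier K" using sub eq by blast
  have sq: "ip x x = rk_ip K x x" if "x \<in> rk_carrier K" for x using eq[OF that] rk_ip_facts(2)[OF that] by simp
  have "ip x y = rk_ip K x y" for x y
  proof (cases "x \<in> rk_carrier K \<and> y \<in> rk_carrier K")
    case True
    then have h: "x \<in> H" "y \<in> H" "x \<in> rk_carrier K" "y \<in> rk_carrier K" using HH by auto
    have "ip (x + y) (x + y) = ip x x + 2 * ip x y + ip y y"
      using h H.ip_commute[OF h(1,2)] by (simp add: H.ip_bilinear)
    moreover have "rk_ip K (x + y) (x + y) = rk_ip K x x + 2 * rk_ip K x y + rk_ip K y y"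
      using h ip_commute[OF h(3,4)] by (simp add: ip_bilinear)
    ultimately show ?thesis using sq[of "x + y"] sq[OF h(3)] sq[OF h(4)] h by simp
  next
    case False
    then show ?thesis using H HH by (auto simp: is_rkhs_def rk_ip_def)
  qed
  then show "ip = rk_ip K" by blast
qed

lemma rkhs_eq: "rkhs K = (rk_carrier K, rk_ip K)"
  unfolding rkhs_def
proof (rule the_equality)
  fix p assume "is_rkhs K p"
  then show "p = (rk_carrier K, rk_ip K)" using is_rkhs_unique[of "fst p" "snd p"] by (cases p) simp
qed (rule is_rkhs_rk)

lemma is_rkhs_rkhs: "is_rkhs K (rkhs_space K, rkhs_inner K)"
  using is_rkhs_rk by (simp add: rkhs_eq)

lemma kernel_funs_dense:
  "x \<in> rkhs_space K \<Longrightarrow> e > 0 \<Longrightarrow> \<exists>\<phi>\<in>coord_functionals. norm_of (rkhs_inner K) (x - kernel_fun K \<phi>) < e"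
  using kernel_funs_dense_rk by (simp add: rkhs_eq)

end

section \<open>Orthonormal Gaussian families\<close>

lemma measurable_If_const:
  assumes "P \<Longrightarrow> f \<in> borel_measurable M"
  shows "(\<lambda>x. if P then f x else (0::real)) \<in> borel_measurable M"
  using assms by (cases P) auto

text \<open>Sums of measurable maps into a nonseparable space need not be measurable. Here the sum
  is a continuous function of a real coefficient sequence, and sequences are measurable
  coordinatewise.\<close>

lemma measurable_lincomb:
  fixes u :: "nat \<Rightarrow> 'x::real_normed_vector"
  assumes "finite I" "\<And>i. i \<in> I \<Longrightarrow> \<eta> i \<in> borel_measurable M"
  shows "(\<lambda>x. \<Sum>i\<in>I. \<eta> i x *\<^sub>R u i) \<in> borel_measurable M"
proof -
  define U where "U = (\<lambda>x i. if i \<in> I then \<eta> i x else 0)"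
  have [measurable]: "U \<in> borel_measurable M"
    by (rule measurable_coordinatewise_then_product, unfold U_def, rule measurable_If_const[OF assms(2)])
  have [measurable]: "(\<lambda>a::nat \<Rightarrow> real. \<Sum>i\<in>I. a i *\<^sub>R u i) \<in> borel_measurable borel"
    by (intro borel_measurable_continuous_onI continuous_intros continuous_on_product_coordinates)
  have "(\<lambda>x. (\<lambda>a::nat \<Rightarrow> real. \<Sum>i\<in>I. a i *\<^sub>R u i) (U x)) \<in> borel_measurable M"
    by measurable
  then show ?thesis by (simp add: U_def)
qed

text \<open>Joint Gaussianity with identity covariance, expressed through linear combinations. The
  form fits both members of \<open>\<xi>\<close> and continuous functionals under a Gaussian
  measure.\<close>

definition gauss_orthonormal :: "'a measure \<Rightarrow> nat \<Rightarrow> (nat \<Rightarrow> 'a \<Rightarrow> real) \<Rightarrow> bool"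
  where "gauss_orthonormal M n \<eta> \<longleftrightarrow>
    (\<forall>c. cgauss M (\<lambda>x. \<Sum>i<n. c i * \<eta> i x) \<and> (\<integral>x. (\<Sum>i<n. c i * \<eta> i x)\<^sup>2 \<partial>M) = (\<Sum>i<n. (c i)\<^sup>2))"

lemma gauss_orthonormal_component:
  assumes "gauss_orthonormal M n \<eta>" "i < n"
  shows "cgauss M (\<eta> i)" "(\<integral>x. (\<eta> i x)\<^sup>2 \<partial>M) = 1"
proof -
  have e: "(\<lambda>x. \<Sum>j<n. (if j = i then 1 else 0) * \<eta> j x) = \<eta> i"
    using assms(2) by (simp add: if_distrib[of "\<lambda>z. z * _"] sum.delta cong: if_cong)
  have "(\<Sum>j<n. (if j = i then 1 else 0::real)\<^sup>2) = 1"
    using assms(2) by (simp add: if_distrib[of "\<lambda>z. z\<^sup>2"] sum.delta cong: if_cong)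
  then show "cgauss M (\<eta> i)" "(\<integral>x. (\<eta> i x)\<^sup>2 \<partial>M) = 1"
    using assms(1)[unfolded gauss_orthonormal_def, rule_format, of "\<lambda>j. if j = i then 1 else 0"] e
    by (auto simp: fun_eq_iff)
qed

lemma gauss_orthonormal_measurable:
  "gauss_orthonormal M n \<eta> \<Longrightarrow> i < n \<Longrightarrow> \<eta> i \<in> borel_measurable M"
  using gauss_orthonormal_component(1) cgauss_measurable by blast

text \<open>Both coefficient vectors, padded by zeros to sequences, have the same law, and the
  integrand is a function of the sequence. Estimates on \<open>\<gamma>\<close> and \<gamma>-norms
  formed with \<open>\<xi>\<close> are exchanged through this equality.\<close>

lemma gauss_orthonormal_nn_integral:
  fixes u :: "nat \<Rightarrow> 'x::real_normed_vector"
  assumes M: "prob_space M1" "prob_space M2"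
    and \<eta>: "gauss_orthonormal M1 n \<eta>" and \<zeta>: "gauss_orthonormal M2 n \<zeta>"
  shows "(\<integral>\<^sup>+x. ennreal ((norm (\<Sum>i<n. \<eta> i x *\<^sub>R u i))\<^sup>2) \<partial>M1) =
    (\<integral>\<^sup>+x. ennreal ((norm (\<Sum>i<n. \<zeta> i x *\<^sub>R u i))\<^sup>2) \<partial>M2)"
proof -
  define U where "U = (\<lambda>x i. if i < n then \<eta> i x else 0)"
  define V where "V = (\<lambda>x i. if i < n then \<zeta> i x else 0)"
  have Um[measurable]: "U \<in> borel_measurable M1"
    by (rule measurable_coordinatewise_then_product, unfold U_def, rule measurable_If_const[OF gauss_orthonormal_measurable[OF \<eta>]])
  have Vm[measurable]: "V \<in> borel_measurable M2"
    by (rule measurable_coordinatewise_then_product, unfold V_def, rule measurable_If_const[OF gauss_orthonormal_measurable[OF \<zeta>]])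
  have law: "distr M1 borel U = distr M2 borel V"
  proof (rule law_eq_gaussI[OF M Um Vm])
    fix \<phi> :: "(nat \<Rightarrow> real) \<Rightarrow> real" assume "\<phi> \<in> coord_functionals"
    then obtain J c where J: "finite J" "\<phi> = (\<lambda>x. \<Sum>i\<in>J. c i * x i)"
      using coord_functionals_explicit by blast
    define d where "d = (\<lambda>i. if i \<in> J then c i else 0)"
    have e: "\<phi> (\<lambda>i. if i < n then y i else 0) = (\<Sum>i<n. d i * y i)" for y
    proof -
      have "\<phi> (\<lambda>i. if i < n then y i else 0) = (\<Sum>i\<in>J. d i * (if i < n then y i else 0))"
        by (simp add: J d_def)
      also have "\<dots> = (\<Sum>i\<in>J \<inter> {..<n}. d i * y i)"
        using J by (intro sum.mono_neutral_cong_right) auto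
      also have "\<dots> = (\<Sum>i<n. d i * y i)"
        by (intro sum.mono_neutral_left) (auto simp: d_def)
      finally show ?thesis .
    qed
    show "cgauss M1 (\<lambda>x. \<phi> (U x)) \<and> cgauss M2 (\<lambda>x. \<phi> (V x)) \<and>
      (\<integral>x. (\<phi> (U x))\<^sup>2 \<partial>M1) = (\<integral>x. (\<phi> (V x))\<^sup>2 \<partial>M2)"
      using \<eta> \<zeta> unfolding U_def V_def e gauss_orthonormal_def by auto
  qed
  define g where "g = (\<lambda>a::nat \<Rightarrow> real. ennreal ((norm (\<Sum>i<n. a i *\<^sub>R u i))\<^sup>2))"
  have "(\<lambda>a::nat \<Rightarrow> real. \<Sum>i<n. a i *\<^sub>R u i) \<in> borel_measurable borel"
    by (intro borel_measurable_continuous_onI continuous_intros continuous_on_product_coordinates)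
  then have g[measurable]: "g \<in> borel_measurable borel" unfolding g_def by measurable
  have "(\<integral>\<^sup>+x. g (U x) \<partial>M1) = (\<integral>\<^sup>+a. g a \<partial>distr M1 borel U)"
    by (rule nn_integral_distr[symmetric]) auto
  also have "\<dots> = (\<integral>\<^sup>+x. g (V x) \<partial>M2)"
    unfolding law by (rule nn_integral_distr) auto
  finally show ?thesis by (simp add: g_def U_def V_def)
qed

lemma gauss_orthonormal_integrable:
  fixes u :: "nat \<Rightarrow> 'x::real_normed_vector"
  assumes M: "prob_space M" and \<eta>: "gauss_orthonormal M n \<eta>"
  shows "integrable M (\<lambda>x. (norm (\<Sum>i<n. \<eta> i x *\<^sub>R u i))\<^sup>2)"
proof (rule Bochner_Integration.integrable_bound)
  show "integrable M (\<lambda>x. (\<Sum>i<n. (\<eta> i x)\<^sup>2) * (\<Sum>i<n. (norm (u i))\<^sup>2))"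
    by (intro integrable_mult_left Bochner_Integration.integrable_sum)
       (use cgauss_properties(1)[OF M gauss_orthonormal_component(1)[OF \<eta>]] in auto)
  have [measurable]: "(\<lambda>x. \<Sum>i<n. \<eta> i x *\<^sub>R u i) \<in> borel_measurable M"
    using gauss_orthonormal_measurable[OF \<eta>] by (intro measurable_lincomb) auto
  show "(\<lambda>x. (norm (\<Sum>i<n. \<eta> i x *\<^sub>R u i))\<^sup>2) \<in> borel_measurable M" by measurable
  have "(norm (\<Sum>i<n. \<eta> i x *\<^sub>R u i))\<^sup>2 \<le> (\<Sum>i<n. (\<eta> i x)\<^sup>2) * (\<Sum>i<n. (norm (u i))\<^sup>2)" for x
  proof -
    have "norm (\<Sum>i<n. \<eta> i x *\<^sub>R u i) \<le> (\<Sum>i<n. \<bar>\<eta> i x\<bar> * norm (u i))"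
      by (rule order_trans[OF norm_sum]) simp
    then have "(norm (\<Sum>i<n. \<eta> i x *\<^sub>R u i))\<^sup>2 \<le> (\<Sum>i<n. \<bar>\<eta> i x\<bar> * norm (u i))\<^sup>2"
      by (intro power_mono) auto
    also have "\<dots> \<le> (\<Sum>i<n. \<bar>\<eta> i x\<bar>\<^sup>2) * (\<Sum>i<n. (norm (u i))\<^sup>2)"
      by (rule Cauchy_Schwarz_ineq_sum)
    finally show ?thesis by simp
  qed
  then show "AE x in M. norm ((norm (\<Sum>i<n. \<eta> i x *\<^sub>R u i))\<^sup>2) \<le> norm ((\<Sum>i<n. (\<eta> i x)\<^sup>2) * (\<Sum>i<n. (norm (u i))\<^sup>2))"
    by (intro always_eventually allI) (simp, smt (verit) abs_ge_self order_trans)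
qed

lemma std_gaussian_sequence_lincomb:
  assumes std: "std_gaussian_sequence M \<xi>" and I: "finite I"
  shows "cgauss M (\<lambda>x. \<Sum>k\<in>I. c k * \<xi> k x)" "(\<integral>x. (\<Sum>k\<in>I. c k * \<xi> k x)\<^sup>2 \<partial>M) = (\<Sum>k\<in>I. (c k)\<^sup>2)"
proof -
  have M: "prob_space M" using std by (simp add: std_gaussian_sequence_def)
  interpret prob_space M by fact
  have ind: "indep_vars (\<lambda>_. borel) \<xi> UNIV" and dist: "\<And>k. distributed M lborel (\<xi> k) std_normal_density"
    using std by (auto simp: std_gaussian_sequence_def)
  have xm[measurable]: "\<xi> k \<in> borel_measurable M" for k using distributed_measurable[OF dist[of k]] by simp
  have g: "cgauss M (\<xi> k)" for k
  proof -
    have "distr M borel (\<xi> k) = distr M lborel (\<xi> k)" by (rule distr_cong) auto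
    also have "\<dots> = density lborel std_normal_density" by (rule distributed_distr_eq_density[OF dist])
    finally show ?thesis unfolding cgauss_def centered_gaussian_real_def by (auto intro!: exI[of _ 1])
  qed
  have v: "(\<integral>x. (\<xi> k x)\<^sup>2 \<partial>M) = 1" for k
  proof -
    have "(\<integral>x. (\<xi> k x)\<^sup>2 \<partial>M) = (\<integral>x. std_normal_density x * x\<^sup>2 \<partial>lborel)"
      by (rule distributed_integral[OF dist, symmetric]) auto
    then show ?thesis using integral_std_normal_moment_even[of 1] by simp
  qed
  have ch: "char (distr M borel (\<lambda>x. \<Sum>k\<in>I. c k * \<xi> k x)) s = complex_of_real (exp (- (s\<^sup>2 * (\<Sum>k\<in>I. (c k)\<^sup>2) / 2)))" for s
  proof -
    have "indep_vars (\<lambda>_. borel) (\<lambda>k x. c k * \<xi> k x) I"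
      by (rule indep_vars_compose2[where X=\<xi> and Y="\<lambda>k x. c k * x", OF indep_vars_subset[OF ind]]) auto
    then have "char (distr M borel (\<lambda>x. \<Sum>k\<in>I. c k * \<xi> k x)) s = (\<Prod>k\<in>I. char (distr M borel (\<lambda>x. c k * \<xi> k x)) s)"
      by (rule char_distr_sum)
    also have "\<dots> = (\<Prod>k\<in>I. complex_of_real (exp (- (s\<^sup>2 * (c k)\<^sup>2 / 2))))"
    proof (rule prod.cong[OF refl])
      fix k
      show "char (distr M borel (\<lambda>x. c k * \<xi> k x)) s = complex_of_real (exp (- (s\<^sup>2 * (c k)\<^sup>2 / 2)))"
        using cgauss_properties(4)[OF M cgauss_scale[OF M g[of k], of "c k"], of s]
        by (simp add: power_mult_distrib v)
    qed
    also have "\<dots> = complex_of_real (\<Prod>k\<in>I. exp (- (s\<^sup>2 * (c k)\<^sup>2 / 2)))" by (rule of_real_prod[symmetric])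
    also have "(\<Prod>k\<in>I. exp (- (s\<^sup>2 * (c k)\<^sup>2 / 2))) = exp (\<Sum>k\<in>I. - (s\<^sup>2 * (c k)\<^sup>2 / 2))"
      by (rule exp_sum[OF I, symmetric])
    also have "(\<Sum>k\<in>I. - (s\<^sup>2 * (c k)\<^sup>2 / 2)) = - (s\<^sup>2 * (\<Sum>k\<in>I. (c k)\<^sup>2) / 2)"
      by (simp add: sum_negf sum_distrib_left sum_divide_distrib)
    finally show ?thesis .
  qed
  have "0 \<le> (\<Sum>k\<in>I. (c k)\<^sup>2)" by (intro sum_nonneg) auto
  note * = cgaussI[OF M _ this ch]
  show "cgauss M (\<lambda>x. \<Sum>k\<in>I. c k * \<xi> k x)" by (rule *(1)) measurable
  show "(\<integral>x. (\<Sum>k\<in>I. c k * \<xi> k x)\<^sup>2 \<partial>M) = (\<Sum>k\<in>I. (c k)\<^sup>2)" by (rule *(2)) measurable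
qed

text \<open>Coefficients will be attached to vectors by an enumeration of a countable set, so those
  of a finite subset need not form an initial segment of the sequence; hence
  \<open>\<sigma>\<close>.\<close>

lemma std_gaussian_sequence_orthonormal:
  assumes std: "std_gaussian_sequence M \<xi>" and \<sigma>: "inj_on \<sigma> {..<n}"
  shows "gauss_orthonormal M n (\<lambda>i. \<xi> (\<sigma> i))"
proof -
  have e: "(\<Sum>i<n. c i * \<xi> (\<sigma> i) x) = (\<Sum>k\<in>\<sigma> ` {..<n}. c (inv_into {..<n} \<sigma> k) * \<xi> k x)"
    "(\<Sum>i<n. (c i)\<^sup>2) = (\<Sum>k\<in>\<sigma> ` {..<n}. (c (inv_into {..<n} \<sigma> k))\<^sup>2)" for c :: "nat \<Rightarrow> real" and x
    by (simp_all add: sum.reindex[OF \<sigma>] \<sigma>)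
  show ?thesis unfolding gauss_orthonormal_def e
    using std_gaussian_sequence_lincomb[OF std, of "\<sigma> ` {..<n}"] by auto
qed

section \<open>Estimates of \<gamma>-norms, and orthonormal sets\<close>

lemma gamma_norm_le:
  assumes std: "std_gaussian_sequence M \<xi>" and c: "0 \<le> c"
    and le: "\<And>n h. orthonormal_system H ip n h \<Longrightarrow>
      (\<integral>\<^sup>+\<omega>. ennreal ((norm (\<Sum>k<n. \<xi> k \<omega> *\<^sub>R A (h k)))\<^sup>2) \<partial>M) \<le> ennreal (c\<^sup>2)"
  shows "gamma_norm M \<xi> H ip A \<le> ereal c"
  unfolding gamma_norm_def
proof (rule SUP_least, clarsimp)
  fix n h assume h: "orthonormal_system H ip n h"
  have M: "prob_space M" using std by (simp add: std_gaussian_sequence_def)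
  note g = std_gaussian_sequence_orthonormal[OF std, of id n, simplified]
  have "ennreal (\<integral>\<omega>. (norm (\<Sum>k<n. \<xi> k \<omega> *\<^sub>R A (h k)))\<^sup>2 \<partial>M) =
      (\<integral>\<^sup>+\<omega>. ennreal ((norm (\<Sum>k<n. \<xi> k \<omega> *\<^sub>R A (h k)))\<^sup>2) \<partial>M)"
    by (rule nn_integral_eq_integral[symmetric, OF gauss_orthonormal_integrable[OF M g]]) auto
  also have "\<dots> \<le> ennreal (c\<^sup>2)" by (rule le[OF h])
  finally have "(\<integral>\<omega>. (norm (\<Sum>k<n. \<xi> k \<omega> *\<^sub>R A (h k)))\<^sup>2 \<partial>M) \<le> c\<^sup>2" by simp
  then show "sqrt (\<integral>\<omega>. (norm (\<Sum>k<n. \<xi> k \<omega> *\<^sub>R A (h k)))\<^sup>2 \<partial>M) \<le> c"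
    by (rule order_trans[OF real_sqrt_le_mono]) (use c in simp)
qed

lemma gamma_norm_bound:
  assumes std: "std_gaussian_sequence M \<xi>" and c: "gamma_norm M \<xi> H ip A \<le> ereal c"
    and h: "orthonormal_system H ip n h" and N: "prob_space N" and \<eta>: "gauss_orthonormal N n \<eta>"
  shows "0 \<le> c" "(\<integral>\<^sup>+\<omega>. ennreal ((norm (\<Sum>k<n. \<eta> k \<omega> *\<^sub>R A (h k)))\<^sup>2) \<partial>N) \<le> ennreal (c\<^sup>2)"
proof -
  have M: "prob_space M" using std by (simp add: std_gaussian_sequence_def)
  note g = std_gaussian_sequence_orthonormal[OF std, of id n, simplified]
  let ?I = "\<integral>\<omega>. (norm (\<Sum>k<n. \<xi> k \<omega> *\<^sub>R A (h k)))\<^sup>2 \<partial>M"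
  have "ereal (sqrt ?I) \<le> gamma_norm M \<xi> H ip A"
    unfolding gamma_norm_def by (rule SUP_upper2[of "(n, h)"]) (use h in auto)
  from order_trans[OF this c] have le: "sqrt ?I \<le> c" by simp
  moreover have I0: "0 \<le> ?I" by (rule integral_nonneg_AE) auto
  ultimately show c0: "0 \<le> c" by (meson order_trans real_sqrt_ge_zero)
  have "?I \<le> c\<^sup>2" by (rule sqrt_le_D[OF le])
  have "(\<integral>\<^sup>+\<omega>. ennreal ((norm (\<Sum>k<n. \<eta> k \<omega> *\<^sub>R A (h k)))\<^sup>2) \<partial>N) =
    (\<integral>\<^sup>+\<omega>. ennreal ((norm (\<Sum>k<n. \<xi> k \<omega> *\<^sub>R A (h k)))\<^sup>2) \<partial>M)"
    by (rule gauss_orthonormal_nn_integral[OF N M \<eta> g])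
  also have "\<dots> = ennreal ?I"
    by (rule nn_integral_eq_integral[OF gauss_orthonormal_integrable[OF M g]]) auto
  also have "\<dots> \<le> ennreal (c\<^sup>2)" using \<open>?I \<le> c\<^sup>2\<close> by (rule ennreal_leI)
  finally show "(\<integral>\<^sup>+\<omega>. ennreal ((norm (\<Sum>k<n. \<eta> k \<omega> *\<^sub>R A (h k)))\<^sup>2) \<partial>N) \<le> ennreal (c\<^sup>2)" .
qed

context ip_space
begin

lemma bounded_linear_onD:
  assumes "bounded_linear_on H ip A"
  shows "x \<in> H \<Longrightarrow> y \<in> H \<Longrightarrow> A (x + y) = A x + A y" "x \<in> H \<Longrightarrow> A (c *\<^sub>R x) = c *\<^sub>R A x"
    "A 0 = 0" "x \<in> H \<Longrightarrow> y \<in> H \<Longrightarrow> A (x - y) = A x - A y" "\<exists>C>0. \<forall>x\<in>H. norm (A x) \<le> C * nrm x"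
proof -
  show a: "A (x + y) = A x + A y" if "x \<in> H" "y \<in> H" for x y using assms that by (auto simp: bounded_linear_on_def)
  show s: "A (c *\<^sub>R x) = c *\<^sub>R A x" if "x \<in> H" for x c using assms that by (auto simp: bounded_linear_on_def)
  show "A 0 = 0" using s[OF mem(1), of 0] by simp
  show "A (x - y) = A x - A y" if "x \<in> H" "y \<in> H" for x y
    using a[of x "-y"] s[of y "-1"] that by simp
  obtain C where C: "\<And>x. x \<in> H \<Longrightarrow> norm (A x) \<le> C * nrm x" using assms unfolding bounded_linear_on_def by blast
  have "norm (A x) \<le> (\<bar>C\<bar> + 1) * nrm x" if "x \<in> H" for x
    by (rule order_trans[OF C[OF that]], rule mult_right_mono) (use that abs_ge_self[of C] in auto)
  then show "\<exists>C>0. \<forall>x\<in>H. norm (A x) \<le> C * nrm x" by (intro exI[of _ "\<bar>C\<bar> + 1"]) auto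
qed

lemma bounded_linear_on_sum:
  assumes "bounded_linear_on H ip A" "\<And>i. i \<in> I \<Longrightarrow> x i \<in> H"
  shows "A (\<Sum>i\<in>I. c i *\<^sub>R x i) = (\<Sum>i\<in>I. c i *\<^sub>R A (x i))"
  using assms(2)
proof (induction I rule: infinite_finite_induct)
  case (insert i I)
  then have "(\<Sum>i\<in>I. c i *\<^sub>R x i) \<in> H" by (intro mem_sum) auto
  with insert show ?case by (simp add: bounded_linear_onD[OF assms(1)])
qed (simp_all add: bounded_linear_onD[OF assms(1)])

lemma bounded_linear_on_tendsto:
  assumes A: "bounded_linear_on H ip A" and "\<And>n. x n \<in> H" "l \<in> H" "(\<lambda>n. nrm (x n - l)) \<longlonglongrightarrow> 0"
  shows "(\<lambda>n. A (x n)) \<longlonglongrightarrow> A l"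
proof -
  obtain C where C: "C > 0" "\<And>x. x \<in> H \<Longrightarrow> norm (A x) \<le> C * nrm x" using bounded_linear_onD(5)[OF A] by blast
  have "(\<lambda>n. A (x n) - A l) \<longlonglongrightarrow> 0"
  proof (rule Lim_null_comparison)
    show "\<forall>\<^sub>F n in sequentially. norm (A (x n) - A l) \<le> C * nrm (x n - l)"
      using C(2)[of "x _ - l"] assms by (simp add: bounded_linear_onD[OF A])
    show "(\<lambda>n. C * nrm (x n - l)) \<longlonglongrightarrow> 0"
      using tendsto_mult_right_zero[OF assms(4)] by simp
  qed
  then show ?thesis by (simp add: LIM_zero_iff)
qed

text \<open>Unindexed counterpart of \<open>orthonormal_system\<close>: sets can be enlarged and
  compared by inclusion, while \<gamma>-norms refer to indexed systems.\<close>

definition orthonormal_set where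
  "orthonormal_set P \<longleftrightarrow> P \<subseteq> H \<and> (\<forall>e\<in>P. \<forall>e'\<in>P. ip e e' = (if e = e' then 1 else 0))"

lemma orthonormal_set_coeff:
  assumes P: "orthonormal_set P" "finite P" and e: "e \<in> P"
  shows "ip (\<Sum>e\<in>P. c e *\<^sub>R e) e = c e" "(\<Sum>e\<in>P. c e *\<^sub>R e) \<in> H"
proof -
  have PH: "P \<subseteq> H" using P by (simp add: orthonormal_set_def)
  have "ip (\<Sum>e'\<in>P. c e' *\<^sub>R e') e = (\<Sum>e'\<in>P. c e' * ip e' e)"
    using PH e by (subst ip_sum_left) (auto simp: ip_scale_left subset_eq)
  also have "\<dots> = (\<Sum>e'\<in>P. if e' = e then c e else 0)"
    using P e by (intro sum.cong) (auto simp: orthonormal_set_def)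
  finally show "ip (\<Sum>e\<in>P. c e *\<^sub>R e) e = c e" using P e by simp
  show "(\<Sum>e\<in>P. c e *\<^sub>R e) \<in> H" using PH by (intro mem_sum) auto
qed

lemma orthonormal_set_sqnorm:
  assumes P: "orthonormal_set P" "finite P"
  shows "ip (\<Sum>e\<in>P. c e *\<^sub>R e) (\<Sum>e\<in>P. d e *\<^sub>R e) = (\<Sum>e\<in>P. c e * d e)"
proof -
  have PH: "P \<subseteq> H" using P by (simp add: orthonormal_set_def)
  have sH: "(\<Sum>e\<in>P. c e *\<^sub>R e) \<in> H" for c using PH by (intro mem_sum) auto
  have "ip (\<Sum>e\<in>P. c e *\<^sub>R e) (\<Sum>e\<in>P. d e *\<^sub>R e) = (\<Sum>e\<in>P. d e * ip (\<Sum>e\<in>P. c e *\<^sub>R e) e)"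
    using PH sH by (subst ip_sum_right) (auto simp: ip_scale_right subset_eq)
  also have "\<dots> = (\<Sum>e\<in>P. c e * d e)"
    using orthonormal_set_coeff(1)[OF P] by (simp add: mult.commute)
  finally show ?thesis .
qed

lemma orthonormal_set_subset: "orthonormal_set P \<Longrightarrow> Q \<subseteq> P \<Longrightarrow> orthonormal_set Q"
  unfolding orthonormal_set_def by blast

lemma orthonormal_system_enum:
  assumes "orthonormal_set P" "bij_betw h {..<n} P"
  shows "orthonormal_system H ip n h"
proof -
  have i: "inj_on h {..<n}" "\<And>k. k < n \<Longrightarrow> h k \<in> P" using assms(2) by (auto simp: bij_betw_def)
  show ?thesis unfolding orthonormal_system_def
  proof (intro conjI allI impI)
    fix k assume "k < n" then show "h k \<in> H" using i assms(1) by (auto simp: orthonormal_set_def)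
  next
    fix j k assume jk: "j < n" "k < n"
    have "(h j = h k) = (j = k)" using i(1) jk by (auto simp: inj_on_def)
    then show "ip (h j) (h k) = (if j = k then 1 else 0)"
      using i(2)[OF jk(1)] i(2)[OF jk(2)] assms(1) by (simp add: orthonormal_set_def)
  qed
qed

end

context hilbert_space
begin

text \<open>Below, \<open>W\<close> is the complement of \<open>V\<close>, the kernel of \<open>B\<close>, inside the complement of \<open>Q\<close>.  An orthonormal
  set in \<open>W\<close> is mapped by \<open>B\<close> injectively onto an independent set, so its size is bounded by the rank.\<close>

lemma finite_rank_orthonormal_extension:
  assumes B: "bounded_linear_on H ip B" and fr: "finite_rank_on H B"
    and Q: "orthonormal_set Q" "finite Q"
  shows "\<exists>P. orthonormal_set P \<and> finite P \<and> Q \<subseteq> P \<and> (\<forall>h\<in>H. (\<forall>e\<in>P. ip h e = 0) \<longrightarrow> B h = 0)"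
proof -
  obtain S where S: "finite S" "B ` H \<subseteq> span S" using fr by (auto simp: finite_rank_on_def)
  note lin = bounded_linear_onD[OF B]
  have QH: "Q \<subseteq> H" using Q by (simp add: orthonormal_set_def)
  define V where "V = {h \<in> H. B h = 0 \<and> (\<forall>e\<in>Q. ip h e = 0)}"
  define W where "W = {h \<in> H. (\<forall>e\<in>Q. ip h e = 0) \<and> (\<forall>v\<in>V. ip h v = 0)}"
  have VH: "V \<subseteq> H" "W \<subseteq> H" by (auto simp: V_def W_def)
  have sV: "subspace V" unfolding subspace_def V_def
    using QH by (auto simp: lin ip_add_left ip_scale_left subset_eq)
  have sW: "subspace W" unfolding subspace_def W_def
    using QH VH by (auto simp: ip_add_left ip_scale_left subset_eq)
  have VW: "x = 0" if "x \<in> V" "x \<in> W" for x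
    using that by (intro ip_eq_0) (auto simp: V_def W_def)
  have proj: "\<exists>u\<in>V. \<forall>v\<in>V. ip (h - u) v = 0" if "h \<in> H" for h
  proof (rule projection[OF sV VH(1) _ that])
    fix v l assume v: "\<And>n::nat. v n \<in> V" and l: "l \<in> H" "(\<lambda>n. nrm (v n - l)) \<longlonglongrightarrow> 0"
    have vH: "v n \<in> H" "B (v n) = 0" for n using v[of n] by (auto simp: V_def)
    have "(\<lambda>n. B (v n)) \<longlonglongrightarrow> B l" by (rule bounded_linear_on_tendsto[OF B vH(1) l])
    then have "B l = 0" using vH(2) by (simp add: LIMSEQ_const_iff)
    moreover have "ip l e = 0" if e: "e \<in> Q" for e
    proof -
      have "(\<lambda>n. ip (v n) e) \<longlonglongrightarrow> ip l e" using QH e by (intro ip_tendsto[OF vH(1) l(1) _ l(2)]) auto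
      moreover have "ip (v n) e = 0" for n using v[of n] e by (auto simp: V_def)
      ultimately show ?thesis by (simp add: LIMSEQ_const_iff)
    qed
    ultimately show "l \<in> V" using l by (simp add: V_def)
  qed
  define good where "good = (\<lambda>P. orthonormal_set P \<and> finite P \<and> P \<subseteq> W)"
  have cardP: "card P \<le> card S" if "good P" for P
  proof -
    have P: "orthonormal_set P" "finite P" "P \<subseteq> W" using that by (auto simp: good_def)
    have PH: "P \<subseteq> H" using P VH by auto
    have zero: "c e = 0" if c: "(\<Sum>e\<in>P. c e *\<^sub>R B e) = 0" and e: "e \<in> P" for c e
    proof -
      let ?h = "\<Sum>e\<in>P. c e *\<^sub>R e"
      have hW: "?h \<in> W" using P by (intro subspace_sum[OF sW] subspace_scale[OF sW]) auto
      have "B ?h = (\<Sum>e\<in>P. c e *\<^sub>R B e)" using PH by (intro bounded_linear_on_sum[OF B]) auto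
      then have "?h \<in> V" using hW c by (auto simp: V_def W_def)
      then have "?h = 0" using hW VW by blast
      then show ?thesis using orthonormal_set_coeff(1)[OF P(1,2) e, of c] e PH by auto
    qed
    have inj: "inj_on B P"
    proof (rule inj_onI)
      fix e e' assume e: "e \<in> P" "e' \<in> P" "B e = B e'"
      show "e = e'"
      proof (rule ccontr)
        assume ne: "e \<noteq> e'"
        have "(\<Sum>x\<in>P. ((if x = e then 1 else 0) - (if x = e' then 1 else 0)) *\<^sub>R B x) = B e - B e'"
          using e P(2) by (simp add: scaleR_diff_left sum_subtractf if_distrib[of "\<lambda>z. z *\<^sub>R _"] cong: if_cong)
        then show False using zero[of "\<lambda>x. (if x = e then 1 else 0) - (if x = e' then 1 else 0)" e] e ne by simp
      qed
    qed
    have "independent (B ` P)"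
    proof
      assume "dependent (B ` P)"
      then obtain u where u: "\<exists>v\<in>B ` P. u v \<noteq> 0" "(\<Sum>v\<in>B ` P. u v *\<^sub>R v) = 0"
        using dependent_finite[of "B ` P"] P(2) by auto
      then have "(\<Sum>e\<in>P. u (B e) *\<^sub>R B e) = 0" by (simp add: sum.reindex[OF inj])
      then show False using zero[of "\<lambda>e. u (B e)"] u(1) by auto
    qed
    moreover have "B ` P \<subseteq> span S" using S PH by auto
    ultimately have "card (B ` P) \<le> card S" using independent_span_bound[OF S(1)] by blast
    then show ?thesis by (simp add: card_image[OF inj])
  qed
  have "good {}" by (simp add: good_def orthonormal_set_def)
  \<comment> \<open>The rank of \<open>B\<close> bounds the size of good sets, so one of largest
    size exists.\<close>
  moreover have "\<forall>P. good P \<longrightarrow> card P < Suc (card S)" using cardP by (auto simp: less_Suc_eq_le)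
  ultimately have "\<exists>P. good P \<and> (\<forall>P'. good P' \<longrightarrow> card P' \<le> card P)"
    by (rule ex_has_greatest_nat)
  then obtain P where P: "good P" "\<And>P'. good P' \<Longrightarrow> card P' \<le> card P" by blast
  have PH: "P \<subseteq> H" "P \<subseteq> W" "finite P" "orthonormal_set P" using P VH by (auto simp: good_def)
  have "orthonormal_set (Q \<union> P)"
    unfolding orthonormal_set_def
  proof (intro conjI ballI)
    show "Q \<union> P \<subseteq> H" using QH PH by auto
    have qp: "ip p q = 0" "ip q p = 0" if "p \<in> P" "q \<in> Q" for p q
    proof -
      show "ip p q = 0" using that PH by (auto simp: W_def)
      then show "ip q p = 0" using ip_commute[of p q] that PH QH by auto
    qed
    have "e \<noteq> e'" if "e \<in> P" "e' \<in> Q" for e e'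
      using qp[OF that] that PH(4) by (auto simp: orthonormal_set_def)
    then show "ip e e' = (if e = e' then 1 else 0)" if "e \<in> Q \<union> P" "e' \<in> Q \<union> P" for e e'
      using that qp Q(1) PH(4) unfolding orthonormal_set_def by (metis UnE)
  qed
  \<comment> \<open>Removing from \<open>h\<close> its projection \<open>u\<close> on
    \<open>V\<close> leaves a vector of \<open>W\<close> orthogonal to \<open>P\<close>. If it were
    nonzero, normalising it would enlarge \<open>P\<close>; so \<open>h\<close> equals
    \<open>u\<close> and lies in the kernel of \<open>B\<close>.\<close>
  moreover have "B h = 0" if h: "h \<in> H" and perp: "\<And>e. e \<in> Q \<union> P \<Longrightarrow> ip h e = 0" for h
  proof -
    obtain u where u: "u \<in> V" "\<And>v. v \<in> V \<Longrightarrow> ip (h - u) v = 0" using proj[OF h] by blast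
    have uH: "u \<in> H" using u VH by auto
    have wW: "h - u \<in> W" unfolding W_def
      using u h uH perp QH by (auto simp: ip_diff_left V_def subset_eq)
    have wP: "ip (h - u) e = 0" "ip e (h - u) = 0" if "e \<in> P" for e
    proof -
      have eH: "e \<in> H" using that PH by auto
      have "ip e u = 0" using that PH u(1) by (auto simp: W_def)
      then show "ip (h - u) e = 0" using perp[of e] that eH uH h ip_commute[OF eH uH] by (simp add: ip_diff_left)
      then show "ip e (h - u) = 0" using ip_commute[of e "h - u"] eH uH h by simp
    qed
    have "h - u = 0"
    proof (rule ccontr)
      assume ne: "h - u \<noteq> 0"
      have wH: "h - u \<in> H" using h uH by simp
      define e where "e = (1 / nrm (h - u)) *\<^sub>R (h - u)"
      have np: "nrm (h - u) > 0" using ne nrm_eq_0[OF wH] nrm_nonneg[OF wH] by fastforce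
      have e1: "ip e e = 1" using np wH
        by (simp add: e_def ip_scale_left ip_scale_right nrm_sq[OF wH, symmetric] power2_eq_square)
      have eW: "e \<in> W" unfolding e_def by (rule subspace_scale[OF sW wW])
      have eP: "ip e p = 0" "ip p e = 0" if "p \<in> P" for p
        using wP[OF that] that PH wH unfolding e_def by (auto simp: ip_scale_left ip_scale_right subset_eq)
      have "e \<notin> P" using e1 eP by force
      have "orthonormal_set (insert e P)"
        using PH e1 eP eW VH \<open>e \<notin> P\<close> unfolding orthonormal_set_def by auto
      then have "good (insert e P)" using PH eW by (auto simp: good_def)
      then show False using P(2)[of "insert e P"] \<open>e \<notin> P\<close> PH(3) by simp
    qed
    then show ?thesis using u(1) by (simp add: V_def)
  qed
  ultimately show ?thesis using Q PH by (intro exI[of _ "Q \<union> P"]) auto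
qed

end

section \<open>Gaussian measures from radonifying operators\<close>

lemma half_power_less: "e > 0 \<Longrightarrow> \<exists>N. 2 * (1/2::real)^N < e"
proof -
  assume "e > 0"
  then obtain N where "(1/2::real)^N < e/2" using real_arch_pow_inv[of "e/2" "1/2"] by auto
  then have "2 * (1/2::real)^N < e" by simp
  then show ?thesis by blast
qed

text \<open>Inner regularity is available on the source, a complete second countable space, and is
  carried over to \<open>'x\<close> by continuity of \<open>G\<close> on each closed set
  \<open>E m\<close>: compact subsets of \<open>E m\<close> have compact images. No separability of
  \<open>'x\<close> enters.\<close>

lemma radon_limit:
  fixes \<mu> :: "'a::{second_countable_topology, complete_space} measure" and F :: "nat \<Rightarrow> 'a \<Rightarrow> 'x::banach"
  assumes \<mu>: "prob_space \<mu>" "sets \<mu> = sets borel"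
    and cont: "\<And>n. continuous_on UNIV (F n)"
    and small: "\<And>n. measure \<mu> {a. (1/2)^n < norm (F (Suc n) a - F n a)} \<le> (1/2)^n"
  shows "\<exists>G. G \<in> borel_measurable \<mu> \<and> (AE a in \<mu>. (\<lambda>n. F n a) \<longlonglongrightarrow> G a) \<and> radon_probability (distr \<mu> borel G)"
proof -
  interpret prob_space \<mu> by fact
  note [measurable_cong] = \<mu>(2)
  have sp: "space \<mu> = UNIV" using \<mu>(2)[THEN sets_eq_imp_space_eq] by simp
  define E where "E = (\<lambda>m. {a. \<forall>n\<ge>m. norm (F (Suc n) a - F n a) \<le> (1/2)^n})"
  have Ecl: "closed (E m)" for m
  proof -
    have "E m = (\<Inter>n\<in>{m..}. {a. norm (F (Suc n) a - F n a) \<le> (1/2)^n})" by (auto simp: E_def)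
    then show ?thesis
      by (auto intro!: closed_INT closed_Collect_le continuous_intros cont)
  qed
  have Eb[measurable]: "E m \<in> sets borel" for m using Ecl by (rule borel_closed)
  have Einc: "E m \<subseteq> E n" if "m \<le> n" for m n using that by (auto simp: E_def)
  define S where "S = (\<Union>m. E m)"
  have Sb[measurable]: "S \<in> sets borel" unfolding S_def by measurable
  \<comment> \<open>The subtracted term \<open>2 * (1/2)^k\<close> makes the induction on
    \<open>k\<close> close; afterwards only \<open>2 * (1/2)^n\<close> is used.\<close>
  have dist: "norm (F k a - F n a) \<le> 2 * (1/2)^n - 2 * (1/2)^k" if a: "a \<in> E m" and n: "m \<le> n" "n \<le> k" for a m n k
    using n(2)
  proof (induction k rule: dec_induct)
    case (step k)
    have "norm (F (Suc k) a - F k a) \<le> (1/2)^k" using a n step by (auto simp: E_def)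
    moreover have "norm (F (Suc k) a - F n a) \<le> norm (F (Suc k) a - F k a) + norm (F k a - F n a)"
      using norm_triangle_ineq[of "F (Suc k) a - F k a" "F k a - F n a"] by simp
    ultimately show ?case using step.IH by simp
  qed simp
  have conv: "convergent (\<lambda>n. F n a)" if a: "a \<in> S" for a
  proof -
    obtain m where m: "a \<in> E m" using a by (auto simp: S_def)
    have "Cauchy (\<lambda>n. F n a)"
    proof (rule CauchyI')
      fix e :: real assume e: "e > 0"
      obtain N where N: "2 * (1/2::real)^N < e"
        using half_power_less[OF e] by blast
      have "norm (F p a - F q a) < e" if "p \<ge> max m N" "q > p" for p q
      proof -
        have "norm (F q a - F p a) \<le> 2 * (1/2)^p - 2 * (1/2)^q" using dist[OF m, of p q] that by simp
        also have "\<dots> \<le> 2 * (1/2)^p" by simp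
        also have "\<dots> \<le> 2 * (1/2)^N" using that by (intro mult_left_mono power_decreasing) auto
        finally show ?thesis using N by (simp add: norm_minus_commute)
      qed
      then show "\<exists>M. \<forall>p\<ge>M. \<forall>q>p. dist (F p a) (F q a) < e" unfolding dist_norm by blast
    qed
    then show ?thesis by (simp add: Cauchy_convergent_iff)
  qed
  \<comment> \<open>With the value 0 off \<open>S\<close>, \<open>G\<close> is an everywhere limit
    of measurable maps, which is how its measurability is obtained.\<close>
  define G where "G = (\<lambda>a. if a \<in> S then lim (\<lambda>n. F n a) else 0)"
  have lim: "(\<lambda>n. F n a) \<longlonglongrightarrow> G a" if "a \<in> S" for a
    using conv[OF that] that by (simp add: G_def convergent_LIMSEQ_iff)
  have Fm[measurable]: "F n \<in> borel_measurable borel" for n by (rule borel_measurable_continuous_onI[OF cont])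
  have Gm: "G \<in> borel_measurable borel"
  proof (rule borel_measurable_LIMSEQ_metric[where f="\<lambda>n a. if a \<in> S then F n a else 0"])
    show "(\<lambda>a. if a \<in> S then F n a else 0) \<in> borel_measurable borel" for n by measurable
    show "(\<lambda>n. if a \<in> S then F n a else 0) \<longlonglongrightarrow> G a" for a
      using lim by (cases "a \<in> S") (auto simp: G_def)
  qed
  then have Gm'[measurable]: "G \<in> borel_measurable \<mu>" by measurable
  have bad: "measure \<mu> (- E m) \<le> 2 * (1/2)^m" for m
  proof -
    have su: "summable (\<lambda>n. (1/2::real)^(n+m))"
      unfolding power_add by (intro summable_mult2 summable_geometric) simp
    have sm: "summable (\<lambda>n. measure \<mu> {a. (1/2)^(n+m) < norm (F (Suc (n+m)) a - F (n+m) a)})"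
      by (rule summable_comparison_test'[OF su, where N=0]) (use small[of "_ + m"] in simp)
    have "- E m = (\<Union>n. {a. (1/2)^(n+m) < norm (F (Suc (n+m)) a - F (n+m) a)})"
    proof (intro set_eqI iffI)
      fix a assume "a \<in> - E m"
      then obtain n where n: "m \<le> n" "(1/2) ^ n < norm (F (Suc n) a - F n a)"
        by (auto simp: E_def not_le)
      then show "a \<in> (\<Union>n. {a. (1/2)^(n+m) < norm (F (Suc (n+m)) a - F (n+m) a)})"
        by (intro UN_I[of "n - m"]) auto
    qed (auto simp: E_def not_le[symmetric], use le_add2 in blast)
    also have "measure \<mu> \<dots> \<le> (\<Sum>n. measure \<mu> {a. (1/2)^(n+m) < norm (F (Suc (n+m)) a - F (n+m) a)})"
    proof (rule finite_measure_subadditive_countably)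
      have "{a. (1/2)^(n+m) < norm (F (Suc (n+m)) a - F (n+m) a)} \<in> sets borel" for n
        by (intro borel_open open_Collect_less continuous_intros cont)
      then show "range (\<lambda>n. {a. (1/2)^(n+m) < norm (F (Suc (n+m)) a - F (n+m) a)}) \<subseteq> events"
        by (auto simp: \<mu>(2))
      show "summable (\<lambda>n. measure \<mu> {a. (1/2)^(n+m) < norm (F (Suc (n+m)) a - F (n+m) a)})"
        by (rule sm)
    qed
    also have "\<dots> \<le> (\<Sum>n. (1/2::real)^(n+m))"
      by (rule suminf_le[OF small sm su])
    also have "\<dots> = 2 * (1/2)^m"
      unfolding power_add by (subst suminf_mult2[symmetric]) (auto simp: suminf_geometric intro!: summable_geometric)
    finally show ?thesis .
  qed
  have small_bad: "\<exists>m. measure \<mu> (- E m) < e" if e: "e > 0" for e :: real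
  proof -
    obtain N where "2 * (1/2::real)^N < e" using half_power_less[OF e] by blast
    then show ?thesis using bad[of N] by (intro exI[of _ N]) simp
  qed
  have "measure \<mu> (- S) = 0"
  proof -
    have "measure \<mu> (- S) \<le> e" if e: "e > 0" for e
    proof -
      obtain m where "measure \<mu> (- E m) < e" using small_bad[OF e] by blast
      moreover have "measure \<mu> (- S) \<le> measure \<mu> (- E m)"
        by (rule finite_measure_mono) (auto simp: S_def)
      ultimately show ?thesis by simp
    qed
    from this[of "measure \<mu> (- S) / 2"] show ?thesis
      using measure_nonneg[of \<mu> "- S"] by linarith
  qed
  then have "- S \<in> null_sets \<mu>" by (auto simp: null_sets_def emeasure_eq_measure)
  then have AES: "AE a in \<mu>. a \<in> S" by (rule AE_I') (auto simp: sp)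
  then have ae: "AE a in \<mu>. (\<lambda>n. F n a) \<longlonglongrightarrow> G a" by eventually_elim (rule lim)
  have contG: "continuous_on (E m) G" for m
  proof (rule uniform_limit_theorem)
    show "\<forall>\<^sub>F n in sequentially. continuous_on (E m) (F n)"
      using continuous_on_subset[OF cont] by auto
    show "uniform_limit (E m) F G sequentially"
    proof (rule uniform_limitI)
      fix e :: real assume e: "e > 0"
      obtain N where N: "2 * (1/2::real)^N < e"
        using half_power_less[OF e] by blast
      have "dist (F n a) (G a) < e" if n: "n \<ge> max m N" and a: "a \<in> E m" for n a
      proof -
        have "norm (G a - F n a) \<le> 2 * (1/2)^n"
        proof (rule LIMSEQ_le_const2)
          show "(\<lambda>k. norm (F k a - F n a)) \<longlonglongrightarrow> norm (G a - F n a)"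
            using a by (intro tendsto_intros lim) (auto simp: S_def)
          have "norm (F k a - F n a) \<le> 2 * (1/2)^n" if "k \<ge> n" for k
            by (rule order_trans[OF dist[OF a _ that]]) (use n in auto)
          then show "\<exists>N. \<forall>k\<ge>N. norm (F k a - F n a) \<le> 2 * (1/2)^n" by blast
        qed
        also have "\<dots> \<le> 2 * (1/2)^N" using n by (intro mult_left_mono power_decreasing) auto
        finally show ?thesis using N by (simp add: dist_norm norm_minus_commute)
      qed
      then show "\<forall>\<^sub>F n in sequentially. \<forall>a\<in>E m. dist (F n a) (G a) < e"
        unfolding eventually_sequentially by blast
    qed
  qed auto
  have "radon_probability (distr \<mu> borel G)"
    unfolding radon_probability_def
  proof (intro conjI ballI allI impI)
    show "prob_space (distr \<mu> borel G)" by (rule prob_space_distr) measurable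
    fix B :: "'x set" and e :: real assume B[measurable]: "B \<in> sets borel" and e: "e > 0"
    obtain m where m: "measure \<mu> (- E m) < e/2" using small_bad[of "e/2"] e by auto
    \<comment> \<open>One half of \<open>e\<close> pays for the complement of \<open>E m\<close>,
      the other for the part of \<open>D\<close> missed by a compact subset. Restricting to
      \<open>E m\<close> is what makes the image of that subset compact.\<close>
    define D where "D = G -` B \<inter> E m"
    have GB[measurable]: "G -` B \<in> sets borel" using measurable_sets[OF Gm B] by simp
    have Db: "D \<in> sets borel" unfolding D_def by simp
    have reg: "emeasure \<mu> D = (SUP C \<in> {C. C \<subseteq> D \<and> compact C}. emeasure \<mu> C)"
      by (rule inner_regular[OF \<mu>(2) _ Db]) simp
    have "\<exists>C. C \<subseteq> D \<and> compact C \<and> measure \<mu> D < measure \<mu> C + e/2"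
    proof (cases "measure \<mu> D < e/2")
      case True
      then show ?thesis by (intro exI[of _ "{}"]) auto
    next
      case False
      have "ennreal (measure \<mu> D - e/2) < emeasure \<mu> D"
        using False e by (simp add: emeasure_eq_measure ennreal_less_iff)
      then obtain C where "C \<subseteq> D" "compact C" "ennreal (measure \<mu> D - e/2) < emeasure \<mu> C"
        unfolding reg less_SUP_iff by auto
      moreover from this False have "measure \<mu> D - e/2 < measure \<mu> C"
        by (simp add: emeasure_eq_measure ennreal_less_iff)
      ultimately show ?thesis by (intro exI[of _ C]) auto
    qed
    then obtain C where C: "C \<subseteq> D" "compact C" "measure \<mu> D < measure \<mu> C + e/2" by blast
    have "compact (G ` C)"
      by (intro compact_continuous_image continuous_on_subset[OF contG[of m]] C(2)) (use C(1) in \<open>auto simp: D_def\<close>)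
    moreover have "G ` C \<subseteq> B" using C(1) by (auto simp: D_def)
    moreover have "measure (distr \<mu> borel G) (B - G ` C) < e"
    proof -
      have Cb: "C \<in> sets \<mu>" "D \<in> sets \<mu>" using C(2) Db by (auto simp: \<mu>(2) borel_compact)
      have "B - G ` C \<in> sets borel" using \<open>compact (G ` C)\<close> by (auto intro: borel_compact)
      then have "measure (distr \<mu> borel G) (B - G ` C) = measure \<mu> (G -` (B - G ` C))"
        by (subst measure_distr) (auto simp: sp)
      also have "\<dots> \<le> measure \<mu> ((D - C) \<union> (- E m))"
        by (rule finite_measure_mono) (use Cb in \<open>auto simp: D_def \<mu>(2)\<close>)
      also have "\<dots> \<le> measure \<mu> (D - C) + measure \<mu> (- E m)"
        by (rule measure_Un_le) (use Cb in \<open>auto simp: \<mu>(2)\<close>)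
      also have "measure \<mu> (D - C) = measure \<mu> D - measure \<mu> C"
        by (rule finite_measure_Diff) (use Cb C in auto)
      finally show ?thesis using C(3) m by simp
    qed
    ultimately show "\<exists>C\<subseteq>B. compact C \<and> measure (distr \<mu> borel G) (B - C) < e" by blast
  qed simp
  then show ?thesis using Gm' ae by blast
qed

lemma (in finite_measure) measure_gt_le_second_moment:
  fixes g :: "'a \<Rightarrow> real"
  assumes g[measurable]: "g \<in> borel_measurable M" and b: "(\<integral>\<^sup>+x. ennreal ((g x)\<^sup>2) \<partial>M) \<le> ennreal b" "0 \<le> b"
    and c: "0 < c"
  shows "measure M {x \<in> space M. c < g x} \<le> b / c\<^sup>2"
proof -
  have "ennreal (c\<^sup>2) * emeasure M {x \<in> space M. c < g x} = (\<integral>\<^sup>+x. ennreal (c\<^sup>2) * indicator {x \<in> space M. c < g x} x \<partial>M)"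
    by (rule nn_integral_cmult_indicator[symmetric]) measurable
  also have "\<dots> \<le> (\<integral>\<^sup>+x. ennreal ((g x)\<^sup>2) \<partial>M)"
    using c by (intro nn_integral_mono) (auto split: split_indicator intro!: ennreal_leI power_mono)
  also have "\<dots> \<le> ennreal b" by (rule b)
  finally have "ennreal (c\<^sup>2 * measure M {x \<in> space M. c < g x}) \<le> ennreal b"
    by (simp add: emeasure_eq_measure ennreal_mult)
  then have "c\<^sup>2 * measure M {x \<in> space M. c < g x} \<le> b" using b(2) by simp
  then show ?thesis using c by (simp add: field_simps)
qed

section \<open>Covariances, and the Gaussian measure induced by an operator\<close>

lemma centered_radon_gaussian_cgauss:
  fixes f :: "'x::banach \<Rightarrow>\<^sub>L real"
  assumes "centered_radon_gaussian \<gamma>"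
  shows "prob_space \<gamma>" "sets \<gamma> = sets borel" "cgauss \<gamma> (blinfun_apply f)"
proof -
  show "prob_space \<gamma>" and s: "sets \<gamma> = sets borel"
    using assms by (auto simp: centered_radon_gaussian_def radon_probability_def)
  have "blinfun_apply f \<in> borel_measurable borel"
    by (intro borel_measurable_continuous_onI continuous_intros)
  then show "cgauss \<gamma> (blinfun_apply f)"
    using assms measurable_cong_sets[OF s refl, of borel] by (auto simp: centered_radon_gaussian_def cgauss_def)
qed

lemma integrable_cgauss_mult:
  assumes "prob_space M" "cgauss M u" "cgauss M w"
  shows "integrable M (\<lambda>x. u x * w x)"
proof (rule Bochner_Integration.integrable_bound)
  show "integrable M (\<lambda>x. (u x)\<^sup>2 + (w x)\<^sup>2)"
    using cgauss_properties(1)[OF assms(1,2)] cgauss_properties(1)[OF assms(1,3)] by simp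
  show "(\<lambda>x. u x * w x) \<in> borel_measurable M"
    using cgauss_measurable[OF assms(2)] cgauss_measurable[OF assms(3)] by measurable
  have "\<bar>a * b\<bar> \<le> a\<^sup>2 + b\<^sup>2" for a b :: real
  proof -
    have "2 * \<bar>a * b\<bar> \<le> a\<^sup>2 + b\<^sup>2" using sum_squares_bound[of "\<bar>a\<bar>" "\<bar>b\<bar>"] by (simp add: abs_mult)
    then show ?thesis by linarith
  qed
  then show "AE x in M. norm (u x * w x) \<le> norm ((u x)\<^sup>2 + (w x)\<^sup>2)" by auto
qed

text \<open>\<open>Blinfun\<close> returns the given function only if that is bounded linear, so
  continuity at 0 is converted into a bound. The constant \<open>2 / d\<close> comes from rescaling
  to norm \<open>d / 2\<close>.\<close>

lemma rkbs_eval_functional: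
  fixes emb :: "'x::banach \<Rightarrow> 't \<Rightarrow> real"
  assumes "rkbs emb"
  shows "blinfun_apply (eval_functional emb t) x = emb x t"
proof -
  have lin: "linear (\<lambda>x. emb x t)"
  proof (rule linearI)
    have l: "linear emb" using assms by (simp add: rkbs_def)
    show "emb (x + y) t = emb x t + emb y t" for x y
      by (simp only: linear_add[OF l] plus_fun_def)
    show "emb (c *\<^sub>R x) t = c *\<^sub>R emb x t" for c x
      by (simp only: linear_scale[OF l] scaleR_fun_def)
  qed
  have cont: "continuous_on UNIV (\<lambda>x. emb x t)" using assms by (simp add: rkbs_def)
  interpret linear "\<lambda>x. emb x t" by (rule lin)
  have "isCont (\<lambda>x. emb x t) 0" using cont by (simp add: continuous_on_eq_continuous_at)
  then have "\<exists>d>0. \<forall>x. dist x 0 < d \<longrightarrow> dist (emb x t) (emb 0 t) < 1"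
    unfolding continuous_at_eps_delta using zero_less_one by blast
  then obtain d where d: "d > 0" "\<And>x. norm x < d \<Longrightarrow> \<bar>emb x t\<bar> < 1"
    by (auto simp: zero)
  have "bounded_linear (\<lambda>x. emb x t)"
  proof (rule bounded_linear_intro)
    fix x
    show "norm (emb x t) \<le> norm x * (2 / d)"
    proof (cases "x = 0")
      case False
      define c where "c = d / (2 * norm x)"
      have c: "c > 0" using d False by (simp add: c_def)
      have "norm (c *\<^sub>R x) < d" using d False by (simp add: c_def)
      then have "\<bar>c * emb x t\<bar> < 1" using d(2)[of "c *\<^sub>R x"] by (simp add: scale)
      then have "c * \<bar>emb x t\<bar> < 1" using c by (simp add: abs_mult)
      then show ?thesis using c d(1) False by (simp add: c_def field_simps)
    qed (simp add: zero)
  qed (simp_all add: add scale)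
  then show ?thesis unfolding eval_functional_def by (simp add: bounded_linear_Blinfun_apply)
qed

text \<open>\<open>covariance_operator\<close> is a definite description and has a meaning only once
  \<open>ex\<close> provides representing vectors. Evaluations separate the points of
  \<open>'x\<close>, which yields linearity of the chosen map as well as its uniqueness.\<close>

lemma covariance_function_eq:
  fixes emb :: "'x::banach \<Rightarrow> 't \<Rightarrow> real"
  assumes emb: "rkbs emb" and \<gamma>: "centered_radon_gaussian \<gamma>"
    and ex: "\<And>f :: 'x \<Rightarrow>\<^sub>L real. \<exists>x. \<forall>g :: 'x \<Rightarrow>\<^sub>L real. blinfun_apply g x = (\<integral>y. blinfun_apply f y * blinfun_apply g y \<partial>\<gamma>)"
  shows "covariance_function emb \<gamma> s t = (\<integral>y. emb y s * emb y t \<partial>\<gamma>)"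
proof -
  note P = centered_radon_gaussian_cgauss[OF \<gamma>]
  define R where "R = (\<lambda>f :: 'x \<Rightarrow>\<^sub>L real. SOME x. \<forall>g :: 'x \<Rightarrow>\<^sub>L real. blinfun_apply g x = (\<integral>y. blinfun_apply f y * blinfun_apply g y \<partial>\<gamma>))"
  have R: "blinfun_apply g (R f) = (\<integral>y. blinfun_apply f y * blinfun_apply g y \<partial>\<gamma>)"
    for f g :: "'x \<Rightarrow>\<^sub>L real"
    using someI_ex[OF ex[of f]] unfolding R_def by blast
  have sep: "x = y" if "\<And>g :: 'x \<Rightarrow>\<^sub>L real. blinfun_apply g x = blinfun_apply g y" for x y
  proof -
    have "emb x t = emb y t" for t
      using that[of "eval_functional emb t"] unfolding rkbs_eval_functional[OF emb] .
    then have "emb x = emb y" by (rule ext)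
    then show ?thesis using emb by (auto simp: rkbs_def inj_def)
  qed
  have int: "integrable \<gamma> (\<lambda>x. blinfun_apply f x * blinfun_apply g x)" for f g :: "'x \<Rightarrow>\<^sub>L real"
    by (rule integrable_cgauss_mult[OF P(1) P(3) P(3)])
  have lin: "linear R"
  proof (rule linearI)
    show "R (f + f') = R f + R f'" for f f'
      by (rule sep) (simp add: R blinfun.add_right blinfun.add_left distrib_right int)
    show "R (c *\<^sub>R f) = c *\<^sub>R R f" for c f
      by (rule sep) (simp add: R blinfun.scaleR_right blinfun.scaleR_left mult.assoc)
  qed
  have "covariance_operator \<gamma> = R"
    unfolding covariance_operator_def
    by (rule the_equality) (use lin R in \<open>auto intro!: ext sep\<close>)
  then show ?thesis
    by (simp add: covariance_function_def R rkbs_eval_functional[OF emb])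
qed

context hilbert_space
begin

text \<open>The one-element orthonormal system shows that the \<gamma>-norm dominates the operator
  norm, since \<open>\<xi> 0\<close> has second moment 1.\<close>

lemma gamma_norm_single:
  fixes A :: "'a \<Rightarrow> 'x::real_normed_vector"
  assumes std: "std_gaussian_sequence M \<xi>" and c: "gamma_norm M \<xi> H ip A \<le> ereal c"
    and A: "\<And>x r. x \<in> H \<Longrightarrow> A (r *\<^sub>R x) = r *\<^sub>R A x" and x: "x \<in> H"
  shows "norm (A x) \<le> c * nrm x"
proof (cases "x = 0")
  case True
  then show ?thesis using A[OF mem(1), of 0] by simp
next
  case False
  then have n: "nrm x > 0" using nrm_eq_0[OF x] nrm_nonneg[OF x] by fastforce
  have M: "prob_space M" using std by (simp add: std_gaussian_sequence_def)
  interpret M: prob_space M by fact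
  have g: "gauss_orthonormal M 1 \<xi>"
    using std_gaussian_sequence_orthonormal[OF std, of "\<lambda>i. i" 1] by simp
  define e where "e = (1 / nrm x) *\<^sub>R x"
  have e: "e \<in> H" "ip e e = 1" using n x
    by (simp_all add: e_def ip_scale_left ip_scale_right nrm_sq[OF x, symmetric] power2_eq_square)
  have h: "orthonormal_system H ip 1 (\<lambda>_. e)" using e by (simp add: orthonormal_system_def)
  note b = gamma_norm_bound[OF std c h M g]
  have "ennreal ((norm (A e))\<^sup>2) = (\<integral>\<^sup>+\<omega>. ennreal ((\<xi> 0 \<omega>)\<^sup>2) * ennreal ((norm (A e))\<^sup>2) \<partial>M)"
  proof -
    have m: "\<xi> 0 \<in> borel_measurable M" by (rule gauss_orthonormal_measurable[OF g]) simp
    have "(\<integral>\<^sup>+\<omega>. ennreal ((\<xi> 0 \<omega>)\<^sup>2) \<partial>M) = ennreal (\<integral>\<omega>. (\<xi> 0 \<omega>)\<^sup>2 \<partial>M)"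
      by (rule nn_integral_eq_integral) (use cgauss_properties(1)[OF M gauss_orthonormal_component(1)[OF g]] in auto)
    also have "\<dots> = 1" using gauss_orthonormal_component(2)[OF g] by simp
    finally show ?thesis using m by (subst nn_integral_multc) auto
  qed
  also have "\<dots> = (\<integral>\<^sup>+\<omega>. ennreal ((norm (\<Sum>k<1. \<xi> k \<omega> *\<^sub>R A e))\<^sup>2) \<partial>M)"
    by (simp add: power_mult_distrib ennreal_mult)
  also have "\<dots> \<le> ennreal (c\<^sup>2)" by (rule b(2))
  finally have "(norm (A e))\<^sup>2 \<le> c\<^sup>2" by simp
  then have "norm (A e) \<le> c" using b(1) by (rule power2_le_imp_le)
  then show ?thesis using n x by (simp add: e_def A field_simps)
qed

text \<open>The vector \<open>r\<close> is the adjoint of \<open>A\<close> applied to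
  \<open>f\<close>, so the last clause says that the covariance operator of \<gamma> is
  \<open>A\<close> composed with its adjoint.\<close>

lemma radonifying_imp_gaussian_measure:
  fixes A :: "'a \<Rightarrow> 'x::banach"
  assumes std: "std_gaussian_sequence M \<xi>" and rad: "gamma_radonifying M \<xi> H ip A"
  shows "\<exists>\<gamma>. centered_radon_gaussian \<gamma> \<and> (\<forall>f :: 'x \<Rightarrow>\<^sub>L real. \<exists>r\<in>H.
    (\<forall>h\<in>H. blinfun_apply f (A h) = ip r h) \<and>
    (\<forall>g. (\<integral>x. blinfun_apply f x * blinfun_apply g x \<partial>\<gamma>) = blinfun_apply g (A r)))"
proof -
  have M: "prob_space M" using std by (simp add: std_gaussian_sequence_def)
  interpret M: prob_space M by fact
  have A: "bounded_linear_on H ip A" using rad by (simp add: gamma_radonifying_def gamma_space_def)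
  note linA = bounded_linear_onD[OF A]
  \<comment> \<open>With error \<open>(1/4)^n\<close>, Chebyshev's inequality at level
    \<open>(1/2)^n\<close> leaves probability \<open>(1/4)^n\<close>, which is below the
    \<open>(1/2)^n\<close> asked for by \<open>radon_limit\<close>.\<close>
  have "\<exists>B. bounded_linear_on H ip B \<and> finite_rank_on H B \<and> gamma_norm M \<xi> H ip (\<lambda>x. A x - B x) \<le> ereal ((1/4)^n)" for n
  proof -
    have "(1/4::real)^n > 0" by simp
    then show ?thesis using rad unfolding gamma_radonifying_def gamma_space_def by (blast intro: less_imp_le)
  qed
  then obtain B where B: "\<And>n. bounded_linear_on H ip (B n)" "\<And>n. finite_rank_on H (B n)"
    "\<And>n. gamma_norm M \<xi> H ip (\<lambda>x. A x - B n x) \<le> ereal ((1/4)^n)" by metis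
  have "\<exists>W. \<forall>n. (orthonormal_set (W n) \<and> finite (W n) \<and> (\<forall>h\<in>H. (\<forall>e\<in>W n. ip h e = 0) \<longrightarrow> B n h = 0)) \<and> W n \<subseteq> W (Suc n)"
  proof (rule dependent_nat_choice[where P="\<lambda>n W. orthonormal_set W \<and> finite W \<and> (\<forall>h\<in>H. (\<forall>e\<in>W. ip h e = 0) \<longrightarrow> B n h = 0)"
        and Q="\<lambda>_ W W'. W \<subseteq> W'"])
    show "\<exists>P. orthonormal_set P \<and> finite P \<and> (\<forall>h\<in>H. (\<forall>e\<in>P. ip h e = 0) \<longrightarrow> B 0 h = 0)"
      using finite_rank_orthonormal_extension[OF B(1,2), of "{}" 0] by (auto simp: orthonormal_set_def)
    show "\<exists>P. (orthonormal_set P \<and> finite P \<and> (\<forall>h\<in>H. (\<forall>e\<in>P. ip h e = 0) \<longrightarrow> B (Suc n) h = 0)) \<and> Q \<subseteq> P"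
      if "orthonormal_set Q \<and> finite Q \<and> (\<forall>h\<in>H. (\<forall>e\<in>Q. ip h e = 0) \<longrightarrow> B n h = 0)" for Q n
      using finite_rank_orthonormal_extension[OF B(1,2), of Q "Suc n"] that by blast
  qed
  then obtain E where E: "\<And>n. orthonormal_set (E n)" "\<And>n. finite (E n)"
    "\<And>n h. h \<in> H \<Longrightarrow> (\<And>e. e \<in> E n \<Longrightarrow> ip h e = 0) \<Longrightarrow> B n h = 0" "\<And>n. E n \<subseteq> E (Suc n)" by blast
  have Einc: "E n \<subseteq> E m" if "n \<le> m" for n m using E(4) that by (rule lift_Suc_mono_le)
  have EH: "e \<in> H" if "e \<in> E n" for e n using E(1)[of n] that by (auto simp: orthonormal_set_def)
  define U where "U = (\<Union>n. E n)"
  have "countable U" unfolding U_def using E(2) by (auto intro: countable_finite)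
  \<comment> \<open>One enumeration for all the sets \<open>E n\<close> attaches to every vector a
    fixed member of \<open>\<xi>\<close>, so that \<open>F m - F n\<close> involves the new vectors
    only.\<close>
  define ind where "ind = to_nat_on U"
  have ind: "inj_on ind U" unfolding ind_def by (rule inj_on_to_nat_on) fact
  have indE: "inj_on ind P" if "P \<subseteq> E n" for P n using ind by (rule inj_on_subset) (use that in \<open>auto simp: U_def\<close>)
  define F where "F = (\<lambda>n a. \<Sum>e\<in>E n. a (ind e) *\<^sub>R A e)"
  \<comment> \<open>The given probability space is arbitrary; the law of \<open>\<xi>\<close> lives
    on the space of real sequences, which has the topology that \<open>radon_limit\<close>
    requires.\<close>
  define seq where "seq = (\<lambda>\<omega> k. \<xi> k \<omega>)"
  define \<mu> where "\<mu> = distr M borel seq"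
  have \<xi>m[measurable]: "\<xi> k \<in> borel_measurable M" for k
    using gauss_orthonormal_measurable[OF std_gaussian_sequence_orthonormal[OF std, of id "Suc k", simplified]] by simp
  have seqm[measurable]: "seq \<in> borel_measurable M"
    by (rule measurable_coordinatewise_then_product) (simp add: seq_def)
  have \<mu>: "prob_space \<mu>" "sets \<mu> = sets borel"
    unfolding \<mu>_def by (auto intro: M.prob_space_distr)
  interpret \<mu>: prob_space \<mu> by fact
  have cF: "continuous_on UNIV (F n)" for n unfolding F_def
    by (intro continuous_intros continuous_on_product_coordinates)
  have Fm[measurable]: "F n \<in> borel_measurable borel" for n by (rule borel_measurable_continuous_onI[OF cF])
  \<comment> \<open>The vectors in the sets \<open>E n\<close> need not span a dense subspace of
    \<open>H\<close>. This estimate replaces density: \<open>B n\<close> annihilates what is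
    orthogonal to \<open>E n\<close>, where \<open>A\<close> is therefore as small as
    \<open>A - B n\<close>.\<close>
  have tail: "norm (A h - A (\<Sum>e\<in>E n. ip h e *\<^sub>R e)) \<le> (1/4)^n * (2 * nrm h)" if h: "h \<in> H" for h n
  proof -
    let ?p = "\<Sum>e\<in>E n. ip h e *\<^sub>R e"
    have pH: "?p \<in> H" using EH by (intro mem_sum) auto
    have pp: "ip ?p ?p = ip h ?p"
      using EH h by (simp add: orthonormal_set_sqnorm[OF E(1,2)] ip_sum_right ip_scale_right)
    have "(nrm ?p)\<^sup>2 \<le> nrm h * nrm ?p"
      using Cauchy_Schwarz[OF h pH] by (simp add: nrm_sq[OF pH] pp)
    then have np: "nrm ?p \<le> nrm h"
      using nrm_nonneg[OF pH] nrm_nonneg[OF h] by (cases "nrm ?p = 0") (auto simp: power2_eq_square)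
    have "B n (h - ?p) = 0"
    proof (rule E(3))
      show "ip (h - ?p) e = 0" if "e \<in> E n" for e
        using orthonormal_set_coeff(1)[OF E(1,2) that] EH[OF that] h pH by (simp add: ip_diff_left)
    qed (use h pH in simp)
    then have "norm (A (h - ?p)) = norm (A (h - ?p) - B n (h - ?p))" by simp
    also have "\<dots> \<le> (1/4)^n * nrm (h - ?p)"
      using gamma_norm_single[OF std B(3)] h pH linA(2) bounded_linear_onD(2)[OF B(1)]
      by (auto simp: scaleR_diff_right)
    also have "\<dots> \<le> (1/4)^n * (2 * nrm h)"
      using nrm_triangle[of h "- ?p"] h pH np by (intro mult_left_mono) (auto simp: nrm_minus)
    finally show ?thesis using h pH by (simp add: linA)
  qed
  have L2: "(\<integral>\<^sup>+a. ennreal ((norm (F m a - F n a))\<^sup>2) \<partial>\<mu>) \<le> ennreal (((1/4)^n)\<^sup>2)" if nm: "n \<le> m" for n m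
  proof -
    define D where "D = E m - E n"
    have D: "finite D" "orthonormal_set D" "D \<subseteq> E m"
      using E(1)[of m] E(2)[of m] by (auto simp: D_def intro: orthonormal_set_subset)
    obtain h where h: "bij_betw h {..<card D} D"
      using ex_bij_betw_nat_finite[OF D(1)] by (auto simp: lessThan_atLeast0)
    have hD: "h i \<in> D" if "i < card D" for i using h that by (auto simp: bij_betw_def)
    have sys: "orthonormal_system H ip (card D) h" by (rule orthonormal_system_enum[OF D(2) h])
    have Bh: "B n (h i) = 0" if i: "i < card D" for i
    proof (rule E(3))
      show "h i \<in> H" using EH hD[OF i] D by blast
      show "ip (h i) e = 0" if e: "e \<in> E n" for e
      proof -
        have "h i \<in> E m" "e \<in> E m" "h i \<noteq> e" using hD[OF i] e Einc[OF nm] by (auto simp: D_def)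
        then show ?thesis using E(1)[of m] by (simp add: orthonormal_set_def)
      qed
    qed
    \<comment> \<open>\<open>B n\<close> vanishes on the new vectors, so it can be inserted at no
      cost and the \<gamma>-norm of \<open>A - B n\<close> bounds the increment.\<close>
    have FD: "F m a - F n a = (\<Sum>i<card D. a (ind (h i)) *\<^sub>R (A (h i) - B n (h i)))" for a
    proof -
      have "F m a - F n a = (\<Sum>e\<in>D. a (ind e) *\<^sub>R A e)"
        unfolding F_def D_def using E(2) Einc[OF nm] by (subst sum_diff) auto
      also have "\<dots> = (\<Sum>i<card D. a (ind (h i)) *\<^sub>R A (h i))"
        by (rule sum.reindex_bij_betw[OF h, symmetric])
      finally show ?thesis by (simp add: Bh)
    qed
    have inj: "inj_on (\<lambda>i. ind (h i)) {..<card D}"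
      using comp_inj_on[of h "{..<card D}" ind] h indE[OF D(3)] by (simp add: bij_betw_def comp_def)
    have "(\<integral>\<^sup>+a. ennreal ((norm (F m a - F n a))\<^sup>2) \<partial>\<mu>) = (\<integral>\<^sup>+\<omega>. ennreal ((norm (F m (seq \<omega>) - F n (seq \<omega>)))\<^sup>2) \<partial>M)"
      unfolding \<mu>_def
    proof (rule nn_integral_distr[OF seqm])
      have "(\<lambda>a. F m a - F n a) \<in> borel_measurable borel"
        by (intro borel_measurable_continuous_onI continuous_intros cF)
      then have "(\<lambda>a. ennreal ((norm (F m a - F n a))\<^sup>2)) \<in> borel_measurable borel" by measurable
      then show "(\<lambda>a. ennreal ((norm (F m a - F n a))\<^sup>2)) \<in> borel_measurable (distr M borel seq)" by simp
    qed
    also have "\<dots> \<le> ennreal (((1/4)^n)\<^sup>2)"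
      unfolding FD seq_def
      by (rule gamma_norm_bound(2)[OF std B(3) sys M std_gaussian_sequence_orthonormal[OF std inj]])
    finally show ?thesis .
  qed
  have small: "measure \<mu> {a. (1/2)^n < norm (F (Suc n) a - F n a)} \<le> (1/2)^n" for n
  proof -
    have "(\<lambda>a. F (Suc n) a - F n a) \<in> borel_measurable borel"
      by (intro borel_measurable_continuous_onI continuous_intros cF)
    then have m: "(\<lambda>a. norm (F (Suc n) a - F n a)) \<in> borel_measurable \<mu>" unfolding \<mu>_def by simp
    have "measure \<mu> {a \<in> space \<mu>. (1/2)^n < norm (F (Suc n) a - F n a)} \<le> ((1/4)^n)\<^sup>2 / ((1/2)^n)\<^sup>2"
      by (rule \<mu>.measure_gt_le_second_moment[OF m L2]) auto
    also have "((1/4)^n)\<^sup>2 / ((1/2)^n)\<^sup>2 = (1/4::real)^n"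
    proof -
      have "(1/4::real)^n = ((1/2)^n)\<^sup>2" by (simp add: power2_eq_square power_mult_distrib[symmetric])
      then show ?thesis by (simp add: power2_eq_square)
    qed
    also have "\<dots> \<le> (1/2)^n" by (rule power_mono) auto
    finally show ?thesis by (simp add: \<mu>_def)
  qed
  obtain G where G[measurable]: "G \<in> borel_measurable \<mu>" "AE a in \<mu>. (\<lambda>n. F n a) \<longlonglongrightarrow> G a"
    "radon_probability (distr \<mu> borel G)"
    using radon_limit[OF \<mu> cF small] by blast
  define \<gamma> where "\<gamma> = distr \<mu> borel G"
  have L: "\<exists>L\<ge>0. \<forall>h\<in>H. \<bar>blinfun_apply f (A h)\<bar> \<le> L * nrm h" for f :: "'x \<Rightarrow>\<^sub>L real"
  proof -
    obtain C where C: "C > 0" "\<And>x. x \<in> H \<Longrightarrow> norm (A x) \<le> C * nrm x" using linA(5) by blast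
    have "\<bar>blinfun_apply f (A h)\<bar> \<le> norm f * C * nrm h" if "h \<in> H" for h
    proof -
      have "\<bar>blinfun_apply f (A h)\<bar> \<le> norm f * norm (A h)" using norm_blinfun[of f "A h"] by simp
      also have "\<dots> \<le> norm f * (C * nrm h)" by (intro mult_left_mono C(2) that) auto
      finally show ?thesis by (simp add: mult.assoc)
    qed
    then show ?thesis using C(1) by (intro exI[of _ "norm f * C"]) auto
  qed
  have main: "cgauss \<gamma> (blinfun_apply f) \<and> (\<exists>r\<in>H. (\<forall>h\<in>H. blinfun_apply f (A h) = ip r h) \<and>
      (\<integral>x. (blinfun_apply f x)\<^sup>2 \<partial>\<gamma>) = ip r r)" for f :: "'x \<Rightarrow>\<^sub>L real"
  proof -
    \<comment> \<open>Truncated expansions of the representer of \<open>f\<close> composed with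
      \<open>A\<close>. The squared norm \<open>v n\<close> of \<open>s n\<close> equals both
      \<open>f (A (s n))\<close> and the variance of \<open>f (F n)\<close>; the first fact bounds
      \<open>v\<close>, so the increasing \<open>v\<close> converges and \<open>s\<close> is
      Cauchy.\<close>
    define s where "s = (\<lambda>n. \<Sum>e\<in>E n. blinfun_apply f (A e) *\<^sub>R e)"
    define v where "v = (\<lambda>n. \<Sum>e\<in>E n. (blinfun_apply f (A e))\<^sup>2)"
    have sH: "s n \<in> H" for n unfolding s_def using EH by (intro mem_sum) auto
    have ss: "ip (s n) (s n) = v n" for n
      by (simp add: s_def v_def orthonormal_set_sqnorm[OF E(1,2)] power2_eq_square)
    have fA: "blinfun_apply f (A (\<Sum>e\<in>E n. c e *\<^sub>R e)) = (\<Sum>e\<in>E n. c e * blinfun_apply f (A e))" for c n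
      using EH by (simp add: bounded_linear_on_sum[OF A] blinfun.sum_right blinfun.scaleR_right)
    have fs: "blinfun_apply f (A (s n)) = v n" for n
      unfolding s_def v_def fA by (simp add: power2_eq_square)
    obtain L where L: "L \<ge> 0" "\<And>h. h \<in> H \<Longrightarrow> \<bar>blinfun_apply f (A h)\<bar> \<le> L * nrm h" using L by blast
    have vL: "v n \<le> L\<^sup>2" for n
    proof -
      have "(nrm (s n))\<^sup>2 \<le> L * nrm (s n)" using L(2)[OF sH, of n] by (simp add: fs nrm_sq[OF sH] ss)
      then have "nrm (s n) \<le> L" using L(1) nrm_nonneg[OF sH, of n]
        by (cases "nrm (s n) = 0") (auto simp: power2_eq_square)
      then show ?thesis using power_mono[of "nrm (s n)" L 2] nrm_nonneg[OF sH, of n] by (simp add: nrm_sq[OF sH] ss)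
    qed
    have inc: "incseq v" unfolding incseq_Suc_iff v_def by (intro allI sum_mono2 E(2) E(4)) auto
    then have "\<exists>l. v \<longlonglongrightarrow> l" using vL by (metis incseq_convergent)
    then have Cv: "Cauchy v" using convergent_Cauchy convergent_def by blast
    have diff: "ip (s m - s n) (s m - s n) = v m - v n" if "n \<le> m" for m n
    proof -
      have "s m - s n = (\<Sum>e\<in>E m - E n. blinfun_apply f (A e) *\<^sub>R e)"
        unfolding s_def using E(2) Einc[OF that] by (subst sum_diff) auto
      moreover have "ip \<dots> \<dots> = (\<Sum>e\<in>E m - E n. (blinfun_apply f (A e))\<^sup>2)"
        using orthonormal_set_sqnorm[OF orthonormal_set_subset[OF E(1)[of m]], of "E m - E n"] E(2)[of m]
        by (simp add: power2_eq_square)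
      moreover have "\<dots> = v m - v n" unfolding v_def using E(2) Einc[OF that] by (subst sum_diff) auto
      ultimately show ?thesis by simp
    qed
    have "\<exists>r\<in>H. (\<lambda>n. nrm (s n - r)) \<longlonglongrightarrow> 0"
    proof (rule complete[OF sH])
      fix e :: real assume e: "e > 0"
      then obtain N where N: "\<And>m n. m \<ge> N \<Longrightarrow> n \<ge> N \<Longrightarrow> dist (v m) (v n) < e\<^sup>2"
        using metric_CauchyD[OF Cv, of "e\<^sup>2"] by auto
      have *: "nrm (s m - s n) < e" if "m \<ge> n" "n \<ge> N" for m n
      proof -
        have "ip (s m - s n) (s m - s n) < e\<^sup>2" using N[of m n] that diff[OF that(1)] by (auto simp: dist_real_def)
        then have "sqrt (ip (s m - s n) (s m - s n)) < sqrt (e\<^sup>2)" by (rule real_sqrt_less_mono)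
        then show ?thesis using e by (simp add: norm_of_def)
      qed
      have "nrm (s m - s n) < e" if "m \<ge> N" "n \<ge> N" for m n
        using *[of n m] *[of m n] that nrm_diff_commute[OF sH sH, of m n] by (cases "n \<le> m") auto
      then show "\<exists>N. \<forall>m\<ge>N. \<forall>n\<ge>N. nrm (s m - s n) < e" by blast
    qed
    then obtain r where r: "r \<in> H" "(\<lambda>n. nrm (s n - r)) \<longlonglongrightarrow> 0" by blast
    have rep: "blinfun_apply f (A h) = ip r h" if h: "h \<in> H" for h
    proof -
      have "(\<lambda>n. A h - A (\<Sum>e\<in>E n. ip h e *\<^sub>R e)) \<longlonglongrightarrow> 0"
      proof (rule Lim_null_comparison)
        show "\<forall>\<^sub>F n in sequentially. norm (A h - A (\<Sum>e\<in>E n. ip h e *\<^sub>R e)) \<le> (1/4)^n * (2 * nrm h)"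
          using tail[OF h] by auto
        show "(\<lambda>n. (1/4::real)^n * (2 * nrm h)) \<longlonglongrightarrow> 0"
          by (rule tendsto_mult_left_zero, rule LIMSEQ_power_zero) simp
      qed
      then have "(\<lambda>n. blinfun_apply f (A h - A (\<Sum>e\<in>E n. ip h e *\<^sub>R e))) \<longlonglongrightarrow> blinfun_apply f 0"
        by (intro tendsto_intros)
      then have "(\<lambda>n. blinfun_apply f (A h) - blinfun_apply f (A (\<Sum>e\<in>E n. ip h e *\<^sub>R e))) \<longlonglongrightarrow> 0"
        by (simp add: blinfun.diff_right)
      then have "(\<lambda>n. blinfun_apply f (A (\<Sum>e\<in>E n. ip h e *\<^sub>R e))) \<longlonglongrightarrow> blinfun_apply f (A h)"
        using tendsto_diff[OF tendsto_const[of "blinfun_apply f (A h)"]] by force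
      moreover have "blinfun_apply f (A (\<Sum>e\<in>E n. ip h e *\<^sub>R e)) = ip (s n) h" for n
      proof -
        have "ip (s n) h = (\<Sum>e\<in>E n. blinfun_apply f (A e) * ip e h)"
          unfolding s_def using EH h by (subst ip_sum_left) (auto simp: ip_scale_left)
        also have "\<dots> = (\<Sum>e\<in>E n. ip h e * blinfun_apply f (A e))"
          using EH h by (intro sum.cong) (auto simp: ip_commute[OF h])
        finally show ?thesis by (simp add: fA)
      qed
      moreover have "(\<lambda>n. ip (s n) h) \<longlonglongrightarrow> ip r h" by (rule ip_tendsto[OF sH r(1) h r(2)])
      ultimately show ?thesis using LIMSEQ_unique by simp
    qed
    have vlim: "v \<longlonglongrightarrow> ip r r"
    proof -
      have "(\<lambda>n. blinfun_apply f (A (s n))) \<longlonglongrightarrow> blinfun_apply f (A r)"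
        by (intro tendsto_intros bounded_linear_on_tendsto[OF A sH r])
      then show ?thesis by (simp add: fs rep[OF r(1)])
    qed
    define u where "u = (\<lambda>n a. blinfun_apply f (F n a))"
    have us: "u n (seq \<omega>) = (\<Sum>k\<in>ind ` E n. blinfun_apply f (A (inv_into (E n) ind k)) * \<xi> k \<omega>)" for n \<omega>
      using indE[of "E n" n]
      by (simp add: u_def F_def seq_def blinfun.sum_right blinfun.scaleR_right sum.reindex mult.commute)
    have vs: "v n = (\<Sum>k\<in>ind ` E n. (blinfun_apply f (A (inv_into (E n) ind k)))\<^sup>2)" for n
      using indE[of "E n" n] by (simp add: v_def sum.reindex)
    have um: "u n \<in> borel_measurable borel" for n
      unfolding u_def by (intro borel_measurable_continuous_onI continuous_intros cF)
    have ug: "cgauss \<mu> (u n)" "(\<integral>a. (u n a)\<^sup>2 \<partial>\<mu>) = v n" for n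
    proof -
      have fin: "finite (ind ` E n)" using E(2) by simp
      show "cgauss \<mu> (u n)"
        unfolding \<mu>_def cgauss_distr[OF seqm um] us by (rule std_gaussian_sequence_lincomb(1)[OF std fin])
      have "(\<integral>a. (u n a)\<^sup>2 \<partial>\<mu>) = (\<integral>\<omega>. (u n (seq \<omega>))\<^sup>2 \<partial>M)"
        unfolding \<mu>_def using um by (intro integral_distr seqm) simp
      then show "(\<integral>a. (u n a)\<^sup>2 \<partial>\<mu>) = v n"
        unfolding us vs std_gaussian_sequence_lincomb(2)[OF std fin] .
    qed
    have fm: "blinfun_apply f \<in> borel_measurable borel"
      by (intro borel_measurable_continuous_onI continuous_intros)
    have fG: "(\<lambda>a. blinfun_apply f (G a)) \<in> borel_measurable \<mu>"
      by (rule measurable_compose[OF G(1) fm])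
    have lim: "AE a in \<mu>. (\<lambda>n. u n a) \<longlonglongrightarrow> blinfun_apply f (G a)"
      using G(2) unfolding u_def by eventually_elim (intro tendsto_intros)
    have "(\<lambda>n. \<integral>a. (u n a)\<^sup>2 \<partial>\<mu>) \<longlonglongrightarrow> ip r r" using vlim by (simp add: ug)
    note w = cgauss_limit[OF \<mu>(1) ug(1) fG lim this]
    have "cgauss \<gamma> (blinfun_apply f)"
      unfolding \<gamma>_def cgauss_distr[OF G(1) fm] by (rule w(1))
    moreover have "(\<integral>x. (blinfun_apply f x)\<^sup>2 \<partial>\<gamma>) = ip r r"
      unfolding \<gamma>_def w(2)[symmetric] using fm by (intro integral_distr G(1)) simp
    ultimately show ?thesis using r(1) rep by blast
  qed
  have \<gamma>: "prob_space \<gamma>" "sets \<gamma> = sets borel" unfolding \<gamma>_def by (auto intro: \<mu>.prob_space_distr G(1))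
  show ?thesis
  proof (intro exI conjI allI)
    show "centered_radon_gaussian \<gamma>"
      using main G(3) unfolding centered_radon_gaussian_def cgauss_def \<gamma>_def[symmetric] by blast
    fix f :: "'x \<Rightarrow>\<^sub>L real"
    obtain r where r: "r \<in> H" "\<And>h. h \<in> H \<Longrightarrow> blinfun_apply f (A h) = ip r h"
      "(\<integral>x. (blinfun_apply f x)\<^sup>2 \<partial>\<gamma>) = ip r r" using main[of f] by blast
    \<comment> \<open>Polarisation: the variances of \<open>f\<close>, \<open>g\<close> and
      \<open>f + g\<close> are known, and the representer \<open>p\<close> of the sum acts on
      \<open>H\<close> like the sum of \<open>r\<close> and \<open>q\<close>.\<close>
    have "(\<integral>x. blinfun_apply f x * blinfun_apply g x \<partial>\<gamma>) = blinfun_apply g (A r)" for g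
    proof -
      obtain q where q: "q \<in> H" "\<And>h. h \<in> H \<Longrightarrow> blinfun_apply g (A h) = ip q h"
        "(\<integral>x. (blinfun_apply g x)\<^sup>2 \<partial>\<gamma>) = ip q q" using main[of g] by blast
      obtain p where p: "p \<in> H" "\<And>h. h \<in> H \<Longrightarrow> blinfun_apply (f + g) (A h) = ip p h"
        "(\<integral>x. (blinfun_apply (f + g) x)\<^sup>2 \<partial>\<gamma>) = ip p p" using main[of "f + g"] by blast
      have ph: "ip p h = ip r h + ip q h" if "h \<in> H" for h
        using p(2)[OF that] r(2)[OF that] q(2)[OF that] by (simp add: blinfun.add_left)
      have "ip p p = ip r r + 2 * ip q r + ip q q"
        using ph[OF p(1)] ph[OF r(1)] ph[OF q(1)] ip_commute[OF p(1) r(1)] ip_commute[OF p(1) q(1)]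
          ip_commute[OF q(1) r(1)] by simp
      moreover have "(\<integral>x. (blinfun_apply (f + g) x)\<^sup>2 \<partial>\<gamma>) = (\<integral>x. (blinfun_apply f x)\<^sup>2 + 2 * (blinfun_apply f x * blinfun_apply g x) + (blinfun_apply g x)\<^sup>2 \<partial>\<gamma>)"
        by (simp add: blinfun.add_left power2_sum algebra_simps)
      moreover have "\<dots> = (\<integral>x. (blinfun_apply f x)\<^sup>2 \<partial>\<gamma>) + 2 * (\<integral>x. blinfun_apply f x * blinfun_apply g x \<partial>\<gamma>) + (\<integral>x. (blinfun_apply g x)\<^sup>2 \<partial>\<gamma>)"
        using integrable_cgauss_mult[OF \<gamma>(1), of f g] main[of f] main[of g]
          cgauss_properties(1)[OF \<gamma>(1), of f] cgauss_properties(1)[OF \<gamma>(1), of g] by simp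
      ultimately show ?thesis using p(3) q(3) r(3) q(2)[OF r(1)] by simp
    qed
    with r show "\<exists>r\<in>H. (\<forall>h\<in>H. blinfun_apply f (A h) = ip r h) \<and>
        (\<forall>g. (\<integral>x. blinfun_apply f x * blinfun_apply g x \<partial>\<gamma>) = blinfun_apply g (A r))" by blast
  qed
qed

end

text \<open>For the evaluation at \<open>s\<close> with representer \<open>r\<close>, the covariance
  with the evaluation at \<open>t\<close> is \<open>r t\<close>, the inner product of
  \<open>r\<close> with the kernel function at \<open>t\<close>; by the choice of \<open>r\<close>
  this is the value of that kernel function at \<open>s\<close>.\<close>

lemma radonifying_imp_covariance:
  fixes emb :: "'x::banach \<Rightarrow> 't \<Rightarrow> real"
  assumes emb: "rkbs emb" and K: "positive_definite K" and std: "std_gaussian_sequence M \<xi>"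
    and sub: "rkhs_space K \<subseteq> range emb"
    and rad: "gamma_radonifying M \<xi> (rkhs_space K) (rkhs_inner K) (inv emb)"
  shows "\<exists>\<gamma> :: 'x measure. centered_radon_gaussian \<gamma> \<and> covariance_function emb \<gamma> = K"
proof -
  interpret K: pd_kernel K by standard (rule K)
  have rk: "is_rkhs K (rkhs_space K, rkhs_inner K)" by (rule K.is_rkhs_rkhs)
  interpret hilbert_space "rkhs_space K" "rkhs_inner K"
    using rk unfolding is_rkhs_def prod.case hilbert_space_on_iff by blast
  obtain \<gamma> :: "'x measure" where \<gamma>: "centered_radon_gaussian \<gamma>"
    "\<And>f. \<exists>r\<in>rkhs_space K. (\<forall>h\<in>rkhs_space K. blinfun_apply f (inv emb h) = rkhs_inner K r h) \<and>
      (\<forall>g. (\<integral>x. blinfun_apply f x * blinfun_apply g x \<partial>\<gamma>) = blinfun_apply g (inv emb r))"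
    using radonifying_imp_gaussian_measure[OF std rad] by blast
  have ev: "blinfun_apply (eval_functional emb t) (inv emb h) = h t" if "h \<in> rkhs_space K" for t h
    using that sub by (simp add: rkbs_eval_functional[OF emb] f_inv_into_f subset_eq)
  have Kt: "(\<lambda>s. K s t) \<in> rkhs_space K" "x \<in> rkhs_space K \<Longrightarrow> rkhs_inner K x (\<lambda>s. K s t) = x t" for x t
    using rk unfolding is_rkhs_def prod.case by blast+
  have "covariance_function emb \<gamma> s t = K s t" for s t
  proof -
    obtain r where r: "r \<in> rkhs_space K"
      "\<And>h. h \<in> rkhs_space K \<Longrightarrow> blinfun_apply (eval_functional emb s) (inv emb h) = rkhs_inner K r h"
      "\<And>g. (\<integral>x. blinfun_apply (eval_functional emb s) x * blinfun_apply g x \<partial>\<gamma>) = blinfun_apply g (inv emb r)"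
      using \<gamma>(2)[of "eval_functional emb s"] by blast
    have "covariance_function emb \<gamma> s t = (\<integral>y. emb y s * emb y t \<partial>\<gamma>)"
    proof (rule covariance_function_eq[OF emb \<gamma>(1)])
      fix f :: "'x \<Rightarrow>\<^sub>L real"
      obtain r where "\<forall>g. (\<integral>x. blinfun_apply f x * blinfun_apply g x \<partial>\<gamma>) = blinfun_apply g (inv emb r)"
        using \<gamma>(2)[of f] by blast
      then show "\<exists>x. \<forall>g. blinfun_apply g x = (\<integral>y. blinfun_apply f y * blinfun_apply g y \<partial>\<gamma>)"
        by (intro exI[of _ "inv emb r"]) simp
    qed
    also have "\<dots> = r t"
      using r(3)[of "eval_functional emb t"] ev[OF r(1)] by (simp add: rkbs_eval_functional[OF emb])
    also have "\<dots> = K s t"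
      using r(2)[OF Kt(1), of t] ev[OF Kt(1), of s t] Kt(2)[OF r(1), of t] by simp
    finally show ?thesis .
  qed
  then show ?thesis using \<gamma>(1) by blast
qed

section \<open>Radon Gaussian measures in coordinates\<close>

text \<open>Every stage adds a compact set of mass close to 1, the sums of two earlier points, and
  their multiples by bounded scalars, all continuous images of compact sets. The bound on the
  scalars grows with the stage, so the union is closed under all of them. Linearity is needed
  because the combinations of points formed later must stay in the union.\<close>

lemma radon_sigma_compact:
  fixes \<gamma> :: "'x::banach measure"
  assumes "radon_probability \<gamma>"
  shows "\<exists>Q::nat \<Rightarrow> 'x set. (\<forall>n. compact (Q n)) \<and> (\<forall>n. Q n \<subseteq> Q (Suc n)) \<and> subspace (\<Union>n. Q n) \<and>
    (\<forall>e>0. \<exists>n. measure \<gamma> (- Q n) < e)"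
proof -
  have s: "sets \<gamma> = sets borel" and "prob_space \<gamma>" using assms by (auto simp: radon_probability_def)
  interpret prob_space \<gamma> by fact
  have "\<exists>C. compact C \<and> measure \<gamma> (UNIV - C) < 1 / real (Suc n)" for n
  proof -
    have "(UNIV :: 'x set) \<in> sets borel" "1 / real (Suc n) > 0" by auto
    then show ?thesis using assms unfolding radon_probability_def by blast
  qed
  then obtain C where C: "\<And>n. compact (C n)" "\<And>n. measure \<gamma> (UNIV - C n) < 1 / real (Suc n)" by metis
  define Q where "Q = rec_nat {0::'x} (\<lambda>n q. q \<union> C n \<union> (\<lambda>z. fst z + snd z) ` (q \<times> q) \<union>
    (\<lambda>z. fst z *\<^sub>R snd z) ` ({- real n..real n} \<times> q))"
  have QS: "Q (Suc n) = Q n \<union> C n \<union> (\<lambda>z. fst z + snd z) ` (Q n \<times> Q n) \<union>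
    (\<lambda>z. fst z *\<^sub>R snd z) ` ({- real n..real n} \<times> Q n)" for n by (simp add: Q_def)
  have Q0: "Q 0 = {0}" by (simp add: Q_def)
  have cQ: "compact (Q n)" for n
  proof (induction n)
    case (Suc n)
    then show ?case unfolding QS
      by (intro compact_Un C compact_continuous_image compact_Times continuous_intros compact_Icc)
  qed (simp add: Q0)
  have inc: "Q n \<subseteq> Q (Suc n)" for n by (auto simp: QS)
  have mono: "Q m \<subseteq> Q n" if "m \<le> n" for m n using inc that by (rule lift_Suc_mono_le)
  have "subspace (\<Union>n. Q n)"
    unfolding subspace_def
  proof (intro conjI ballI allI)
    show "0 \<in> (\<Union>n. Q n)" using Q0 by auto
  next
    fix x y assume "x \<in> (\<Union>n. Q n)" "y \<in> (\<Union>n. Q n)"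
    then obtain m k where "x \<in> Q m" "y \<in> Q k" by auto
    then have "x \<in> Q (max m k)" "y \<in> Q (max m k)" using mono[of m "max m k"] mono[of k "max m k"] by auto
    then have "x + y \<in> Q (Suc (max m k))" unfolding QS by force
    then show "x + y \<in> (\<Union>n. Q n)" by blast
  next
    fix c :: real and x assume "x \<in> (\<Union>n. Q n)"
    then obtain m where m: "x \<in> Q m" by auto
    obtain k where k: "\<bar>c\<bar> \<le> real k" using real_arch_simple by blast
    have "x \<in> Q (max m k)" "\<bar>c\<bar> \<le> real (max m k)" using m mono[of m "max m k"] k by auto
    then have "c *\<^sub>R x \<in> Q (Suc (max m k))" unfolding QS by (force simp: abs_le_iff)
    then show "c *\<^sub>R x \<in> (\<Union>n. Q n)" by blast
  qed
  moreover have "\<exists>n. measure \<gamma> (- Q n) < e" if e: "e > 0" for e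
  proof -
    obtain n where n: "1 / real (Suc n) < e" using nat_approx_posE[OF e] by (auto simp: divide_inverse)
    have "measure \<gamma> (- Q (Suc n)) \<le> measure \<gamma> (UNIV - C n)"
      using C(1)[of n] by (intro finite_measure_mono) (auto simp: QS s borel_compact)
    then show ?thesis using C(2)[of n] n by (intro exI[of _ "Suc n"]) linarith
  qed
  ultimately show ?thesis using cQ inc by blast
qed

text \<open>On a compact set kept at distance \<open>1 / (m + 1)\<close> from 0 finitely many
  members of \<open>D\<close> suffice by compactness; the countable union over all such sets is
  enough. Keeping the sequence inside \<open>D\<close> allows it to consist of evaluations.\<close>

lemma separating_sequence:
  fixes Q :: "nat \<Rightarrow> 'x::banach set" and D :: "('x \<Rightarrow>\<^sub>L real) set"
  assumes Q: "\<And>n. compact (Q n)" and D: "D \<noteq> {}" "\<And>x. x \<noteq> 0 \<Longrightarrow> \<exists>g\<in>D. blinfun_apply g x \<noteq> 0"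
  shows "\<exists>f::nat \<Rightarrow> 'x \<Rightarrow>\<^sub>L real. range f \<subseteq> D \<and> (\<forall>x\<in>(\<Union>n. Q n). (\<forall>j. blinfun_apply (f j) x = 0) \<longrightarrow> x = 0)"
proof -
  have "\<exists>D'\<subseteq>D. finite D' \<and> (\<forall>x\<in>Q n. 1 / real (Suc m) \<le> norm x \<longrightarrow> (\<exists>g\<in>D'. blinfun_apply g x \<noteq> 0))" for n m
  proof -
    let ?S = "Q n \<inter> {x. 1 / real (Suc m) \<le> norm x}"
    have "compact ?S" by (intro compact_Int_closed Q closed_Collect_le continuous_intros)
    moreover have "open {x. blinfun_apply g x \<noteq> 0}" for g :: "'x \<Rightarrow>\<^sub>L real"
      by (intro open_Collect_neq continuous_intros)
    moreover have "?S \<subseteq> (\<Union>g\<in>D. {x. blinfun_apply g x \<noteq> 0})"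
    proof
      fix x assume "x \<in> ?S"
      then have "x \<noteq> 0" by auto
      then show "x \<in> (\<Union>g\<in>D. {x. blinfun_apply g x \<noteq> 0})" using D(2) by auto
    qed
    ultimately obtain D' where "D' \<subseteq> D" "finite D'" "?S \<subseteq> (\<Union>g\<in>D'. {x. blinfun_apply g x \<noteq> 0})"
      by (rule compactE_image)
    then show ?thesis by (intro exI[of _ D']) auto
  qed
  then obtain G where G: "\<And>n m. G n m \<subseteq> D" "\<And>n m. finite (G n m)"
    "\<And>n m x. x \<in> Q n \<Longrightarrow> 1 / real (Suc m) \<le> norm x \<Longrightarrow> \<exists>g\<in>G n m. blinfun_apply g x \<noteq> 0" by metis
  obtain d where d: "d \<in> D" using D by auto
  define C where "C = insert d (\<Union>n. \<Union>m. G n m)"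
  have "countable C" unfolding C_def using G(2) by (intro countable_insert countable_UN) (auto intro: countable_finite)
  moreover have "C \<noteq> {}" by (simp add: C_def)
  ultimately have r: "range (from_nat_into C) = C" by (intro range_from_nat_into)
  have "x = 0" if x: "x \<in> Q n" and z: "\<And>j. blinfun_apply (from_nat_into C j) x = 0" for x n
  proof (rule ccontr)
    assume "x \<noteq> 0"
    then obtain m where m: "1 / real (Suc m) < norm x" using nat_approx_posE[of "norm x"] by (auto simp: divide_inverse)
    obtain g where g: "g \<in> G n m" "blinfun_apply g x \<noteq> 0" using G(3)[OF x, of m] m by auto
    then have "g \<in> range (from_nat_into C)" unfolding r by (auto simp: C_def)
    then show False using z g(2) by auto
  qed
  moreover have "C \<subseteq> D" using G d by (auto simp: C_def)
  ultimately show ?thesis using r by (intro exI[of _ "from_nat_into C"]) auto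
qed

text \<open>By \<open>ineq\<close>, the tail at \<open>s + sqrt 2 * t\<close> divided by
  \<open>p\<close> is at most the square of the tail at \<open>t\<close> divided by
  \<open>p\<close>. Along the levels \<open>t n\<close> this ratio starts at 1/4 at most; of the
  repeated squaring only a factor 1/4 per step is kept, which already beats the growth of
  \<open>(t n)\<^sup>2\<close>, of order \<open>2 ^ n\<close>.\<close>

lemma (in prob_space) second_moment_finite_by_doubling:
  fixes g :: "'a \<Rightarrow> real"
  assumes g[measurable]: "g \<in> borel_measurable M" and g0: "\<And>x. 0 \<le> g x"
    and ineq: "\<And>s t. prob {x \<in> space M. g x \<le> s} * prob {x \<in> space M. t < g x} \<le> (prob {x \<in> space M. (t - s) / sqrt 2 < g x})\<^sup>2"
  shows "(\<integral>\<^sup>+x. ennreal ((g x)\<^sup>2) \<partial>M) < \<infinity>"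
proof -
  define q where "q = (\<lambda>t. prob {x \<in> space M. t < g x})"
  have "(\<lambda>n. measure M {x \<in> space M. real n < g x}) \<longlonglongrightarrow> measure M (\<Inter>n. {x \<in> space M. real n < g x})"
    by (rule finite_Lim_measure_decseq) (auto simp: decseq_def)
  moreover have "(\<Inter>n. {x \<in> space M. real n < g x}) = {}"
    by auto (meson less_asym reals_Archimedean2)
  ultimately have "(\<lambda>n. q (real n)) \<longlonglongrightarrow> 0" by (simp add: q_def)
  then have "\<forall>\<^sub>F n in sequentially. q (real n) < 1/5" by (rule order_tendstoD) simp
  \<comment> \<open>A tail of at most 1/5 leaves \<open>p \<ge> 4/5\<close>, so the initial ratio is
    at most 1/4.\<close>
  then obtain n0 where n0: "\<And>n. n \<ge> n0 \<Longrightarrow> q (real n) < 1/5" by (auto simp: eventually_sequentially)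
  define s where "s = real (Suc n0)"
  have s: "s \<ge> 1" "q s \<le> 1/5" using n0[of "Suc n0"] by (auto simp: s_def)
  define p where "p = prob {x \<in> space M. g x \<le> s}"
  have "prob (space M - {x \<in> space M. s < g x}) = 1 - q s"
    unfolding q_def by (rule prob_compl) measurable
  moreover have "space M - {x \<in> space M. s < g x} = {x \<in> space M. g x \<le> s}" by auto
  ultimately have p: "p = 1 - q s" by (simp add: p_def)
  moreover have "0 \<le> q s" by (simp add: q_def)
  ultimately have p1: "p \<ge> 4/5" "p \<le> 1" using s by auto
  define t where "t = rec_nat s (\<lambda>_ t. s + sqrt 2 * t)"
  have t: "t 0 = s" "t (Suc n) = s + sqrt 2 * t n" for n by (simp_all add: t_def)
  have sq2: "1 \<le> sqrt (2::real)" "4 \<le> 3 * sqrt (2::real)"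
    by (auto intro: real_le_rsqrt power2_le_imp_le simp: power_mult_distrib)
  have tn: "real n + 1 \<le> t n" for n
  proof (induction n)
    case (Suc n)
    have "1 * t n \<le> sqrt 2 * t n" using Suc sq2 by (intro mult_right_mono) auto
    then show ?case using Suc.IH s(1) unfolding t of_nat_Suc by linarith
  qed (use s in \<open>simp add: t\<close>)
  \<comment> \<open>The summand -3 absorbs the \<open>s\<close> added in each step, because
    \<open>4 \<le> 3 * sqrt 2\<close>.\<close>
  have tu: "t n \<le> s * (4 * sqrt 2 ^ n - 3)" for n
  proof (induction n)
    case (Suc n)
    have "sqrt 2 * t n \<le> sqrt 2 * (s * (4 * sqrt 2 ^ n - 3))" by (rule mult_left_mono[OF Suc]) simp
    moreover have "s * 4 \<le> s * (3 * sqrt 2)" using s sq2 by (intro mult_left_mono) auto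
    ultimately show ?case by (simp add: t algebra_simps)
  qed (use s in \<open>simp add: t\<close>)
  have tsq: "(t n)\<^sup>2 \<le> 16 * s\<^sup>2 * 2 ^ n" for n
  proof -
    have "t n \<le> 4 * s * sqrt 2 ^ n" using tu[of n] s by (simp add: algebra_simps)
    then have "(t n)\<^sup>2 \<le> (4 * s * sqrt 2 ^ n)\<^sup>2" using tn[of n] by (intro power_mono) auto
    also have "\<dots> = 16 * s\<^sup>2 * (sqrt 2 ^ n)\<^sup>2" by (simp add: power_mult_distrib)
    also have "(sqrt 2 ^ n)\<^sup>2 = (2::real) ^ n" by (simp add: power2_eq_square power_mult_distrib[symmetric])
    finally show ?thesis .
  qed
  have qt: "q (t n) \<le> p * (1/4) ^ Suc n" for n
  proof (induction n)
    case 0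
    then show ?case using s p1 by (simp add: t)
  next
    case (Suc n)
    have "p * q (t (Suc n)) \<le> (q (t n))\<^sup>2"
      using ineq[of s "t (Suc n)"] by (simp add: t p_def q_def)
    also have "\<dots> \<le> (p * (1/4) ^ Suc n)\<^sup>2" by (rule power_mono[OF Suc]) (simp add: q_def)
    also have "\<dots> = p * (p * (1/4) ^ (2 * Suc n))" by (simp add: power2_eq_square power_mult power_mult_distrib mult_ac flip: power_add)
    finally have "q (t (Suc n)) \<le> p * (1/4) ^ (2 * Suc n)" using p1 by simp
    also have "\<dots> \<le> p * (1/4) ^ Suc (Suc n)" using p1 by (intro mult_left_mono power_decreasing) auto
    finally show ?case .
  qed
  have gen: "F n \<le> (\<Sum>n. F n)" for F :: "nat \<Rightarrow> ennreal" and n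
    using sum_le_suminf[of F "{n}"] by simp
  have pw: "ennreal ((g x)\<^sup>2) \<le> ennreal (s\<^sup>2) + (\<Sum>n. ennreal ((t (Suc n))\<^sup>2) * indicator {x \<in> space M. t n < g x} x)"
    if x: "x \<in> space M" for x
  proof (cases "g x \<le> s")
    case True
    then have "ennreal ((g x)\<^sup>2) \<le> ennreal (s\<^sup>2)" using g0[of x] by (intro ennreal_leI power_mono)
    then show ?thesis by (simp add: add_increasing2)
  next
    case False
    obtain k where "g x \<le> real k" using real_arch_simple by blast
    then have ex: "g x \<le> t (Suc k)" using tn[of "Suc k"] by simp
    define n where "n = (LEAST n. g x \<le> t (Suc n))"
    have n: "g x \<le> t (Suc n)" unfolding n_def by (rule LeastI[of "\<lambda>n. g x \<le> t (Suc n)", OF ex])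
    have "t n < g x"
    proof (cases n)
      case 0
      then show ?thesis using False by (simp add: t)
    next
      case (Suc m)
      then have "\<not> g x \<le> t (Suc m)" using not_less_Least[of m "\<lambda>n. g x \<le> t (Suc n)"] by (simp add: n_def)
      then show ?thesis using Suc by simp
    qed
    then have "ennreal ((g x)\<^sup>2) \<le> ennreal ((t (Suc n))\<^sup>2) * indicator {x \<in> space M. t n < g x} x"
      using n g0[of x] x by (auto intro!: ennreal_leI power_mono)
    also have "\<dots> \<le> (\<Sum>n. ennreal ((t (Suc n))\<^sup>2) * indicator {x \<in> space M. t n < g x} x)"
      by (rule gen)
    finally show ?thesis by (simp add: add_increasing)
  qed
  have "(\<integral>\<^sup>+x. ennreal ((g x)\<^sup>2) \<partial>M) \<le>
    (\<integral>\<^sup>+x. ennreal (s\<^sup>2) + (\<Sum>n. ennreal ((t (Suc n))\<^sup>2) * indicator {x \<in> space M. t n < g x} x) \<partial>M)"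
    by (rule nn_integral_mono) (rule pw)
  also have "\<dots> = ennreal (s\<^sup>2) + (\<Sum>n. \<integral>\<^sup>+x. ennreal ((t (Suc n))\<^sup>2) * indicator {x \<in> space M. t n < g x} x \<partial>M)"
    by (subst nn_integral_add) (auto simp: nn_integral_suminf emeasure_space_1)
  also have "\<dots> \<le> ennreal (s\<^sup>2) + (\<Sum>n. ennreal (8 * s\<^sup>2 * (1/2) ^ n))"
  proof (intro add_left_mono suminf_le)
    fix n
    have "(\<integral>\<^sup>+x. ennreal ((t (Suc n))\<^sup>2) * indicator {x \<in> space M. t n < g x} x \<partial>M) = ennreal ((t (Suc n))\<^sup>2) * ennreal (q (t n))"
      by (subst nn_integral_cmult_indicator) (auto simp: emeasure_eq_measure q_def)
    also have "\<dots> = ennreal ((t (Suc n))\<^sup>2 * q (t n))" by (simp add: ennreal_mult q_def)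
    also have "(t (Suc n))\<^sup>2 * q (t n) \<le> (16 * s\<^sup>2 * 2 ^ Suc n) * (1 * (1/4) ^ Suc n)"
      using p1 by (intro mult_mono tsq order_trans[OF qt] mult_right_mono) (auto simp: q_def)
    also have "\<dots> = 8 * s\<^sup>2 * (1/2) ^ n"
    proof -
      have "(2::real) ^ n * (1/4) ^ n = (1/2) ^ n" by (simp add: power_mult_distrib[symmetric])
      then show ?thesis by (simp add: mult_ac)
    qed
    finally show "(\<integral>\<^sup>+x. ennreal ((t (Suc n))\<^sup>2) * indicator {x \<in> space M. t n < g x} x \<partial>M) \<le> ennreal (8 * s\<^sup>2 * (1/2) ^ n)"
      by (simp add: ennreal_leI)
  qed auto
  also have "\<dots> < \<infinity>"
  proof -
    have "summable (\<lambda>n. 8 * s\<^sup>2 * (1/2::real) ^ n)" by (intro summable_mult summable_geometric) simp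
    then have "(\<Sum>n. ennreal (8 * s\<^sup>2 * (1/2) ^ n)) \<noteq> \<top>" by (rule ennreal_suminf_neq_top) simp
    then show ?thesis by (simp add: less_top)
  qed
  finally show ?thesis .
qed

section \<open>Gaussian measures seen through countably many coordinates\<close>

text \<open>The functionals \<open>f\<close> separate points of the union of the \<open>Q n\<close>
  only, not of all of \<open>'x\<close>. They are a parameter because the sequence is later enlarged
  by a functional while \<gamma> and \<open>Q\<close> stay fixed.\<close>

locale gaussian_coords =
  fixes \<gamma> :: "'x::banach measure" and Q :: "nat \<Rightarrow> 'x set" and f :: "nat \<Rightarrow> 'x \<Rightarrow>\<^sub>L real"
  assumes gauss: "centered_radon_gaussian \<gamma>"
    and compact_Q: "\<And>n. compact (Q n)" and Q_Suc: "\<And>n. Q n \<subseteq> Q (Suc n)"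
    and subspace_UN: "subspace (\<Union>n. Q n)"
    and tight: "\<And>e. e > 0 \<Longrightarrow> \<exists>n. measure \<gamma> (- Q n) < e"
    and separating: "\<And>x. x \<in> (\<Union>n. Q n) \<Longrightarrow> (\<And>j. blinfun_apply (f j) x = 0) \<Longrightarrow> x = 0"
begin

lemma prob_\<gamma>: "prob_space \<gamma>" and sets_\<gamma>[measurable_cong]: "sets \<gamma> = sets borel"
  and cgauss_blinfun: "cgauss \<gamma> (blinfun_apply g)"
  using centered_radon_gaussian_cgauss[OF gauss] by auto

lemma space_\<gamma>[simp]: "space \<gamma> = UNIV"
  using sets_\<gamma>[THEN sets_eq_imp_space_eq] by simp

sublocale \<gamma>: prob_space \<gamma> by (rule prob_\<gamma>)
sublocale P: pair_prob_space \<gamma> \<gamma> by standard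

definition "E = (\<Union>n. Q n)"

definition coords :: "'x \<Rightarrow> nat \<Rightarrow> real" where "coords x = (\<lambda>j. blinfun_apply (f j) x)"

text \<open>Left inverse of the coordinates on \<open>E\<close>; the value 0 elsewhere is arbitrary
  and concerns a null set for the law of the coordinates.\<close>

definition recon :: "(nat \<Rightarrow> real) \<Rightarrow> 'x"
  where "recon a = (if a \<in> coords ` E then the_inv_into E coords a else 0)"

definition cov :: "('x \<Rightarrow>\<^sub>L real) \<Rightarrow> ('x \<Rightarrow>\<^sub>L real) \<Rightarrow> real"
  where "cov g h = (\<integral>x. blinfun_apply g x * blinfun_apply h x \<partial>\<gamma>)"

lemma E_mem: "0 \<in> E" "x \<in> E \<Longrightarrow> y \<in> E \<Longrightarrow> x + y \<in> E" "x \<in> E \<Longrightarrow> y \<in> E \<Longrightarrow> x - y \<in> E"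
  "x \<in> E \<Longrightarrow> c *\<^sub>R x \<in> E"
  using subspace_UN[folded E_def] by (auto simp: subspace_0 subspace_add subspace_diff subspace_scale)

lemma E_sum: "(\<And>i. i \<in> I \<Longrightarrow> x i \<in> E) \<Longrightarrow> (\<Sum>i\<in>I. x i) \<in> E"
  using subspace_sum[OF subspace_UN[folded E_def]] by blast

lemma blinfun_measurable[measurable]: "blinfun_apply g \<in> borel_measurable borel" for g :: "'x \<Rightarrow>\<^sub>L real"
  by (intro borel_measurable_continuous_onI continuous_intros)

lemma continuous_coords: "continuous_on A coords"
proof -
  have "continuous_on A (\<lambda>x. coords x j)" for j unfolding coords_def by (intro continuous_intros)
  then show ?thesis by (rule continuous_on_coordinatewise_then_product)
qed

lemma coords_measurable[measurable]: "coords \<in> borel_measurable borel"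
  by (rule borel_measurable_continuous_onI[OF continuous_coords])

lemma coords_linear: "coords (x + y) = coords x + coords y" "coords (x - y) = coords x - coords y"
  "coords (c *\<^sub>R x) = c *\<^sub>R coords x"
  by (auto simp: coords_def fun_eq_iff blinfun.add_right blinfun.diff_right blinfun.scaleR_right scaleR_fun_def)

lemma inj_coords: "inj_on coords E"
proof (rule inj_onI)
  fix x y assume xy: "x \<in> E" "y \<in> E" and c: "coords x = coords y"
  have "coords x j = coords y j" for j using c by simp
  then have "x - y = 0"
    using E_mem(3)[OF xy] by (intro separating) (auto simp: E_def coords_def blinfun.diff_right)
  then show "x = y" by simp
qed

lemma recon_coords: "x \<in> E \<Longrightarrow> recon (coords x) = x"
  by (simp add: recon_def the_inv_into_f_f[OF inj_coords])

lemma coords_E_borel[measurable]: "coords ` E \<in> sets borel"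
proof -
  have "coords ` E = (\<Union>n. coords ` Q n)" by (auto simp: E_def)
  moreover have "coords ` Q n \<in> sets borel" for n
    by (intro borel_compact compact_continuous_image continuous_coords compact_Q)
  ultimately show ?thesis by auto
qed

text \<open>Within the image of \<open>E\<close>, the points sent outside an open set are a
  countable union of coordinate images of compact sets, hence Borel.\<close>

lemma recon_measurable[measurable]: "recon \<in> borel_measurable borel"
proof (rule borel_measurableI)
  fix S :: "'x set" assume S: "open S"
  have e: "{a \<in> coords ` E. recon a \<notin> S} = (\<Union>n. coords ` (Q n \<inter> - S))"
  proof (intro set_eqI iffI)
    fix a assume "a \<in> {a \<in> coords ` E. recon a \<notin> S}"
    then obtain x where x: "x \<in> E" "a = coords x" "x \<notin> S" by (auto simp: recon_coords)
    then show "a \<in> (\<Union>n. coords ` (Q n \<inter> - S))" by (auto simp: E_def)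
  next
    fix a assume "a \<in> (\<Union>n. coords ` (Q n \<inter> - S))"
    then obtain x n where x: "x \<in> Q n" "x \<notin> S" "a = coords x" by auto
    moreover have "x \<in> E" using x by (auto simp: E_def)
    ultimately show "a \<in> {a \<in> coords ` E. recon a \<notin> S}" by (auto simp: recon_coords)
  qed
  have "coords ` (Q n \<inter> - S) \<in> sets borel" for n
    by (intro borel_compact compact_continuous_image continuous_coords compact_Int_closed compact_Q) (use S in auto)
  then have b: "{a \<in> coords ` E. recon a \<notin> S} \<in> sets borel" unfolding e by auto
  have "recon -` S = (coords ` E - {a \<in> coords ` E. recon a \<notin> S}) \<union> (if 0 \<in> S then - (coords ` E) else {})"
    by (auto simp: recon_def split: if_splits)
  then show "recon -` S \<inter> space borel \<in> sets borel" using b coords_E_borel by (auto simp: Compl_eq_Diff_UNIV)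
qed

lemma Q_borel[measurable]: "Q n \<in> sets borel"
  by (rule borel_compact[OF compact_Q])

lemma E_borel[measurable]: "E \<in> sets borel"
  unfolding E_def by measurable

lemma AE_E: "AE x in \<gamma>. x \<in> E"
proof -
  have "measure \<gamma> (- E) \<le> e" if e: "e > 0" for e
  proof -
    obtain n where "measure \<gamma> (- Q n) < e" using tight[OF e] by blast
    moreover have "measure \<gamma> (- E) \<le> measure \<gamma> (- Q n)"
      by (rule \<gamma>.finite_measure_mono) (auto simp: E_def sets_\<gamma>)
    ultimately show ?thesis by simp
  qed
  from this[of "measure \<gamma> (- E) / 2"] have "measure \<gamma> (- E) = 0"
    using measure_nonneg[of \<gamma> "- E"] by linarith
  then have "- E \<in> null_sets \<gamma>" by (auto simp: null_sets_def \<gamma>.emeasure_eq_measure sets_\<gamma>)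
  then show ?thesis by (rule AE_I') auto
qed

lemma AE_pair_E: "AE z in \<gamma> \<Otimes>\<^sub>M \<gamma>. fst z \<in> E \<and> snd z \<in> E"
proof (rule AE_conjI)
  show "AE z in \<gamma> \<Otimes>\<^sub>M \<gamma>. fst z \<in> E"
  proof (rule P.AE_pair_measure)
    show "AE x in \<gamma>. AE y in \<gamma>. fst (x, y) \<in> E" using AE_E by simp
  qed measurable
  show "AE z in \<gamma> \<Otimes>\<^sub>M \<gamma>. snd z \<in> E"
  proof (rule P.AE_pair_measure)
    show "AE x in \<gamma>. AE y in \<gamma>. snd (x, y) \<in> E" using AE_E by simp
  qed measurable
qed

lemma coord_functional_blinfun:
  "\<phi> \<in> coord_functionals \<Longrightarrow> \<exists>g. \<forall>x. \<phi> (coords x) = blinfun_apply g x"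
proof (induction rule: coord_functionals_induct)
  case (eval j)
  then show ?case by (intro exI[of _ "f j"]) (simp add: coords_def)
next
  case zero
  then show ?case by (intro exI[of _ 0]) simp
next
  case (add \<phi> \<psi>)
  then obtain g h where "\<forall>x. \<phi> (coords x) = blinfun_apply g x" "\<forall>x. \<psi> (coords x) = blinfun_apply h x" by blast
  then show ?case by (intro exI[of _ "g + h"]) (simp add: blinfun.add_left)
next
  case (scale c \<phi>)
  then obtain g where "\<forall>x. \<phi> (coords x) = blinfun_apply g x" by blast
  then show ?case by (intro exI[of _ "c *\<^sub>R g"]) (simp add: blinfun.scaleR_left)
qed

lemma cov_integrable:
  fixes g h :: "'x \<Rightarrow>\<^sub>L real"
  shows "integrable \<gamma> (\<lambda>x. blinfun_apply g x * blinfun_apply h x)"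
  by (rule integrable_cgauss_mult[OF prob_\<gamma> cgauss_blinfun cgauss_blinfun])

lemma cov_commute: "cov g h = cov h g"
  by (simp add: cov_def mult.commute)

lemma cov_bilinear:
  "cov (g + h) k = cov g k + cov h k" "cov k (g + h) = cov k g + cov k h"
  "cov (c *\<^sub>R g) k = c * cov g k" "cov k (c *\<^sub>R g) = c * cov k g"
  "cov (g - h) k = cov g k - cov h k" "cov k (g - h) = cov k g - cov k h"
  "cov 0 k = 0" "cov k 0 = 0"
proof -
  show add: "cov (g + h) k = cov g k + cov h k" for g h k
    by (simp add: cov_def blinfun.add_left distrib_right cov_integrable)
  then show "cov k (g + h) = cov k g + cov k h" by (simp add: cov_commute[of k])
  show scale: "cov (c *\<^sub>R g) k = c * cov g k" for c g k
    by (simp add: cov_def blinfun.scaleR_left mult.assoc)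
  then show "cov k (c *\<^sub>R g) = c * cov k g" by (simp add: cov_commute[of k])
  show diff: "cov (g - h) k = cov g k - cov h k" for g h k
    using add[of g "(-1) *\<^sub>R h" k] scale[of "-1" h k] by simp
  then show "cov k (g - h) = cov k g - cov k h" by (simp add: cov_commute[of k])
  show zero: "cov 0 k = 0" for k by (simp add: cov_def)
  then show "cov k 0 = 0" by (simp add: cov_commute[of k])
qed

lemma cov_sum: "cov (\<Sum>i\<in>I. c i *\<^sub>R g i) k = (\<Sum>i\<in>I. c i * cov (g i) k)"
  "cov k (\<Sum>i\<in>I. c i *\<^sub>R g i) = (\<Sum>i\<in>I. c i * cov k (g i))"
  by (induction I rule: infinite_finite_induct) (auto simp: cov_bilinear)

lemma cov_square: "cov g g = (\<integral>x. (blinfun_apply g x)\<^sup>2 \<partial>\<gamma>)"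
  by (simp add: cov_def power2_eq_square)

lemma cov_nonneg: "0 \<le> cov g g"
  by (simp add: cov_square)

lemma cov_zero_AE: "cov g g = 0 \<Longrightarrow> AE x in \<gamma>. blinfun_apply g x = 0"
  using integral_nonneg_eq_0_iff_AE[OF cov_integrable[of g g]] by (simp add: cov_def)

lemma cov_zero:
  assumes "cov g g = 0"
  shows "cov g h = 0"
proof -
  have "(\<integral>x. blinfun_apply g x * blinfun_apply h x \<partial>\<gamma>) = (\<integral>x. 0 \<partial>\<gamma>)"
    using cov_zero_AE[OF assms] by (intro integral_cong_AE) auto
  then show ?thesis by (simp add: cov_def)
qed

lemma law_single:
  fixes U V :: "'x \<Rightarrow> 'i::countable \<Rightarrow> real"
  assumes "\<And>\<phi>. \<phi> \<in> coord_functionals \<Longrightarrow> \<exists>g k. (\<forall>x. \<phi> (U x) = blinfun_apply g x) \<and>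
    (\<forall>x. \<phi> (V x) = blinfun_apply k x) \<and> cov g g = cov k k"
  shows "U \<in> borel_measurable borel" "V \<in> borel_measurable borel" "distr \<gamma> borel U = distr \<gamma> borel V"
proof -
  have "(\<lambda>x. U x i) \<in> borel_measurable borel" "(\<lambda>x. V x i) \<in> borel_measurable borel" for i
  proof -
    obtain g k where e: "\<And>x. U x i = blinfun_apply g x" "\<And>x. V x i = blinfun_apply k x"
      using assms[OF coord_functionals_eval[of i]] by blast
    show "(\<lambda>x. U x i) \<in> borel_measurable borel" "(\<lambda>x. V x i) \<in> borel_measurable borel"
      unfolding e by measurable
  qed
  then show m[measurable]: "U \<in> borel_measurable borel" "V \<in> borel_measurable borel"
    by (auto intro: measurable_coordinatewise_then_product)
  show "distr \<gamma> borel U = distr \<gamma> borel V"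
  proof (rule law_eq_gaussI[OF prob_\<gamma> prob_\<gamma>])
    fix \<phi> :: "('i \<Rightarrow> real) \<Rightarrow> real" assume "\<phi> \<in> coord_functionals"
    then obtain g k where "\<forall>x. \<phi> (U x) = blinfun_apply g x" "\<forall>x. \<phi> (V x) = blinfun_apply k x" "cov g g = cov k k"
      using assms by blast
    then show "cgauss \<gamma> (\<lambda>x. \<phi> (U x)) \<and> cgauss \<gamma> (\<lambda>x. \<phi> (V x)) \<and> (\<integral>x. (\<phi> (U x))\<^sup>2 \<partial>\<gamma>) = (\<integral>x. (\<phi> (V x))\<^sup>2 \<partial>\<gamma>)"
      using cgauss_blinfun by (simp add: cov_square)
  qed measurable
qed

lemma gauss_pair:
  assumes "\<And>z. u z = blinfun_apply g (fst z) + blinfun_apply h (snd z)"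
  shows "cgauss (\<gamma> \<Otimes>\<^sub>M \<gamma>) u" "(\<integral>z. (u z)\<^sup>2 \<partial>(\<gamma> \<Otimes>\<^sub>M \<gamma>)) = cov g g + cov h h"
proof -
  have u: "u = (\<lambda>z. blinfun_apply g (fst z) + blinfun_apply h (snd z))" using assms by blast
  show "cgauss (\<gamma> \<Otimes>\<^sub>M \<gamma>) u" "(\<integral>z. (u z)\<^sup>2 \<partial>(\<gamma> \<Otimes>\<^sub>M \<gamma>)) = cov g g + cov h h"
    unfolding u cov_square
    using cgauss_add_prod[OF prob_\<gamma> prob_\<gamma> cgauss_blinfun cgauss_blinfun] by blast+
qed

text \<open>The two components are independent, so the variance of a split functional is
  \<open>cov g g + cov h h\<close>, and equality of laws becomes an identity between covariances.
  The splitting also yields measurability for the product \<sigma>-algebra.\<close>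

lemma law_pair:
  fixes U :: "'x \<times> 'x \<Rightarrow> 'i::countable \<Rightarrow> real" and V :: "'x \<Rightarrow> 'i \<Rightarrow> real"
  assumes "\<And>\<phi>. \<phi> \<in> coord_functionals \<Longrightarrow> \<exists>g h k. (\<forall>z. \<phi> (U z) = blinfun_apply g (fst z) + blinfun_apply h (snd z)) \<and>
    (\<forall>x. \<phi> (V x) = blinfun_apply k x) \<and> cov g g + cov h h = cov k k"
  shows "U \<in> borel_measurable (\<gamma> \<Otimes>\<^sub>M \<gamma>)" "V \<in> borel_measurable borel" "distr (\<gamma> \<Otimes>\<^sub>M \<gamma>) borel U = distr \<gamma> borel V"
proof -
  have "(\<lambda>z. U z i) \<in> borel_measurable (\<gamma> \<Otimes>\<^sub>M \<gamma>)" "(\<lambda>x. V x i) \<in> borel_measurable borel" for i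
  proof -
    obtain g h k where e: "\<And>z. U z i = blinfun_apply g (fst z) + blinfun_apply h (snd z)" "\<And>x. V x i = blinfun_apply k x"
      using assms[OF coord_functionals_eval[of i]] by blast
    show "(\<lambda>z. U z i) \<in> borel_measurable (\<gamma> \<Otimes>\<^sub>M \<gamma>)" "(\<lambda>x. V x i) \<in> borel_measurable borel"
      unfolding e by measurable
  qed
  then show m: "U \<in> borel_measurable (\<gamma> \<Otimes>\<^sub>M \<gamma>)" "V \<in> borel_measurable borel"
    by (auto intro: measurable_coordinatewise_then_product)
  have V: "V \<in> borel_measurable \<gamma>" using m(2) by measurable
  show "distr (\<gamma> \<Otimes>\<^sub>M \<gamma>) borel U = distr \<gamma> borel V"
  proof (rule law_eq_gaussI[OF P.prob_space_axioms prob_\<gamma> m(1) V])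
    fix \<phi> :: "('i \<Rightarrow> real) \<Rightarrow> real" assume "\<phi> \<in> coord_functionals"
    then obtain g h k where e: "\<And>z. \<phi> (U z) = blinfun_apply g (fst z) + blinfun_apply h (snd z)"
      "\<And>x. \<phi> (V x) = blinfun_apply k x" "cov g g + cov h h = cov k k"
      using assms by blast
    have "(\<integral>x. (\<phi> (V x))\<^sup>2 \<partial>\<gamma>) = cov k k" unfolding e(2) by (simp add: cov_square)
    moreover have "cgauss \<gamma> (\<lambda>x. \<phi> (V x))" unfolding e(2) by (rule cgauss_blinfun)
    ultimately show "cgauss (\<gamma> \<Otimes>\<^sub>M \<gamma>) (\<lambda>x. \<phi> (U x)) \<and> cgauss \<gamma> (\<lambda>x. \<phi> (V x)) \<and>
      (\<integral>x. (\<phi> (U x))\<^sup>2 \<partial>(\<gamma> \<Otimes>\<^sub>M \<gamma>)) = (\<integral>x. (\<phi> (V x))\<^sup>2 \<partial>\<gamma>)"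
      using gauss_pair[of "\<lambda>z. \<phi> (U z)", OF e(1)] e(3) by simp
  qed
qed

text \<open>If \<open>x\<close>, \<open>y\<close> are independent with law \<open>\<gamma>\<close> and \<open>v\<close> is the sequence of covariances with \<open>g\<close>,
  then \<open>x - (g x / \<sigma>\<^sup>2) v + (g y / \<sigma>\<^sup>2) v\<close> has again law \<open>\<gamma>\<close>, so almost surely lies in \<open>E\<close>.  Fixing \<open>x\<close>
  and subtracting two such points shows that \<open>v\<close> itself lies in the linear space \<open>E\<close>.\<close>

lemma cov_vector: "\<exists>x\<in>E. \<forall>j. blinfun_apply (f j) x = cov g (f j)"
proof (cases "cov g g = 0")
  case True
  then show ?thesis using E_mem(1) cov_zero[OF True] by (intro bexI[of _ 0]) auto
next
  case False
  then have s: "cov g g > 0" using cov_nonneg[of g] by simp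
  define v where "v = (\<lambda>j. cov g (f j))"
  define U where "U = (\<lambda>z::'x \<times> 'x. \<lambda>j. coords (fst z) j + ((blinfun_apply g (snd z) - blinfun_apply g (fst z)) / cov g g) * v j)"
  have \<phi>k: "\<exists>k. (\<forall>x. \<phi> (coords x) = blinfun_apply k x) \<and> \<phi> v = cov g k" if "\<phi> \<in> coord_functionals" for \<phi>
    using that
  proof (induction rule: coord_functionals_induct)
    case (eval j)
    then show ?case by (intro exI[of _ "f j"]) (simp add: coords_def v_def)
  next
    case zero
    then show ?case by (intro exI[of _ 0]) (simp add: cov_bilinear)
  next
    case (add \<phi> \<psi>)
    then obtain k l where "\<forall>x. \<phi> (coords x) = blinfun_apply k x" "\<phi> v = cov g k"
      "\<forall>x. \<psi> (coords x) = blinfun_apply l x" "\<psi> v = cov g l" by blast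
    then show ?case by (intro exI[of _ "k + l"]) (simp add: blinfun.add_left cov_bilinear)
  next
    case (scale c \<phi>)
    then obtain k where "\<forall>x. \<phi> (coords x) = blinfun_apply k x" "\<phi> v = cov g k" by blast
    then show ?case by (intro exI[of _ "c *\<^sub>R k"]) (simp add: blinfun.scaleR_left cov_bilinear)
  qed
  have law: "U \<in> borel_measurable (\<gamma> \<Otimes>\<^sub>M \<gamma>)" "distr (\<gamma> \<Otimes>\<^sub>M \<gamma>) borel U = distr \<gamma> borel coords"
  proof -
    have *: "\<exists>k l m. (\<forall>z. \<phi> (U z) = blinfun_apply k (fst z) + blinfun_apply l (snd z)) \<and>
      (\<forall>x. \<phi> (coords x) = blinfun_apply m x) \<and> cov k k + cov l l = cov m m" if \<phi>: "\<phi> \<in> coord_functionals" for \<phi>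
    proof -
      obtain k where k: "\<And>x. \<phi> (coords x) = blinfun_apply k x" "\<phi> v = cov g k" using \<phi>k[OF \<phi>] by blast
      \<comment> \<open>The regression coefficient of \<open>k\<close> on \<open>g\<close>:
        \<open>k - c *\<^sub>R g\<close> is uncorrelated with \<open>g\<close>, so the variance of
        \<open>k\<close> splits accordingly.\<close>
      define c where "c = cov g k / cov g g"
      have "\<phi> (U z) = blinfun_apply (k - c *\<^sub>R g) (fst z) + blinfun_apply (c *\<^sub>R g) (snd z)" for z
        unfolding U_def coord_functionals_linear[OF \<phi>] k c_def
        by (simp add: blinfun.diff_left blinfun.scaleR_left diff_divide_distrib algebra_simps)
      moreover have "cov (k - c *\<^sub>R g) (k - c *\<^sub>R g) + cov (c *\<^sub>R g) (c *\<^sub>R g) = cov k k"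
        using s cov_commute[of k g] by (simp add: cov_bilinear c_def field_simps)
      ultimately show ?thesis using k(1) by blast
    qed
    show "U \<in> borel_measurable (\<gamma> \<Otimes>\<^sub>M \<gamma>)" "distr (\<gamma> \<Otimes>\<^sub>M \<gamma>) borel U = distr \<gamma> borel coords"
      by (rule law_pair[of U coords, OF *], assumption)+
  qed
  have "AE a in distr \<gamma> borel coords. a \<in> coords ` E"
    by (subst AE_distr_iff) (use AE_E in \<open>auto elim!: eventually_mono\<close>)
  then have "AE z in \<gamma> \<Otimes>\<^sub>M \<gamma>. U z \<in> coords ` E"
    unfolding law(2)[symmetric] by (subst (asm) AE_distr_iff) (use law(1) in auto)
  then have "AE x in \<gamma>. AE y in \<gamma>. U (x, y) \<in> coords ` E" by (rule P.AE_pair)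
  then obtain x where x: "AE y in \<gamma>. U (x, y) \<in> coords ` E"
    using \<gamma>.AE_False by (metis (mono_tags, lifting) eventually_mono)
  \<comment> \<open>If \<open>g\<close> took one value on almost all admissible \<open>y\<close>,
    this value would be its mean 0 and its variance would vanish.\<close>
  have "\<exists>y y'. U (x, y) \<in> coords ` E \<and> U (x, y') \<in> coords ` E \<and> blinfun_apply g y \<noteq> blinfun_apply g y'"
  proof (rule ccontr)
    assume neg: "\<not> ?thesis"
    obtain y0 where y0: "U (x, y0) \<in> coords ` E"
      using x \<gamma>.AE_False by (metis (mono_tags, lifting) eventually_mono)
    have ae: "AE y in \<gamma>. blinfun_apply g y = blinfun_apply g y0"
      using x by eventually_elim (use neg y0 in blast)
    have "(\<integral>y. blinfun_apply g y \<partial>\<gamma>) = (\<integral>y. blinfun_apply g y0 \<partial>\<gamma>)"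
      using ae by (intro integral_cong_AE) auto
    then have "blinfun_apply g y0 = 0"
      using cgauss_properties(3)[OF prob_\<gamma> cgauss_blinfun, of g] using \<gamma>.prob_space by simp
    then have "cov g g = (\<integral>y. 0 \<partial>\<gamma>)" unfolding cov_def using ae by (intro integral_cong_AE) auto
    then show False using s by simp
  qed
  then obtain y y' p p' where y: "blinfun_apply g y \<noteq> blinfun_apply g y'"
    "p \<in> E" "U (x, y) = coords p" "p' \<in> E" "U (x, y') = coords p'" by blast
  define c where "c = (blinfun_apply g y - blinfun_apply g y') / cov g g"
  have c: "c \<noteq> 0" using y(1) s by (simp add: c_def)
  have "coords p j - coords p' j = c * v j" for j
    unfolding y(3,5)[symmetric] U_def c_def using s by (simp add: field_simps)
  then have "coords ((1 / c) *\<^sub>R (p - p')) j = v j" for j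
    using c by (simp add: coords_linear scaleR_fun_def)
  then show ?thesis using E_mem y by (intro bexI[of _ "(1 / c) *\<^sub>R (p - p')"]) (auto simp: coords_def v_def)
qed

text \<open>If the rotated difference has norm at most \<open>s\<close> and the rotated sum has norm
  above \<open>t\<close>, the triangle inequality pushes both \<open>x\<close> and \<open>y\<close>
  beyond \<open>(t - s) / sqrt 2\<close>. The event involves both rotated vectors, so their joint
  law is compared, in sequences indexed by \<open>nat + nat\<close>.\<close>

lemma fernique_inequality:
  "measure \<gamma> {x. norm x \<le> s} * measure \<gamma> {x. t < norm x} \<le> (measure \<gamma> {x. (t - s) / sqrt 2 < norm x})\<^sup>2"
proof -
  define r where "r = 1 / sqrt (2::real)"
  have r2: "r * r = 1/2" "r > 0" by (auto simp: r_def)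
  define V where "V = (\<lambda>z::'x \<times> 'x. case_sum (coords (fst z)) (coords (snd z)))"
  define U where "U = (\<lambda>z::'x \<times> 'x. case_sum (coords (r *\<^sub>R (fst z - snd z))) (coords (r *\<^sub>R (fst z + snd z))))"
  have rep: "\<exists>g h. \<forall>x y. \<phi> (case_sum (coords x) (coords y)) = blinfun_apply g x + blinfun_apply h y"
    if "\<phi> \<in> coord_functionals" for \<phi> :: "(nat + nat \<Rightarrow> real) \<Rightarrow> real"
    using that
  proof (induction rule: coord_functionals_induct)
    case (eval j)
    show ?case
    proof (cases j)
      case (Inl i)
      then show ?thesis by (intro exI[of _ "f i"] exI[of _ 0]) (simp add: coords_def)
    next
      case (Inr i)
      then show ?thesis by (intro exI[of _ 0] exI[of _ "f i"]) (simp add: coords_def)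
    qed
  next
    case zero
    then show ?case by (intro exI[of _ 0]) simp
  next
    case (add \<phi> \<psi>)
    then obtain g h g' h' where "\<forall>x y. \<phi> (case_sum (coords x) (coords y)) = blinfun_apply g x + blinfun_apply h y"
      "\<forall>x y. \<psi> (case_sum (coords x) (coords y)) = blinfun_apply g' x + blinfun_apply h' y" by blast
    then show ?case by (intro exI[of _ "g + g'"] exI[of _ "h + h'"]) (simp add: blinfun.add_left)
  next
    case (scale c \<phi>)
    then obtain g h where "\<forall>x y. \<phi> (case_sum (coords x) (coords y)) = blinfun_apply g x + blinfun_apply h y" by blast
    then show ?case by (intro exI[of _ "c *\<^sub>R g"] exI[of _ "c *\<^sub>R h"]) (simp add: blinfun.scaleR_left distrib_left)
  qed
  have rep': "\<exists>g h k l. (\<forall>z. \<phi> (V z) = blinfun_apply g (fst z) + blinfun_apply h (snd z)) \<and>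
      (\<forall>z. \<phi> (U z) = blinfun_apply k (fst z) + blinfun_apply l (snd z)) \<and> cov g g + cov h h = cov k k + cov l l"
    if \<phi>: "\<phi> \<in> coord_functionals" for \<phi>
  proof -
    obtain g h where gh: "\<And>x y. \<phi> (case_sum (coords x) (coords y)) = blinfun_apply g x + blinfun_apply h y"
      using rep[OF \<phi>] by blast
    have "\<phi> (U z) = blinfun_apply (r *\<^sub>R (h + g)) (fst z) + blinfun_apply (r *\<^sub>R (h - g)) (snd z)" for z
      unfolding U_def gh by (simp add: blinfun.add_left blinfun.diff_left blinfun.scaleR_left
          blinfun.add_right blinfun.diff_right blinfun.scaleR_right algebra_simps)
    moreover have "cov (r *\<^sub>R (h + g)) (r *\<^sub>R (h + g)) + cov (r *\<^sub>R (h - g)) (r *\<^sub>R (h - g)) = cov g g + cov h h"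
    proof -
      have "cov (r *\<^sub>R (h + g)) (r *\<^sub>R (h + g)) + cov (r *\<^sub>R (h - g)) (r *\<^sub>R (h - g)) = (r * r) * (2 * cov g g + 2 * cov h h)"
        by (simp add: cov_bilinear algebra_simps cov_commute[of g h])
      then show ?thesis by (simp add: r2)
    qed
    ultimately show ?thesis using gh by (metis (no_types, lifting) V_def)
  qed
  have UVm: "U \<in> borel_measurable (\<gamma> \<Otimes>\<^sub>M \<gamma>)" "V \<in> borel_measurable (\<gamma> \<Otimes>\<^sub>M \<gamma>)"
  proof -
    have "(\<lambda>z. U z i) \<in> borel_measurable (\<gamma> \<Otimes>\<^sub>M \<gamma>)" "(\<lambda>z. V z i) \<in> borel_measurable (\<gamma> \<Otimes>\<^sub>M \<gamma>)" for i
    proof -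
      obtain g h k l where e: "\<And>z. V z i = blinfun_apply g (fst z) + blinfun_apply h (snd z)"
        "\<And>z. U z i = blinfun_apply k (fst z) + blinfun_apply l (snd z)"
        using rep'[OF coord_functionals_eval[of i]] by blast
      show "(\<lambda>z. U z i) \<in> borel_measurable (\<gamma> \<Otimes>\<^sub>M \<gamma>)" "(\<lambda>z. V z i) \<in> borel_measurable (\<gamma> \<Otimes>\<^sub>M \<gamma>)"
        unfolding e by measurable
    qed
    then show "U \<in> borel_measurable (\<gamma> \<Otimes>\<^sub>M \<gamma>)" "V \<in> borel_measurable (\<gamma> \<Otimes>\<^sub>M \<gamma>)"
      by (auto intro: measurable_coordinatewise_then_product)
  qed
  have law: "distr (\<gamma> \<Otimes>\<^sub>M \<gamma>) borel V = distr (\<gamma> \<Otimes>\<^sub>M \<gamma>) borel U"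
  proof (rule law_eq_gaussI[OF P.prob_space_axioms P.prob_space_axioms UVm(2,1)])
    fix \<phi> :: "(nat + nat \<Rightarrow> real) \<Rightarrow> real" assume "\<phi> \<in> coord_functionals"
    then obtain g h k l where e: "\<And>z. \<phi> (V z) = blinfun_apply g (fst z) + blinfun_apply h (snd z)"
      "\<And>z. \<phi> (U z) = blinfun_apply k (fst z) + blinfun_apply l (snd z)" "cov g g + cov h h = cov k k + cov l l"
      using rep' by blast
    show "cgauss (\<gamma> \<Otimes>\<^sub>M \<gamma>) (\<lambda>z. \<phi> (V z)) \<and> cgauss (\<gamma> \<Otimes>\<^sub>M \<gamma>) (\<lambda>z. \<phi> (U z)) \<and>
      (\<integral>z. (\<phi> (V z))\<^sup>2 \<partial>(\<gamma> \<Otimes>\<^sub>M \<gamma>)) = (\<integral>z. (\<phi> (U z))\<^sup>2 \<partial>(\<gamma> \<Otimes>\<^sub>M \<gamma>))"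
      using gauss_pair[of "\<lambda>z. \<phi> (V z)", OF e(1)] gauss_pair[of "\<lambda>z. \<phi> (U z)", OF e(2)] e(3) by simp
  qed
  define W where "W = {w::nat + nat \<Rightarrow> real. norm (recon (\<lambda>j. w (Inl j))) \<le> s \<and> t < norm (recon (\<lambda>j. w (Inr j)))}"
  have Wb: "W \<in> sets borel"
  proof -
    have [measurable]: "(\<lambda>w::nat + nat \<Rightarrow> real. (\<lambda>j. w (Inl j))) \<in> borel_measurable borel"
      "(\<lambda>w::nat + nat \<Rightarrow> real. (\<lambda>j. w (Inr j))) \<in> borel_measurable borel"
      by (intro measurable_coordinatewise_then_product borel_measurable_continuous_onI continuous_on_product_coordinates)+
    show ?thesis unfolding W_def by measurable
  qed
  have em: "emeasure (distr (\<gamma> \<Otimes>\<^sub>M \<gamma>) borel Y) W = emeasure (\<gamma> \<Otimes>\<^sub>M \<gamma>) {z \<in> space (\<gamma> \<Otimes>\<^sub>M \<gamma>). Y z \<in> W}"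
    if "Y \<in> borel_measurable (\<gamma> \<Otimes>\<^sub>M \<gamma>)" for Y
    using that Wb by (simp add: emeasure_distr vimage_def Int_def conj_commute)
  let ?A = "{x::'x. norm x \<le> s}" and ?B = "{x::'x. t < norm x}" and ?C = "{x::'x. (t - s) / sqrt 2 < norm x}"
  have ABC: "?A \<in> sets \<gamma>" "?B \<in> sets \<gamma>" "?C \<in> sets \<gamma>"
    unfolding sets_\<gamma> by measurable
  have "emeasure \<gamma> ?A * emeasure \<gamma> ?B = emeasure (\<gamma> \<Otimes>\<^sub>M \<gamma>) (?A \<times> ?B)"
    by (rule \<gamma>.emeasure_pair_measure_Times[symmetric]) (use ABC in auto)
  also have "\<dots> \<le> emeasure (\<gamma> \<Otimes>\<^sub>M \<gamma>) {z \<in> space (\<gamma> \<Otimes>\<^sub>M \<gamma>). V z \<in> W}"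
  proof (rule emeasure_mono_AE)
    show "AE z in \<gamma> \<Otimes>\<^sub>M \<gamma>. z \<in> ?A \<times> ?B \<longrightarrow> z \<in> {z \<in> space (\<gamma> \<Otimes>\<^sub>M \<gamma>). V z \<in> W}"
      using AE_pair_E by eventually_elim (auto simp: V_def W_def recon_coords space_pair_measure)
    show "{z \<in> space (\<gamma> \<Otimes>\<^sub>M \<gamma>). V z \<in> W} \<in> sets (\<gamma> \<Otimes>\<^sub>M \<gamma>)" using UVm(2) Wb by measurable
  qed
  also have "\<dots> = emeasure (\<gamma> \<Otimes>\<^sub>M \<gamma>) {z \<in> space (\<gamma> \<Otimes>\<^sub>M \<gamma>). U z \<in> W}"
    using em[OF UVm(1)] em[OF UVm(2)] law by simp
  also have "\<dots> \<le> emeasure (\<gamma> \<Otimes>\<^sub>M \<gamma>) (?C \<times> ?C)"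
  proof (rule emeasure_mono_AE)
    show "AE z in \<gamma> \<Otimes>\<^sub>M \<gamma>. z \<in> {z \<in> space (\<gamma> \<Otimes>\<^sub>M \<gamma>). U z \<in> W} \<longrightarrow> z \<in> ?C \<times> ?C"
      using AE_pair_E
    proof eventually_elim
      case (elim z)
      obtain x y where z: "z = (x, y)" by (cases z)
      have xy: "x \<in> E" "y \<in> E" using elim z by auto
      show ?case
      proof
        assume "z \<in> {z \<in> space (\<gamma> \<Otimes>\<^sub>M \<gamma>). U z \<in> W}"
        then have "norm (r *\<^sub>R (x - y)) \<le> s" "t < norm (r *\<^sub>R (x + y))"
          using xy by (auto simp: z U_def W_def recon_coords E_mem)
        then have n: "r * norm (x - y) \<le> s" "t < r * norm (x + y)" using r2 by auto
        have "norm (x + y) \<le> 2 * norm x + norm (x - y)"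
        proof -
          have e: "2 *\<^sub>R x - (x - y) = x + y" by (simp add: scaleR_2)
          show ?thesis using norm_triangle_ineq4[of "2 *\<^sub>R x" "x - y"] unfolding e by simp
        qed
        moreover have "norm (x + y) \<le> 2 * norm y + norm (x - y)"
        proof -
          have e: "2 *\<^sub>R y + (x - y) = x + y" by (simp add: scaleR_2)
          show ?thesis using norm_triangle_ineq[of "2 *\<^sub>R y" "x - y"] unfolding e by simp
        qed
        ultimately have "r * norm (x + y) \<le> r * (2 * norm x + norm (x - y))" "r * norm (x + y) \<le> r * (2 * norm y + norm (x - y))"
          using r2(2) by (simp_all add: mult_left_mono)
        then have "r * (t - s) < r * (r * (2 * norm x))" "r * (t - s) < r * (r * (2 * norm y))"
          using n r2(2) by (auto simp: distrib_left)
        then have "r * (t - s) < norm x" "r * (t - s) < norm y"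
          using r2(1) by (simp_all flip: mult.assoc)
        then show "z \<in> ?C \<times> ?C" by (simp add: z r_def)
      qed
    qed
    show "?C \<times> ?C \<in> sets (\<gamma> \<Otimes>\<^sub>M \<gamma>)" using ABC by auto
  qed
  also have "\<dots> = emeasure \<gamma> ?C * emeasure \<gamma> ?C"
    by (rule \<gamma>.emeasure_pair_measure_Times) (use ABC in auto)
  finally show ?thesis
    by (simp add: \<gamma>.emeasure_eq_measure ennreal_mult[symmetric] power2_eq_square)
qed

lemma second_moment_finite: "(\<integral>\<^sup>+x. ennreal ((norm x)\<^sup>2) \<partial>\<gamma>) < \<infinity>"
  by (rule \<gamma>.second_moment_finite_by_doubling) (use fernique_inequality in auto)

lemma nn_integral_law_single:
  fixes F :: "'x \<Rightarrow> ennreal"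
  assumes F[measurable]: "F \<in> borel_measurable borel"
    and E: "\<And>x. x \<in> E \<Longrightarrow> S x \<in> E" "\<And>x. x \<in> E \<Longrightarrow> T x \<in> E"
    and lin: "\<And>g. \<exists>k l. (\<forall>x. blinfun_apply g (S x) = blinfun_apply k x) \<and>
      (\<forall>x. blinfun_apply g (T x) = blinfun_apply l x) \<and> cov k k = cov l l"
  shows "(\<integral>\<^sup>+x. F (S x) \<partial>\<gamma>) = (\<integral>\<^sup>+x. F (T x) \<partial>\<gamma>)"
proof -
  have *: "\<exists>k l. (\<forall>x. \<phi> (coords (S x)) = blinfun_apply k x) \<and>
      (\<forall>x. \<phi> (coords (T x)) = blinfun_apply l x) \<and> cov k k = cov l l" if "\<phi> \<in> coord_functionals" for \<phi>
    using coord_functional_blinfun[OF that] lin by metis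
  note law = law_single[of "\<lambda>x. coords (S x)" "\<lambda>x. coords (T x)", OF *]
  have "(\<integral>\<^sup>+x. F (S x) \<partial>\<gamma>) = (\<integral>\<^sup>+x. F (recon (coords (S x))) \<partial>\<gamma>)"
    by (rule nn_integral_cong_AE) (use AE_E in eventually_elim, simp add: recon_coords E)
  also have "\<dots> = (\<integral>\<^sup>+a. F (recon a) \<partial>distr \<gamma> borel (\<lambda>x. coords (S x)))"
    using law(1) by (subst nn_integral_distr) auto
  also have "\<dots> = (\<integral>\<^sup>+a. F (recon a) \<partial>distr \<gamma> borel (\<lambda>x. coords (T x)))"
    using law(3) by simp
  also have "\<dots> = (\<integral>\<^sup>+x. F (recon (coords (T x))) \<partial>\<gamma>)"
    using law(2) by (subst nn_integral_distr) auto
  also have "\<dots> = (\<integral>\<^sup>+x. F (T x) \<partial>\<gamma>)"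
    by (rule nn_integral_cong_AE) (use AE_E in eventually_elim, simp add: recon_coords E)
  finally show ?thesis .
qed

text \<open>\<open>S z\<close> combines two vectors, and \<open>F (S z)\<close> may fail to be
  measurable for the product \<sigma>-algebra. The detour through \<open>coords\<close> and
  \<open>recon\<close> is measurable and changes nothing where \<open>S z\<close> lies in
  \<open>E\<close>.\<close>

lemma nn_integral_law_pair:
  fixes F :: "'x \<Rightarrow> ennreal" and S :: "'x \<times> 'x \<Rightarrow> 'x"
  assumes F[measurable]: "F \<in> borel_measurable borel"
    and E: "\<And>x. x \<in> E \<Longrightarrow> T x \<in> E"
    and lin: "\<And>g. \<exists>h k l. (\<forall>z. blinfun_apply g (S z) = blinfun_apply h (fst z) + blinfun_apply k (snd z)) \<and>
      (\<forall>x. blinfun_apply g (T x) = blinfun_apply l x) \<and> cov h h + cov k k = cov l l"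
  shows "(\<lambda>z. F (recon (coords (S z)))) \<in> borel_measurable (\<gamma> \<Otimes>\<^sub>M \<gamma>)"
    "(\<integral>\<^sup>+z. F (recon (coords (S z))) \<partial>(\<gamma> \<Otimes>\<^sub>M \<gamma>)) = (\<integral>\<^sup>+x. F (T x) \<partial>\<gamma>)"
proof -
  have *: "\<exists>h k l. (\<forall>z. \<phi> (coords (S z)) = blinfun_apply h (fst z) + blinfun_apply k (snd z)) \<and>
      (\<forall>x. \<phi> (coords (T x)) = blinfun_apply l x) \<and> cov h h + cov k k = cov l l" if "\<phi> \<in> coord_functionals" for \<phi>
    using coord_functional_blinfun[OF that] lin by metis
  note law = law_pair[of "\<lambda>z. coords (S z)" "\<lambda>x. coords (T x)", OF *]
  have Fr: "(\<lambda>a. F (recon a)) \<in> borel_measurable borel" by measurable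
  show m: "(\<lambda>z. F (recon (coords (S z)))) \<in> borel_measurable (\<gamma> \<Otimes>\<^sub>M \<gamma>)"
    by (rule measurable_compose[OF law(1) Fr])
  have "(\<integral>\<^sup>+z. F (recon (coords (S z))) \<partial>(\<gamma> \<Otimes>\<^sub>M \<gamma>)) = (\<integral>\<^sup>+a. F (recon a) \<partial>distr (\<gamma> \<Otimes>\<^sub>M \<gamma>) borel (\<lambda>z. coords (S z)))"
    using law(1) by (subst nn_integral_distr) auto
  also have "\<dots> = (\<integral>\<^sup>+a. F (recon a) \<partial>distr \<gamma> borel (\<lambda>x. coords (T x)))"
    using law(3) by simp
  also have "\<dots> = (\<integral>\<^sup>+x. F (recon (coords (T x))) \<partial>\<gamma>)"
    using law(2) by (subst nn_integral_distr) auto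
  also have "\<dots> = (\<integral>\<^sup>+x. F (T x) \<partial>\<gamma>)"
    by (rule nn_integral_cong_AE) (use AE_E in eventually_elim, simp add: recon_coords E)
  finally show "(\<integral>\<^sup>+z. F (recon (coords (S z))) \<partial>(\<gamma> \<Otimes>\<^sub>M \<gamma>)) = (\<integral>\<^sup>+x. F (T x) \<partial>\<gamma>)" .
qed

text \<open>With \<open>S x = \<Sum>i<n. u i x *\<^sub>R y i\<close> the uncorrelated parts \<open>S\<close> and \<open>T - S\<close> are independent, so \<open>2 S - T\<close>
  has the same law as \<open>T\<close>; the bound is then convexity applied to \<open>S = (T + (2 S - T)) / 2\<close>.\<close>

lemma gaussian_domination:
  fixes u :: "nat \<Rightarrow> 'x \<Rightarrow>\<^sub>L real" and y :: "nat \<Rightarrow> 'x"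
  assumes orth: "\<And>i j. i < n \<Longrightarrow> j < n \<Longrightarrow> cov (u i) (u j) = (if i = j then 1 else 0)"
    and T: "continuous_on UNIV T" "\<And>x. x \<in> E \<Longrightarrow> T x \<in> E"
    and y: "\<And>i. i < n \<Longrightarrow> y i \<in> E"
    and lin: "\<And>g. \<exists>k. (\<forall>x. blinfun_apply g (T x) = blinfun_apply k x) \<and> (\<forall>i<n. blinfun_apply g (y i) = cov (u i) k)"
  shows "(\<integral>\<^sup>+x. ennreal ((norm (\<Sum>i<n. blinfun_apply (u i) x *\<^sub>R y i))\<^sup>2) \<partial>\<gamma>) \<le> (\<integral>\<^sup>+x. ennreal ((norm (T x))\<^sup>2) \<partial>\<gamma>)"
proof -
  define S where "S = (\<lambda>x. \<Sum>i<n. blinfun_apply (u i) x *\<^sub>R y i)"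
  define W where "W = (\<lambda>x. 2 *\<^sub>R S x - T x)"
  have cS: "continuous_on UNIV S" unfolding S_def by (intro continuous_intros)
  have cW: "continuous_on UNIV W" unfolding W_def by (intro continuous_intros cS T)
  have m[measurable]: "T \<in> borel_measurable borel" "W \<in> borel_measurable borel"
    by (auto intro: borel_measurable_continuous_onI T cW)
  have SE: "S x \<in> E" for x unfolding S_def using y by (intro E_sum E_mem) auto
  have "(\<integral>\<^sup>+x. ennreal ((norm (W x))\<^sup>2) \<partial>\<gamma>) = (\<integral>\<^sup>+x. ennreal ((norm (T x))\<^sup>2) \<partial>\<gamma>)"
  proof (rule nn_integral_law_single[where F="\<lambda>x. ennreal ((norm x)\<^sup>2)"])
    show "W x \<in> E" if "x \<in> E" for x unfolding W_def using that SE T by (intro E_mem) auto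
    show "\<exists>k l. (\<forall>x. blinfun_apply g (W x) = blinfun_apply k x) \<and>
      (\<forall>x. blinfun_apply g (T x) = blinfun_apply l x) \<and> cov k k = cov l l" for g
    proof -
      obtain k where k: "\<And>x. blinfun_apply g (T x) = blinfun_apply k x" "\<And>i. i < n \<Longrightarrow> blinfun_apply g (y i) = cov (u i) k"
        using lin[of g] by blast
      \<comment> \<open>The projection of \<open>k\<close> onto the span of the \<open>u i\<close>
        with respect to \<open>cov\<close>; \<open>2 *\<^sub>R w - k\<close> is the reflection of
        \<open>k\<close>, which has the same variance.\<close>
      define w where "w = (\<Sum>i<n. cov (u i) k *\<^sub>R u i)"
      have "blinfun_apply g (W x) = blinfun_apply (2 *\<^sub>R w - k) x" for x
        by (simp add: W_def S_def w_def k blinfun.diff_right blinfun.diff_left blinfun.scaleR_right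
            blinfun.scaleR_left blinfun.sum_right blinfun.sum_left mult.commute)
      moreover have "cov (2 *\<^sub>R w - k) (2 *\<^sub>R w - k) = cov k k"
      proof -
        have wu: "cov w (u i) = cov (u i) k" if "i < n" for i
        proof -
          have "cov w (u i) = (\<Sum>j<n. if j = i then cov (u i) k else 0)"
            unfolding w_def cov_sum using orth that by (intro sum.cong) auto
          then show ?thesis using that by simp
        qed
        have "cov w w = (\<Sum>i<n. cov (u i) k * cov w (u i))" by (subst (2) w_def) (simp add: cov_sum)
        also have "\<dots> = (\<Sum>i<n. cov (u i) k * cov (u i) k)" by (simp add: wu)
        also have "\<dots> = cov w k" by (simp add: w_def cov_sum)
        finally show ?thesis by (simp add: cov_bilinear cov_commute[of k w])
      qed
      ultimately show ?thesis using k(1) by blast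
    qed
  qed (use T in auto)
  moreover have half: "ennreal (1/2) * ennreal (a\<^sup>2) + ennreal (1/2) * ennreal (b\<^sup>2) = ennreal (1/2 * a\<^sup>2 + 1/2 * b\<^sup>2)" for a b
    by (subst ennreal_plus, simp, simp, subst (1 2) ennreal_mult) auto
  moreover have "(\<integral>\<^sup>+x. ennreal ((norm (S x))\<^sup>2) \<partial>\<gamma>) \<le> (\<integral>\<^sup>+x. ennreal (1/2) * ennreal ((norm (T x))\<^sup>2) + ennreal (1/2) * ennreal ((norm (W x))\<^sup>2) \<partial>\<gamma>)"
  proof (rule nn_integral_mono)
    fix x
    have "2 *\<^sub>R S x = T x + W x" by (simp add: W_def)
    then have "norm (2 *\<^sub>R S x) \<le> norm (T x) + norm (W x)" by (metis norm_triangle_ineq)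
    then have "2 * norm (S x) \<le> norm (T x) + norm (W x)" by simp
    then have "(2 * norm (S x))\<^sup>2 \<le> (norm (T x) + norm (W x))\<^sup>2" by (rule power_mono) simp
    also have "\<dots> \<le> 2 * (norm (T x))\<^sup>2 + 2 * (norm (W x))\<^sup>2"
      using sum_squares_bound[of "norm (T x)" "norm (W x)"] by (simp add: power2_sum)
    finally have "(norm (S x))\<^sup>2 \<le> (1/2) * (norm (T x))\<^sup>2 + (1/2) * (norm (W x))\<^sup>2" by (simp add: power_mult_distrib)
    then show "ennreal ((norm (S x))\<^sup>2) \<le> ennreal (1/2) * ennreal ((norm (T x))\<^sup>2) + ennreal (1/2) * ennreal ((norm (W x))\<^sup>2)"
      unfolding half by (rule ennreal_leI)
  qed
  moreover have "(\<integral>\<^sup>+x. ennreal (1/2) * ennreal ((norm (T x))\<^sup>2) + ennreal (1/2) * ennreal ((norm (W x))\<^sup>2) \<partial>\<gamma>) =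
    ennreal (1/2) * (\<integral>\<^sup>+x. ennreal ((norm (T x))\<^sup>2) \<partial>\<gamma>) + ennreal (1/2) * (\<integral>\<^sup>+x. ennreal ((norm (W x))\<^sup>2) \<partial>\<gamma>)"
    by (subst nn_integral_add) (auto simp: nn_integral_cmult)
  moreover have "ennreal (1/2) * z + ennreal (1/2) * z = z" for z
  proof -
    have "ennreal (1/2) + ennreal (1/2) = ennreal (1/2 + 1/2)" by (rule ennreal_plus[symmetric]) auto
    then have "(ennreal (1/2) + ennreal (1/2)) * z = z" by simp
    then show ?thesis by (simp only: distrib_right)
  qed
  ultimately show ?thesis by (simp add: S_def)
qed

lemma gauss_orthonormal_blinfun:
  assumes orth: "\<And>i j. i < n \<Longrightarrow> j < n \<Longrightarrow> cov (u i) (u j) = (if i = j then 1 else 0)"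
  shows "gauss_orthonormal \<gamma> n (\<lambda>i. blinfun_apply (u i))"
  unfolding gauss_orthonormal_def
proof (intro allI conjI)
  fix c :: "nat \<Rightarrow> real"
  define w where "w = (\<Sum>i<n. c i *\<^sub>R u i)"
  have e: "(\<Sum>i<n. c i * blinfun_apply (u i) x) = blinfun_apply w x" for x
    by (simp add: w_def blinfun.sum_left blinfun.scaleR_left)
  show "cgauss \<gamma> (\<lambda>x. \<Sum>i<n. c i * blinfun_apply (u i) x)" unfolding e by (rule cgauss_blinfun)
  have "cov w w = (\<Sum>i<n. c i * (\<Sum>j<n. c j * cov (u i) (u j)))"
    unfolding w_def by (simp only: cov_sum(1)) (simp only: cov_sum(2))
  also have "\<dots> = (\<Sum>i<n. c i * (\<Sum>j<n. if j = i then c i else 0))"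
    using orth by (intro sum.cong arg_cong2[of _ _ _ _ "(*)"]) auto
  also have "\<dots> = (\<Sum>i<n. (c i)\<^sup>2)" by (intro sum.cong) (auto simp: power2_eq_square)
  finally show "(\<integral>x. (\<Sum>i<n. c i * blinfun_apply (u i) x)\<^sup>2 \<partial>\<gamma>) = (\<Sum>i<n. (c i)\<^sup>2)"
    unfolding e by (simp add: cov_square)
qed

text \<open>\<open>cov\<close> is only a semi-inner product: residuals of variance 0 are dropped,
  and each \<open>f j\<close> is recovered up to such a residual. Staying in the span of
  \<open>f\<close> is what lets the result be translated into kernel functions.\<close>

lemma gram_schmidt:
  "\<exists>(N::nat) g. (\<forall>k<N. g k \<in> span (range f)) \<and> (\<forall>j<N. \<forall>k<N. cov (g j) (g k) = (if j = k then 1 else 0)) \<and>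
    (\<forall>j<m. cov (f j - (\<Sum>k<N. cov (f j) (g k) *\<^sub>R g k)) (f j - (\<Sum>k<N. cov (f j) (g k) *\<^sub>R g k)) = 0)"
proof (induction m)
  case 0
  show ?case by (rule exI[where x="0::nat"]) auto
next
  case (Suc m)
  then obtain N :: nat and g where g: "\<And>k. k < N \<Longrightarrow> g k \<in> span (range f)"
    "\<And>j k. j < N \<Longrightarrow> k < N \<Longrightarrow> cov (g j) (g k) = (if j = k then 1 else 0)"
    "\<And>j. j < m \<Longrightarrow> cov (f j - (\<Sum>k<N. cov (f j) (g k) *\<^sub>R g k)) (f j - (\<Sum>k<N. cov (f j) (g k) *\<^sub>R g k)) = 0"
    by blast
  define h where "h = f m - (\<Sum>k<N. cov (f m) (g k) *\<^sub>R g k)"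
  show ?case
  proof (cases "cov h h = 0")
    case True
    then show ?thesis using g by (intro exI[of _ N] exI[of _ g]) (auto simp: h_def less_Suc_eq)
  next
    case False
    define s where "s = sqrt (cov h h)"
    have s: "s > 0" "s * s = cov h h" using False cov_nonneg[of h] by (auto simp: s_def)
    have hg: "cov h (g k) = 0" if k: "k < N" for k
    proof -
      have "(\<Sum>j<N. cov (f m) (g j) * cov (g j) (g k)) = (\<Sum>j<N. if j = k then cov (f m) (g k) else 0)"
        using g(2) k by (intro sum.cong) auto
      then show ?thesis using k by (simp add: h_def cov_bilinear cov_sum)
    qed
    define g' where "g' = g(N := (1 / s) *\<^sub>R h)"
    have g'k: "g' k = g k" if "k < N" for k using that by (simp add: g'_def)
    have g'N: "g' N = (1 / s) *\<^sub>R h" by (simp add: g'_def)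
    have "h \<in> span (range f)" unfolding h_def
      using g(1) by (intro span_diff span_sum span_scale) (auto intro: span_base)
    then have sp: "\<forall>k<Suc N. g' k \<in> span (range f)" using g(1) by (auto simp: less_Suc_eq g'k g'N span_scale)
    have orth: "\<forall>j<Suc N. \<forall>k<Suc N. cov (g' j) (g' k) = (if j = k then 1 else 0)"
    proof (intro allI impI)
      fix j k assume "j < Suc N" "k < Suc N"
      then consider "j < N" "k < N" | "j < N" "k = N" | "j = N" "k < N" | "j = N" "k = N" by linarith
      then show "cov (g' j) (g' k) = (if j = k then 1 else 0)"
      proof cases
        case 4
        then show ?thesis using s(1) by (simp add: g'N cov_bilinear s(2)[symmetric])
      qed (use g(2) hg in \<open>auto simp: g'k g'N cov_bilinear cov_commute[of _ h]\<close>)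
    qed
    have sum': "(\<Sum>k<Suc N. cov q (g' k) *\<^sub>R g' k) = (\<Sum>k<N. cov q (g k) *\<^sub>R g k) + cov q (g' N) *\<^sub>R g' N" for q
      by (simp add: g'k)
    have "cov (f j - (\<Sum>k<Suc N. cov (f j) (g' k) *\<^sub>R g' k)) (f j - (\<Sum>k<Suc N. cov (f j) (g' k) *\<^sub>R g' k)) = 0"
      if j: "j < Suc m" for j
    proof (cases "j = m")
      case True
      have fh: "cov (f m) h = cov h h"
      proof -
        have "cov (\<Sum>k<N. cov (f m) (g k) *\<^sub>R g k) h = 0"
          by (simp add: cov_sum hg cov_commute[of _ h])
        then show ?thesis by (subst (2) h_def) (simp add: cov_bilinear)
      qed
      have "f m - (\<Sum>k<Suc N. cov (f m) (g' k) *\<^sub>R g' k) = h - cov (f m) (g' N) *\<^sub>R g' N"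
        unfolding sum' by (simp add: h_def)
      also have "\<dots> = 0" using s by (simp add: g'N cov_bilinear fh flip: s(2))
      finally show ?thesis using True by (simp add: cov_bilinear)
    next
      case False
      with j have j: "j < m" by simp
      define d where "d = f j - (\<Sum>k<N. cov (f j) (g k) *\<^sub>R g k)"
      have d: "cov d d = 0" using g(3)[OF j] by (simp add: d_def)
      have "cov d h + (\<Sum>k<N. cov (f j) (g k) * cov (g k) h) = cov (f j) h"
        by (simp add: d_def cov_bilinear cov_sum)
      then have "cov (f j) h = 0" using cov_zero[OF d, of h] hg by (simp add: cov_commute[of _ h])
      then have "f j - (\<Sum>k<Suc N. cov (f j) (g' k) *\<^sub>R g' k) = d"
        unfolding sum' by (simp add: d_def g'N cov_bilinear)
      then show ?thesis using d by simp
    qed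
    then show ?thesis using sp orth by (intro exI[of _ "Suc N"] exI[of _ g']) auto
  qed
qed

text \<open>The pairs of points of \<open>Q n\<close> at distance at least \<open>e\<close> form a
  compact set, covered by the open sets on which some coordinate differs; finitely many coordinates
  suffice.\<close>

lemma coords_determine:
  assumes e: "e > 0"
  shows "\<exists>m. \<forall>x\<in>Q n. \<forall>y\<in>Q n. (\<forall>j<m. blinfun_apply (f j) x = blinfun_apply (f j) y) \<longrightarrow> norm (x - y) < e"
proof -
  let ?K = "(Q n \<times> Q n) \<inter> {z. e \<le> norm (fst z - snd z)}"
  let ?N = "\<lambda>j. {z. blinfun_apply (f j) (fst z) \<noteq> blinfun_apply (f j) (snd z)}"
  have "compact ?K"
    by (intro compact_Int_closed compact_Times compact_Q closed_Collect_le continuous_intros)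
  moreover have "open (?N j)" for j
    by (intro open_Collect_neq continuous_intros)
  moreover have "?K \<subseteq> (\<Union>j\<in>UNIV. ?N j)"
  proof
    fix z assume z: "z \<in> ?K"
    then have E: "fst z \<in> E" "snd z \<in> E" by (auto simp: E_def)
    have "fst z \<noteq> snd z" using z e by auto
    then have "coords (fst z) \<noteq> coords (snd z)" using E inj_coords by (auto simp: inj_on_def)
    then show "z \<in> (\<Union>j\<in>UNIV. ?N j)" by (auto simp: coords_def fun_eq_iff)
  qed
  ultimately obtain J where J: "finite J" "?K \<subseteq> (\<Union>j\<in>J. ?N j)" by (rule compactE_image)
  obtain m where m: "\<And>j. j \<in> J \<Longrightarrow> j < m" using J(1) unfolding finite_nat_set_iff_bounded by blast
  have *: "norm (x - y) < e" if xy: "x \<in> Q n" "y \<in> Q n" and eq: "\<And>j. j < m \<Longrightarrow> blinfun_apply (f j) x = blinfun_apply (f j) y" for x y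
  proof (rule ccontr)
    assume "\<not> norm (x - y) < e"
    then have "(x, y) \<in> ?K" using xy by auto
    then have "(x, y) \<in> (\<Union>j\<in>J. ?N j)" using J(2) by blast
    then show False using eq m by auto
  qed
  then show ?thesis by blast
qed

lemma tail_second_moment:
  assumes e: "e > 0"
  shows "\<exists>n. (\<integral>\<^sup>+x. ennreal ((norm x)\<^sup>2) * indicator {x. real n < norm x} x \<partial>\<gamma>) \<le> ennreal e"
proof -
  have i: "integrable \<gamma> (\<lambda>x. (norm x)\<^sup>2)"
    using second_moment_finite by (intro integrableI_bounded) auto
  have "(\<lambda>n. \<integral>x. (norm x)\<^sup>2 * indicator {x. real n < norm x} x \<partial>\<gamma>) \<longlonglongrightarrow> (\<integral>x. 0 \<partial>\<gamma>)"
  proof (rule integral_dominated_convergence[where w="\<lambda>x. (norm x)\<^sup>2"])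
    show "AE x in \<gamma>. (\<lambda>n. (norm x)\<^sup>2 * indicator {x. real n < norm x} x) \<longlonglongrightarrow> 0"
    proof (rule AE_I2)
      fix x :: 'x
      obtain k where k: "norm x \<le> real k" using real_arch_simple by blast
      have "\<forall>\<^sub>F n in sequentially. (norm x)\<^sup>2 * indicator {x. real n < norm x} x = 0"
        using eventually_ge_at_top[of k] by eventually_elim (use k in auto)
      then show "(\<lambda>n. (norm x)\<^sup>2 * indicator {x. real n < norm x} x) \<longlonglongrightarrow> 0" by (rule tendsto_eventually)
    qed
    show "AE x in \<gamma>. norm ((norm x)\<^sup>2 * indicator {x. real n < norm x} x) \<le> (norm x)\<^sup>2" for n
      by (rule AE_I2) (auto split: split_indicator)
  qed (use i in auto)
  then have "\<forall>\<^sub>F n in sequentially. (\<integral>x. (norm x)\<^sup>2 * indicator {x. real n < norm x} x \<partial>\<gamma>) < e"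
    using e by (intro order_tendstoD) auto
  then obtain n where n: "(\<integral>x. (norm x)\<^sup>2 * indicator {x. real n < norm x} x \<partial>\<gamma>) < e"
    by (auto simp: eventually_sequentially)
  have "(\<integral>\<^sup>+x. ennreal ((norm x)\<^sup>2) * indicator {x. real n < norm x} x \<partial>\<gamma>) =
    (\<integral>\<^sup>+x. ennreal ((norm x)\<^sup>2 * indicator {x. real n < norm x} x) \<partial>\<gamma>)"
    by (intro nn_integral_cong) (auto split: split_indicator)
  also have "\<dots> = ennreal (\<integral>x. (norm x)\<^sup>2 * indicator {x. real n < norm x} x \<partial>\<gamma>)"
  proof (rule nn_integral_eq_integral)
    show "integrable \<gamma> (\<lambda>x. (norm x)\<^sup>2 * indicator {x. real n < norm x} x)"
      by (rule Bochner_Integration.integrable_bound[OF i]) (auto split: split_indicator)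
  qed auto
  also have "\<dots> \<le> ennreal e" using n by (intro ennreal_leI) simp
  finally show ?thesis by blast
qed

text \<open>Given \<open>x\<close>, the vector \<open>T (x, y)\<close> resamples the part of \<open>x\<close> that is not determined by the first \<open>m\<close>
  coordinates.  It is close to \<open>x\<close> with high probability, and \<open>x - T (x, y)\<close> is the difference \<open>W (x, y)\<close> of two
  independent copies of \<open>x - S x\<close>.\<close>

lemma finite_rank_approximation:
  assumes R: "\<And>g. R g \<in> E" "\<And>g h. blinfun_apply h (R g) = cov g h" and e: "e > 0"
  shows "\<exists>(N::nat) g. (\<forall>k<N. g k \<in> span (range f)) \<and> (\<forall>j<N. \<forall>k<N. cov (g j) (g k) = (if j = k then 1 else 0)) \<and>
    (\<integral>\<^sup>+x. ennreal ((norm (x - (\<Sum>k<N. blinfun_apply (g k) x *\<^sub>R R (g k))))\<^sup>2) \<partial>\<gamma>) \<le> ennreal e"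
proof -
  \<comment> \<open>The bounds \<open>e / 8\<close> and \<open>e / (4 * C)\<close> make the integral
    of \<open>B\<close> at most \<open>e / 2\<close>. It is charged twice and added to
    \<open>e\<close>; the total \<open>2 * e\<close> is halved by the factor \<open>sqrt 2\<close>
    in the law of \<open>W\<close>.\<close>
  obtain M where M: "(\<integral>\<^sup>+x. ennreal ((norm x)\<^sup>2) * indicator {x. real M < norm x} x \<partial>\<gamma>) \<le> ennreal (e / 8)"
    using tail_second_moment[of "e / 8"] e by auto
  \<comment> \<open>Twice the squared norms of two vectors, each of norm at most \<open>M\<close>,
    add up to at most \<open>4 * (real M)\<^sup>2\<close>. The added 1 keeps \<open>C\<close>
    positive when \<open>M = 0\<close>.\<close>
  define C where "C = 4 * (real M)\<^sup>2 + 1"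
  have C: "C > 0" "4 * (real M)\<^sup>2 \<le> C" by (auto simp: C_def intro: add_nonneg_pos)
  obtain n where n: "measure \<gamma> (- Q n) < e / (4 * C)" using tight[of "e / (4 * C)"] e C by auto
  obtain m where m: "\<And>x y. x \<in> Q n \<Longrightarrow> y \<in> Q n \<Longrightarrow> (\<And>j. j < m \<Longrightarrow> blinfun_apply (f j) x = blinfun_apply (f j) y)
      \<Longrightarrow> norm (x - y) < sqrt e"
    using coords_determine[of "sqrt e" n] e by auto
  obtain N :: nat and g where g: "\<And>k. k < N \<Longrightarrow> g k \<in> span (range f)"
    "\<And>j k. j < N \<Longrightarrow> k < N \<Longrightarrow> cov (g j) (g k) = (if j = k then 1 else 0)"
    "\<And>j. j < m \<Longrightarrow> cov (f j - (\<Sum>k<N. cov (f j) (g k) *\<^sub>R g k)) (f j - (\<Sum>k<N. cov (f j) (g k) *\<^sub>R g k)) = 0"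
    using gram_schmidt[of m] by blast
  define S where "S = (\<lambda>x. \<Sum>k<N. blinfun_apply (g k) x *\<^sub>R R (g k))"
  define p where "p = (\<lambda>h. \<Sum>k<N. cov h (g k) *\<^sub>R g k)"
  have SE: "S x \<in> E" for x unfolding S_def using R(1) by (intro E_sum E_mem)
  have hS: "blinfun_apply h (S x) = blinfun_apply (p h) x" for h x
    by (simp add: S_def p_def blinfun.sum_right blinfun.sum_left blinfun.scaleR_right blinfun.scaleR_left R(2)
        cov_commute[of h] mult.commute)
  have pp: "cov (p h) (p h) = cov (p h) h" for h
  proof -
    have "cov (p h) (g k) = cov h (g k)" if "k < N" for k
    proof -
      have "cov (p h) (g k) = (\<Sum>j<N. if j = k then cov h (g k) else 0)"
        unfolding p_def cov_sum using g(2) that by (intro sum.cong) auto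
      then show ?thesis using that by simp
    qed
    then have "cov (p h) (p h) = (\<Sum>k<N. cov h (g k) * cov h (g k))"
      by (subst (2) p_def) (simp add: cov_sum)
    also have "\<dots> = cov (p h) h" by (simp add: p_def cov_sum cov_commute[of h])
    finally show ?thesis .
  qed
  have var: "cov (h - p h) (h - p h) = cov h h - cov (p h) h" for h
    by (simp add: cov_bilinear pp cov_commute[of h "p h"])
  have var': "cov (p h - h) (p h - h) = cov h h - cov (p h) h" for h
    by (simp add: cov_bilinear pp cov_commute[of h "p h"])
  have cS: "continuous_on UNIV S" unfolding S_def by (intro continuous_intros)
  define T where "T = (\<lambda>z::'x \<times> 'x. S (fst z) + (snd z - S (snd z)))"
  define W where "W = (\<lambda>z::'x \<times> 'x. (fst z - S (fst z)) - (snd z - S (snd z)))"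
  define F where "F = (\<lambda>x::'x. ennreal ((norm x)\<^sup>2))"
  have F[measurable]: "F \<in> borel_measurable borel" unfolding F_def by measurable
  \<comment> \<open>A charge depending on a single vector: both \<open>fst z\<close> and
    \<open>T z\<close> have law \<gamma>, so their charges have the same integral. The first term
    pays when a vector leaves \<open>Q n\<close>, the second for norms beyond
    \<open>M\<close>.\<close>
  define B where "B = (\<lambda>x::'x. ennreal C * indicator (- Q n) x + 2 * (ennreal ((norm x)\<^sup>2) * indicator {x. real M < norm x} x))"
  have B[measurable]: "B \<in> borel_measurable borel" unfolding B_def by measurable
  have lawW: "(\<lambda>z. F (recon (coords (W z)))) \<in> borel_measurable (\<gamma> \<Otimes>\<^sub>M \<gamma>)"
    "(\<integral>\<^sup>+z. F (recon (coords (W z))) \<partial>(\<gamma> \<Otimes>\<^sub>M \<gamma>)) = (\<integral>\<^sup>+x. F (sqrt 2 *\<^sub>R (x - S x)) \<partial>\<gamma>)"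
  proof -
    have *: "\<exists>k l j. (\<forall>z. blinfun_apply h (W z) = blinfun_apply k (fst z) + blinfun_apply l (snd z)) \<and>
      (\<forall>x. blinfun_apply h (sqrt 2 *\<^sub>R (x - S x)) = blinfun_apply j x) \<and> cov k k + cov l l = cov j j" for h
      by (rule exI[of _ "h - p h"], rule exI[of _ "p h - h"], rule exI[of _ "sqrt 2 *\<^sub>R (h - p h)"])
         (simp add: W_def hS blinfun.diff_right blinfun.diff_left blinfun.scaleR_right blinfun.scaleR_left
           blinfun.minus_left cov_bilinear(3,4) var var' mult.assoc[symmetric])
    have TE: "\<And>x. x \<in> E \<Longrightarrow> sqrt 2 *\<^sub>R (x - S x) \<in> E" using SE by (intro E_mem)
    show "(\<lambda>z. F (recon (coords (W z)))) \<in> borel_measurable (\<gamma> \<Otimes>\<^sub>M \<gamma>)"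
      "(\<integral>\<^sup>+z. F (recon (coords (W z))) \<partial>(\<gamma> \<Otimes>\<^sub>M \<gamma>)) = (\<integral>\<^sup>+x. F (sqrt 2 *\<^sub>R (x - S x)) \<partial>\<gamma>)"
      by (rule nn_integral_law_pair[OF F TE *], assumption)+
  qed
  have lawT: "(\<lambda>z. B (recon (coords (T z)))) \<in> borel_measurable (\<gamma> \<Otimes>\<^sub>M \<gamma>)"
    "(\<integral>\<^sup>+z. B (recon (coords (T z))) \<partial>(\<gamma> \<Otimes>\<^sub>M \<gamma>)) = (\<integral>\<^sup>+x. B x \<partial>\<gamma>)"
  proof -
    have *: "\<exists>k l j. (\<forall>z. blinfun_apply h (T z) = blinfun_apply k (fst z) + blinfun_apply l (snd z)) \<and>
      (\<forall>x. blinfun_apply h x = blinfun_apply j x) \<and> cov k k + cov l l = cov j j" for h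
      by (rule exI[of _ "p h"], rule exI[of _ "h - p h"], rule exI[of _ h])
         (simp add: T_def hS blinfun.diff_right blinfun.diff_left blinfun.add_right var pp)
    show "(\<lambda>z. B (recon (coords (T z)))) \<in> borel_measurable (\<gamma> \<Otimes>\<^sub>M \<gamma>)"
      "(\<integral>\<^sup>+z. B (recon (coords (T z))) \<partial>(\<gamma> \<Otimes>\<^sub>M \<gamma>)) = (\<integral>\<^sup>+x. B x \<partial>\<gamma>)"
      by (rule nn_integral_law_pair[where T="\<lambda>x. x", OF B _ *], assumption)+
  qed
  have law1: "(\<lambda>z. B (recon (coords (fst z)))) \<in> borel_measurable (\<gamma> \<Otimes>\<^sub>M \<gamma>)"
    "(\<integral>\<^sup>+z. B (recon (coords (fst z))) \<partial>(\<gamma> \<Otimes>\<^sub>M \<gamma>)) = (\<integral>\<^sup>+x. B x \<partial>\<gamma>)"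
  proof -
    have *: "\<exists>k l j. (\<forall>z. blinfun_apply h (fst z) = blinfun_apply k (fst z) + blinfun_apply l (snd z)) \<and>
      (\<forall>x. blinfun_apply h x = blinfun_apply j x) \<and> cov k k + cov l l = cov j j" for h
      by (rule exI[of _ h], rule exI[of _ 0], rule exI[of _ h]) (simp add: cov_bilinear)
    show "(\<lambda>z. B (recon (coords (fst z)))) \<in> borel_measurable (\<gamma> \<Otimes>\<^sub>M \<gamma>)"
      "(\<integral>\<^sup>+z. B (recon (coords (fst z))) \<partial>(\<gamma> \<Otimes>\<^sub>M \<gamma>)) = (\<integral>\<^sup>+x. B x \<partial>\<gamma>)"
      by (rule nn_integral_law_pair[where T="\<lambda>x. x", OF B _ *], assumption)+
  qed
  \<comment> \<open>Residuals of variance 0 vanish almost surely, so \<open>S\<close> preserves the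
    first \<open>m\<close> coordinates off a null set.\<close>
  have agree: "AE x in \<gamma>. \<forall>j<m. blinfun_apply (f j) (S x) = blinfun_apply (f j) x"
  proof -
    have "AE x in \<gamma>. \<forall>j\<in>{..<m}. blinfun_apply (f j - p (f j)) x = 0"
      using g(3) cov_zero_AE unfolding p_def by (intro AE_finite_allI) auto
    then show ?thesis by eventually_elim (auto simp: hS blinfun.diff_left)
  qed
  have "AE z in \<gamma> \<Otimes>\<^sub>M \<gamma>. \<forall>j<m. blinfun_apply (f j) (S (fst z)) = blinfun_apply (f j) (fst z)"
    using agree by (intro P.AE_pair_measure) (auto simp: hS)
  moreover have "AE z in \<gamma> \<Otimes>\<^sub>M \<gamma>. \<forall>j<m. blinfun_apply (f j) (S (snd z)) = blinfun_apply (f j) (snd z)"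
    using agree by (intro P.AE_pair_measure) (auto simp: hS)
  ultimately have agree2: "AE z in \<gamma> \<Otimes>\<^sub>M \<gamma>. \<forall>j<m. blinfun_apply (f j) (T z) = blinfun_apply (f j) (fst z)"
    by eventually_elim (auto simp: T_def blinfun.add_right blinfun.diff_right)
  have "(\<integral>\<^sup>+x. F (sqrt 2 *\<^sub>R (x - S x)) \<partial>\<gamma>) \<le>
    (\<integral>\<^sup>+z. ennreal e + (B (recon (coords (fst z))) + B (recon (coords (T z)))) \<partial>(\<gamma> \<Otimes>\<^sub>M \<gamma>))"
    unfolding lawW(2)[symmetric]
  proof (rule nn_integral_mono_AE)
    show "AE z in \<gamma> \<Otimes>\<^sub>M \<gamma>. F (recon (coords (W z))) \<le> ennreal e + (B (recon (coords (fst z))) + B (recon (coords (T z))))"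
      using agree2 AE_pair_E
    proof eventually_elim
      case (elim z)
      have E: "fst z \<in> E" "T z \<in> E" "W z \<in> E" using elim SE by (auto simp: T_def W_def intro!: E_mem)
      have W: "W z = fst z - T z" by (simp add: W_def T_def)
      have "ennreal ((norm (fst z - T z))\<^sup>2) \<le> ennreal e + (B (fst z) + B (T z))"
      proof (cases "fst z \<in> Q n \<and> T z \<in> Q n")
        case True
        then have "norm (fst z - T z) < sqrt e" using elim by (intro m) auto
        then have "(norm (fst z - T z))\<^sup>2 \<le> (sqrt e)\<^sup>2" by (intro power_mono) auto
        then have "ennreal ((norm (fst z - T z))\<^sup>2) \<le> ennreal e" using e by (intro ennreal_leI) simp
        then show ?thesis by (rule order_trans) simp
      next
        case False
        define b where "b = (\<lambda>u::'x. C * indicator (- Q n) u + 2 * ((norm u)\<^sup>2 * indicator {x. real M < norm x} u))"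
        have b0: "0 \<le> b u" for u using C by (auto simp: b_def)
        have Bb: "B u = ennreal (b u)" for u
          using C by (simp add: B_def b_def ennreal_mult split: split_indicator)
        have sq: "2 * (norm u)\<^sup>2 \<le> 2 * (real M)\<^sup>2 + 2 * ((norm u)\<^sup>2 * indicator {x. real M < norm x} u)" for u :: 'x
        proof (cases "real M < norm u")
          case False
          then have "(norm u)\<^sup>2 \<le> (real M)\<^sup>2" by (intro power_mono) auto
          then show ?thesis using False by simp
        qed simp
        have "(norm (fst z - T z))\<^sup>2 \<le> (norm (fst z) + norm (T z))\<^sup>2"
          by (intro power_mono norm_triangle_ineq4) simp
        also have "\<dots> \<le> 2 * (norm (fst z))\<^sup>2 + 2 * (norm (T z))\<^sup>2"
          using sum_squares_bound[of "norm (fst z)" "norm (T z)"] by (simp add: power2_sum)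
        also have "\<dots> \<le> 4 * (real M)\<^sup>2 + 2 * ((norm (fst z))\<^sup>2 * indicator {x. real M < norm x} (fst z))
            + 2 * ((norm (T z))\<^sup>2 * indicator {x. real M < norm x} (T z))"
          using sq[of "fst z"] sq[of "T z"] by linarith
        also have "\<dots> \<le> b (fst z) + b (T z)"
          using False C by (auto simp: b_def split: split_indicator)
        finally have "ennreal ((norm (fst z - T z))\<^sup>2) \<le> B (fst z) + B (T z)"
          unfolding Bb by (simp add: b0 ennreal_leI flip: ennreal_plus)
        then show ?thesis by (rule order_trans) simp
      qed
      then show ?case by (simp add: F_def W recon_coords E(1,2) E(3)[unfolded W])
    qed
  qed
  also have "\<dots> = ennreal e + ((\<integral>\<^sup>+x. B x \<partial>\<gamma>) + (\<integral>\<^sup>+x. B x \<partial>\<gamma>))"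
    using law1(1) lawT(1) by (subst nn_integral_add, simp, simp, subst nn_integral_add) (auto simp: law1(2) lawT(2) P.emeasure_space_1)
  also have "(\<integral>\<^sup>+x. B x \<partial>\<gamma>) \<le> ennreal (e / 2)"
  proof -
    have "(\<integral>\<^sup>+x. B x \<partial>\<gamma>) = ennreal C * emeasure \<gamma> (- Q n) + 2 * (\<integral>\<^sup>+x. ennreal ((norm x)\<^sup>2) * indicator {x. real M < norm x} x \<partial>\<gamma>)"
      unfolding B_def by (subst nn_integral_add) (auto simp: nn_integral_cmult nn_integral_cmult_indicator)
    also have "\<dots> \<le> ennreal C * ennreal (e / (4 * C)) + 2 * ennreal (e / 8)"
      using n M by (intro add_mono mult_left_mono) (auto simp: \<gamma>.emeasure_eq_measure ennreal_leI)
    also have "\<dots> = ennreal (C * (e / (4 * C)) + 2 * (e / 8))"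
    proof -
      have "ennreal (C * (e / (4 * C)) + 2 * (e / 8)) = ennreal (C * (e / (4 * C))) + ennreal (2 * (e / 8))"
        using C e by (intro ennreal_plus) auto
      also have "ennreal (C * (e / (4 * C))) = ennreal C * ennreal (e / (4 * C))"
        using C e by (intro ennreal_mult) auto
      also have "ennreal (2 * (e / 8)) = ennreal 2 * ennreal (e / 8)"
        using e by (intro ennreal_mult) auto
      finally show ?thesis by simp
    qed
    also have "C * (e / (4 * C)) + 2 * (e / 8) = e / 2" using C by simp
    finally show ?thesis .
  qed
  also have "ennreal e + (ennreal (e / 2) + ennreal (e / 2)) = ennreal (2 * e)"
    using e by (simp add: ennreal_plus[symmetric] del: ennreal_plus)
  finally have le: "(\<integral>\<^sup>+x. F (sqrt 2 *\<^sub>R (x - S x)) \<partial>\<gamma>) \<le> ennreal (2 * e)"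
    by (simp add: add_mono)
  have "(\<lambda>x. x - S x) \<in> borel_measurable borel" by (intro borel_measurable_continuous_onI continuous_intros cS)
  then have [measurable]: "(\<lambda>x. F (x - S x)) \<in> borel_measurable borel" by measurable
  have "F (sqrt 2 *\<^sub>R (x - S x)) = 2 * F (x - S x)" for x
    by (simp add: F_def power_mult_distrib ennreal_mult)
  with le have "2 * (\<integral>\<^sup>+x. F (x - S x) \<partial>\<gamma>) \<le> 2 * ennreal e"
    using e by (simp add: nn_integral_cmult ennreal_mult)
  then have "(\<integral>\<^sup>+x. F (x - S x) \<partial>\<gamma>) \<le> ennreal e"
    by (subst (asm) ennreal_mult_le_mult_iff) auto
  then show ?thesis using g(1,2) unfolding F_def S_def by blast
qed

end

section \<open>Radonifying embeddings from Gaussian measures\<close>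

context ip_space
begin

lemma nrm_sum: "(\<And>i. i \<in> I \<Longrightarrow> x i \<in> H) \<Longrightarrow> nrm (\<Sum>i\<in>I. x i) \<le> (\<Sum>i\<in>I. nrm (x i))"
proof (induction I rule: infinite_finite_induct)
  case (insert i I)
  then have "nrm (x i + (\<Sum>i\<in>I. x i)) \<le> nrm (x i) + nrm (\<Sum>i\<in>I. x i)"
    by (intro nrm_triangle mem_sum) auto
  with insert show ?case by simp
qed auto

text \<open>The supremum in the \<gamma>-norm runs over all orthonormal systems, whereas estimates
  are available for systems of kernel functions. The proof is Gram-Schmidt inside \<open>D\<close>,
  with control of the perturbation.\<close>

lemma orthonormal_system_approx:
  assumes D: "subspace D" "D \<subseteq> H" and dense: "\<And>h e. h \<in> H \<Longrightarrow> e > 0 \<Longrightarrow> \<exists>k\<in>D. nrm (h - k) < e"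
    and h: "orthonormal_system H ip n h" and e: "e > 0"
  shows "\<exists>h'. orthonormal_system H ip n h' \<and> (\<forall>i<n. h' i \<in> D \<and> nrm (h i - h' i) < e)"
  using h e
proof (induction n arbitrary: e)
  case 0
  then show ?case by (auto simp: orthonormal_system_def)
next
  case (Suc n)
  \<comment> \<open>Replacing \<open>h n\<close> by \<open>k\<close> costs \<open>d\<close>,
    removing its \<open>n\<close> components along the earlier vectors at most \<open>2 * d\<close>
    each; \<open>d\<close> is chosen so that these add up to \<open>\<eta>\<close>. Normalising
    costs another \<open>\<eta>\<close>, and \<open>\<eta> \<le> 1/4\<close> keeps \<open>k'\<close>
    away from 0.\<close>
  define \<eta> where "\<eta> = min e 1 / 4"
  have \<eta>: "0 < \<eta>" "2 * \<eta> < e" "\<eta> \<le> 1/4" using Suc.prems by (auto simp: \<eta>_def)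
  define d where "d = \<eta> / (2 * real n + 1)"
  have "2 * real n + 1 > 0" by simp
  then have d: "d > 0" "d * (2 * real n + 1) = \<eta>" using \<eta> by (auto simp: d_def)
  have "orthonormal_system H ip n h" using Suc.prems(1) by (auto simp: orthonormal_system_def)
  then obtain h' where h': "orthonormal_system H ip n h'" "\<And>i. i < n \<Longrightarrow> h' i \<in> D" "\<And>i. i < n \<Longrightarrow> nrm (h i - h' i) < d"
    using Suc.IH d(1) by blast
  have hH: "h i \<in> H" if "i \<le> n" for i using Suc.prems(1) that by (auto simp: orthonormal_system_def)
  have h'H: "h' i \<in> H" if "i < n" for i using h'(2)[OF that] D by auto
  have hn: "ip (h n) (h i) = 0" if "i < n" for i using Suc.prems(1) that by (auto simp: orthonormal_system_def)
  have hn1: "nrm (h n) = 1" using Suc.prems(1) by (auto simp: orthonormal_system_def norm_of_def)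
  have h'o: "ip (h' i) (h' j) = (if i = j then 1 else 0)" if "i < n" "j < n" for i j
    using h'(1) that by (auto simp: orthonormal_system_def)
  have h'1: "nrm (h' i) = 1" if "i < n" for i using h'o[OF that that] by (simp add: norm_of_def)
  obtain k where k: "k \<in> D" "nrm (h n - k) < d" using dense[OF hH[OF order_refl] d(1)] by blast
  have kH: "k \<in> H" using k D by auto
  have kn: "nrm (k - h n) < d" using k(2) nrm_diff_commute[OF hH[OF order_refl] kH] by simp
  have co: "\<bar>ip k (h' i)\<bar> \<le> 2 * d" if i: "i < n" for i
  proof -
    have "ip k (h' i) = ip (k - h n) (h' i) - ip (h n) (h i - h' i)"
      using i hn[OF i] by (simp add: ip_diff_left ip_diff_right kH hH h'H)
    moreover have "\<bar>ip (k - h n) (h' i)\<bar> \<le> d * 1"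
      using Cauchy_Schwarz[of "k - h n" "h' i"] kn h'1[OF i] kH hH h'H[OF i] by simp
    moreover have "\<bar>ip (h n) (h i - h' i)\<bar> \<le> 1 * d"
      using Cauchy_Schwarz[of "h n" "h i - h' i"] h'(3)[OF i] hn1 hH[of n] hH[of i] i h'H[OF i] by simp
    ultimately show ?thesis by linarith
  qed
  define k' where "k' = k - (\<Sum>i<n. ip k (h' i) *\<^sub>R h' i)"
  have sH: "(\<Sum>i<n. ip k (h' i) *\<^sub>R h' i) \<in> H" using h'H by (intro mem_sum) auto
  have k'D: "k' \<in> D" unfolding k'_def using k h'(2) D by (intro subspace_diff subspace_sum subspace_scale) auto
  then have k'H: "k' \<in> H" using D by auto
  have perp: "ip k' (h' j) = 0" if j: "j < n" for j
  proof -
    have "ip (\<Sum>i<n. ip k (h' i) *\<^sub>R h' i) (h' j) = (\<Sum>i<n. ip k (h' i) * ip (h' i) (h' j))"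
      using h'H j by (subst ip_sum_left) (auto simp: ip_scale_left)
    also have "\<dots> = (\<Sum>i<n. if i = j then ip k (h' j) else 0)" using h'o j by (intro sum.cong) auto
    finally show ?thesis using j by (simp add: k'_def ip_diff_left kH sH h'H)
  qed
  have near: "nrm (h n - k') \<le> \<eta>"
  proof -
    have "nrm (h n - k') \<le> nrm (h n - k) + nrm (\<Sum>i<n. ip k (h' i) *\<^sub>R h' i)"
      using nrm_triangle[of "h n - k" "\<Sum>i<n. ip k (h' i) *\<^sub>R h' i"] sH kH hH[of n] by (simp add: k'_def algebra_simps)
    also have "nrm (\<Sum>i<n. ip k (h' i) *\<^sub>R h' i) \<le> (\<Sum>i<n. nrm (ip k (h' i) *\<^sub>R h' i))"
      using h'H by (intro nrm_sum) auto
    also have "\<dots> \<le> (\<Sum>i<n. 2 * d)" using co h'1 h'H by (intro sum_mono) (simp add: nrm_scale)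
    finally show ?thesis using k(2) d(2) by (simp add: algebra_simps)
  qed
  define \<nu> where "\<nu> = nrm k'"
  have \<nu>: "\<bar>1 - \<nu>\<bar> \<le> \<eta>" using nrm_triangle_rev[OF hH[OF order_refl] k'H] near hn1 by (simp add: \<nu>_def)
  then have \<nu>0: "\<nu> > 0" using \<eta> by linarith
  define g where "g = h'(n := (1 / \<nu>) *\<^sub>R k')"
  have gk: "g i = h' i" if "i < n" for i using that by (simp add: g_def)
  have gn: "g n = (1 / \<nu>) *\<^sub>R k'" by (simp add: g_def)
  have gnH: "g n \<in> H" using k'H by (simp add: gn)
  have gn1: "ip (g n) (g n) = 1"
    using \<nu>0 k'H
    by (simp add: gn ip_scale_left ip_scale_right nrm_sq[OF k'H, symmetric] \<nu>_def[symmetric] power2_eq_square)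
  have gp: "ip (g n) (h' j) = 0" "ip (h' j) (g n) = 0" if "j < n" for j
    using perp[OF that] ip_commute[OF h'H[OF that] k'H] k'H h'H[OF that] by (simp_all add: gn ip_scale_left ip_scale_right)
  have "nrm (h n - g n) < e"
  proof -
    have "nrm (k' - g n) = nrm ((1 - 1 / \<nu>) *\<^sub>R k')" by (simp add: gn scaleR_left_diff_distrib)
    also have "\<dots> = \<bar>1 - \<nu>\<bar>"
      using \<nu>0 k'H by (simp add: nrm_scale \<nu>_def[symmetric] abs_if field_simps)
    finally have "nrm (h n - g n) \<le> \<eta> + \<eta>"
      using nrm_triangle_diff[OF hH[OF order_refl] k'H gnH] near \<nu> by simp
    then show ?thesis using \<eta> by simp
  qed
  moreover have "g n \<in> D" unfolding gn using k'D D by (intro subspace_scale)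
  moreover have "d * 1 \<le> d * (2 * real n + 1)" using d(1) by (intro mult_left_mono) auto
  then have "d < e" using d(2) \<eta> by simp
  then have "g i \<in> D \<and> nrm (h i - g i) < e" if "i < n" for i
    using h'(2,3)[OF that] that by (simp add: gk)
  ultimately have "\<forall>i<Suc n. g i \<in> D \<and> nrm (h i - g i) < e"
    by (simp add: less_Suc_eq)
  moreover have "orthonormal_system H ip (Suc n) g"
    unfolding orthonormal_system_def
    using h'H gnH h'o gn1 gp by (auto simp: less_Suc_eq gk)
  ultimately show ?case by blast
qed

end

text \<open>\<open>cov_vector\<close> controls the values on \<open>f\<close> only. Prepending any
  \<open>h\<close> to \<open>f\<close> leaves \<open>E\<close> unchanged and gives a vector that is
  right on \<open>h\<close> and on \<open>f\<close>; as \<open>f\<close> separates the points of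
  \<open>E\<close>, it is the same vector for every \<open>h\<close>.\<close>

lemma (in gaussian_coords) cov_representer: "\<exists>x\<in>E. \<forall>h. blinfun_apply h x = cov g h"
proof -
  obtain x where x: "x \<in> E" "\<And>j. blinfun_apply (f j) x = cov g (f j)" using cov_vector by blast
  have "blinfun_apply h x = cov g h" for h
  proof -
    interpret h: gaussian_coords \<gamma> Q "case_nat h f"
    proof (unfold_locales)
      show "y = 0" if "y \<in> (\<Union>n. Q n)" "\<And>j. blinfun_apply (case_nat h f j) y = 0" for y
        using separating[OF that(1)] that(2)[of "Suc _"] by simp
    qed (use gauss compact_Q Q_Suc subspace_UN tight in auto)
    obtain y where y: "y \<in> E" "\<And>j. blinfun_apply (case_nat h f j) y = cov g (case_nat h f j)"
      using h.cov_vector[of g] by blast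
    have "blinfun_apply (f j) y = cov g (f j)" for j using y(2)[of "Suc j"] by simp
    then have "coords y = coords x" by (simp add: coords_def x(2))
    then have "y = x" using inj_coords x(1) y(1) by (auto simp: inj_on_def)
    then show ?thesis using y(2)[of 0] by simp
  qed
  then show ?thesis using x(1) by blast
qed

lemma nn_integral_norm_Fatou:
  fixes y :: "nat \<Rightarrow> 'w \<Rightarrow> 'x::real_normed_vector"
  assumes m: "\<And>k. y k \<in> borel_measurable M" and lim: "\<And>w. (\<lambda>k. y k w) \<longlonglongrightarrow> z w"
    and le: "\<And>k. (\<integral>\<^sup>+w. ennreal ((norm (y k w))\<^sup>2) \<partial>M) \<le> c"
  shows "(\<integral>\<^sup>+w. ennreal ((norm (z w))\<^sup>2) \<partial>M) \<le> c"
proof -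
  have "(\<integral>\<^sup>+w. ennreal ((norm (z w))\<^sup>2) \<partial>M) = (\<integral>\<^sup>+w. liminf (\<lambda>k. ennreal ((norm (y k w))\<^sup>2)) \<partial>M)"
  proof (rule nn_integral_cong)
    fix w
    have "(\<lambda>k. ennreal ((norm (y k w))\<^sup>2)) \<longlonglongrightarrow> ennreal ((norm (z w))\<^sup>2)"
      by (intro tendsto_ennrealI tendsto_intros lim)
    then show "ennreal ((norm (z w))\<^sup>2) = liminf (\<lambda>k. ennreal ((norm (y k w))\<^sup>2))"
      by (rule lim_imp_Liminf[symmetric, rotated]) simp
  qed
  also have "\<dots> \<le> liminf (\<lambda>k. \<integral>\<^sup>+w. ennreal ((norm (y k w))\<^sup>2) \<partial>M)"
    using m by (intro nn_integral_liminf) measurable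
  also have "\<dots> \<le> liminf (\<lambda>k::nat. c)" by (intro Liminf_mono always_eventually allI le)
  also have "\<dots> = c" by (rule Liminf_const) simp
  finally show ?thesis .
qed

lemma covariance_imp_radonifying:
  fixes emb :: "'x::banach \<Rightarrow> 't \<Rightarrow> real" and \<gamma> :: "'x measure"
  assumes emb: "rkbs emb" and K: "positive_definite K" and std: "std_gaussian_sequence M \<xi>"
    and \<gamma>: "centered_radon_gaussian \<gamma>" and cov_K: "covariance_function emb \<gamma> = K"
  shows "rkhs_space K \<subseteq> range emb \<and> gamma_radonifying M \<xi> (rkhs_space K) (rkhs_inner K) (inv emb)"
proof -
  define H where "H = rkhs_space K"
  define ip where "ip = rkhs_inner K"
  define A where "A = inv emb"
  have M: "prob_space M" using std by (simp add: std_gaussian_sequence_def)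
  interpret K: pd_kernel K by standard (rule K)
  have rk: "is_rkhs K (H, ip)" unfolding H_def ip_def by (rule K.is_rkhs_rkhs)
  interpret hilbert_space H ip
    using rk unfolding is_rkhs_def prod.case hilbert_space_on_iff by blast
  have Kt: "(\<lambda>s. K s t) \<in> H" "x \<in> H \<Longrightarrow> ip x (\<lambda>s. K s t) = x t" for x t
    using rk unfolding is_rkhs_def prod.case by blast+
  note kf = K.kernel_fun_mem_gen[OF rk]
  have lin: "linear emb" and inj: "inj emb" using emb by (auto simp: rkbs_def)
  define \<delta> where "\<delta> = eval_functional emb"
  have \<delta>: "blinfun_apply (\<delta> t) x = emb x t" for t x unfolding \<delta>_def by (rule rkbs_eval_functional[OF emb])
  have A_emb: "A (emb x) = x" for x unfolding A_def by (rule inv_f_f[OF inj])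
  obtain Q :: "nat \<Rightarrow> 'x set" where Q: "\<And>n. compact (Q n)" "\<And>n. Q n \<subseteq> Q (Suc n)" "subspace (\<Union>n. Q n)"
    "\<And>e. e > 0 \<Longrightarrow> \<exists>n. measure \<gamma> (- Q n) < e"
  proof -
    have "radon_probability \<gamma>" using \<gamma> by (simp add: centered_radon_gaussian_def)
    from radon_sigma_compact[OF this] obtain Q :: "nat \<Rightarrow> 'x set" where
      "(\<forall>n. compact (Q n)) \<and> (\<forall>n. Q n \<subseteq> Q (Suc n)) \<and> subspace (\<Union>n. Q n) \<and> (\<forall>e>0. \<exists>n. measure \<gamma> (- Q n) < e)"
      by (elim exE)
    then show ?thesis by (intro that[of Q]) auto
  qed
  have "\<exists>g\<in>range \<delta>. blinfun_apply g x \<noteq> 0" if "x \<noteq> 0" for x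
  proof -
    have "emb x \<noteq> emb 0" using that inj by (auto simp: inj_def)
    then show ?thesis by (auto simp: \<delta> linear_0[OF lin] fun_eq_iff)
  qed
  \<comment> \<open>Choosing the coordinates among evaluations ties their span to
    \<open>coord_functionals\<close>, and thereby to kernel functions.\<close>
  then have "\<exists>f::nat \<Rightarrow> 'x \<Rightarrow>\<^sub>L real. range f \<subseteq> range \<delta> \<and>
      (\<forall>x\<in>(\<Union>n. Q n). (\<forall>j. blinfun_apply (f j) x = 0) \<longrightarrow> x = 0)"
    by (intro separating_sequence Q(1)) auto
  then obtain f :: "nat \<Rightarrow> 'x \<Rightarrow>\<^sub>L real" where f: "range f \<subseteq> range \<delta>"
    "\<forall>x\<in>(\<Union>n. Q n). (\<forall>j. blinfun_apply (f j) x = 0) \<longrightarrow> x = 0" by (elim exE conjE)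
  interpret G: gaussian_coords \<gamma> Q f
    by unfold_locales (use \<gamma> Q f(2) in auto)
  define R where "R = (\<lambda>g. SOME x. x \<in> G.E \<and> (\<forall>h. blinfun_apply h x = G.cov g h))"
  have R: "R g \<in> G.E" "blinfun_apply h (R g) = G.cov g h" for g h
  proof -
    have "\<exists>x. x \<in> G.E \<and> (\<forall>h. blinfun_apply h x = G.cov g h)" using G.cov_representer by blast
    from someI_ex[OF this] show "R g \<in> G.E" "blinfun_apply h (R g) = G.cov g h" unfolding R_def by auto
  qed
  have embR: "emb (R g) t = G.cov g (\<delta> t)" for g t using R(2)[of "\<delta> t" g] by (simp add: \<delta>)
  have K_cov: "K s t = G.cov (\<delta> s) (\<delta> t)" for s t
  proof -
    have "covariance_function emb \<gamma> s t = (\<integral>y. emb y s * emb y t \<partial>\<gamma>)"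
    proof (rule covariance_function_eq[OF emb \<gamma>])
      show "\<exists>x. \<forall>g. blinfun_apply g x = (\<integral>y. blinfun_apply f y * blinfun_apply g y \<partial>\<gamma>)" for f :: "'x \<Rightarrow>\<^sub>L real"
        using R(2) by (intro exI[of _ "R f"]) (simp add: G.cov_def)
    qed
    then show ?thesis by (simp add: cov_K G.cov_def \<delta>)
  qed
  \<comment> \<open>The continuous functional on \<open>'x\<close> obtained from
    \<open>\<phi>\<close> by composition with \<open>emb\<close>.\<close>
  define bl where "bl = (\<lambda>\<phi>. SOME g :: 'x \<Rightarrow>\<^sub>L real. \<forall>x. blinfun_apply g x = \<phi> (emb x))"
  have bl: "blinfun_apply (bl \<phi>) x = \<phi> (emb x)" if "\<phi> \<in> coord_functionals" for \<phi> x
  proof -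
    have "\<exists>g :: 'x \<Rightarrow>\<^sub>L real. \<forall>x. blinfun_apply g x = \<phi> (emb x)"
      using that
    proof (induction rule: coord_functionals_induct)
      case (eval t)
      then show ?case by (intro exI[of _ "\<delta> t"]) (simp add: \<delta>)
    next
      case zero
      then show ?case by (intro exI[of _ 0]) simp
    next
      case (add \<phi> \<psi>)
      then obtain g h :: "'x \<Rightarrow>\<^sub>L real" where "\<forall>x. blinfun_apply g x = \<phi> (emb x)" "\<forall>x. blinfun_apply h x = \<psi> (emb x)" by blast
      then show ?case by (intro exI[of _ "g + h"]) (simp add: blinfun.add_left)
    next
      case (scale c \<phi>)
      then obtain g :: "'x \<Rightarrow>\<^sub>L real" where "\<forall>x. blinfun_apply g x = \<phi> (emb x)" by blast
      then show ?case by (intro exI[of _ "c *\<^sub>R g"]) (simp add: blinfun.scaleR_left)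
    qed
    from someI_ex[OF this] show ?thesis unfolding bl_def by blast
  qed
  have cov_bl: "G.cov g (bl \<phi>) = \<phi> (emb (R g))" if "\<phi> \<in> coord_functionals" for g \<phi>
    using R(2)[of "bl \<phi>" g] bl[OF that] by simp
  have emb_R_bl: "emb (R (bl \<phi>)) = kernel_fun K \<phi>" if \<phi>: "\<phi> \<in> coord_functionals" for \<phi>
  proof
    fix t
    have "emb (R (\<delta> t)) = K t" by (rule ext) (simp add: embR K_cov)
    then show "emb (R (bl \<phi>)) t = kernel_fun K \<phi> t"
      using cov_bl[OF \<phi>, of "\<delta> t"] G.cov_commute[of "\<delta> t"] by (simp add: embR kernel_fun_def)
  qed
  \<comment> \<open>An isometry: an orthonormal system of kernel functions corresponds to
    functionals that are Gaussian orthonormal under \<gamma>.\<close>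
  have cov_ip: "G.cov (bl \<phi>) (bl \<psi>) = ip (kernel_fun K \<phi>) (kernel_fun K \<psi>)"
    if "\<phi> \<in> coord_functionals" "\<psi> \<in> coord_functionals" for \<phi> \<psi>
    using cov_bl[OF that(2), of "bl \<phi>"] emb_R_bl[OF that(1)] kf(2)[OF that(2) kf(1)[OF that(1)]] by simp
  have A_kf: "A (kernel_fun K \<phi>) = R (bl \<phi>)" if "\<phi> \<in> coord_functionals" for \<phi>
    using A_emb[of "R (bl \<phi>)"] emb_R_bl[OF that] by simp
  define C where "C = sqrt (enn2real (\<integral>\<^sup>+x. ennreal ((norm x)\<^sup>2) \<partial>\<gamma>))"
  have C: "0 \<le> C" "(\<integral>\<^sup>+x. ennreal ((norm x)\<^sup>2) \<partial>\<gamma>) = ennreal (C\<^sup>2)"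
    using G.second_moment_finite by (auto simp: C_def)
  \<comment> \<open>The vectors on the left are the images of \<open>R (bl (\<phi> i))\<close> under
    the map subtracting the regression. With \<open>N = 0\<close> this controls the embedding
    itself, with the approximating \<open>g\<close> the error operator.\<close>
  have domination: "(\<integral>\<^sup>+x. ennreal ((norm (\<Sum>i<n. blinfun_apply (bl (\<phi> i)) x *\<^sub>R
        (R (bl (\<phi> i)) - (\<Sum>k<N. G.cov (bl (\<phi> i)) (g k) *\<^sub>R R (g k)))))\<^sup>2) \<partial>\<gamma>)
      \<le> (\<integral>\<^sup>+x. ennreal ((norm (x - (\<Sum>k<N. blinfun_apply (g k) x *\<^sub>R R (g k))))\<^sup>2) \<partial>\<gamma>)"
    if \<phi>: "\<And>i. i < n \<Longrightarrow> \<phi> i \<in> coord_functionals"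
      and o: "\<And>i j. i < n \<Longrightarrow> j < n \<Longrightarrow> G.cov (bl (\<phi> i)) (bl (\<phi> j)) = (if i = j then 1 else 0)"
    for n N :: nat and \<phi> g
  proof (rule G.gaussian_domination[OF o])
    show "continuous_on UNIV (\<lambda>x. x - (\<Sum>k<N. blinfun_apply (g k) x *\<^sub>R R (g k)))" by (intro continuous_intros)
    show "x - (\<Sum>k<N. blinfun_apply (g k) x *\<^sub>R R (g k)) \<in> G.E" if "x \<in> G.E" for x
      using that R(1) by (intro G.E_mem G.E_sum)
    show "R (bl (\<phi> i)) - (\<Sum>k<N. G.cov (bl (\<phi> i)) (g k) *\<^sub>R R (g k)) \<in> G.E" for i
      using R(1) by (intro G.E_mem G.E_sum)
    show "\<exists>k. (\<forall>x. blinfun_apply h (x - (\<Sum>k<N. blinfun_apply (g k) x *\<^sub>R R (g k))) = blinfun_apply k x) \<and>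
      (\<forall>i<n. blinfun_apply h (R (bl (\<phi> i)) - (\<Sum>k<N. G.cov (bl (\<phi> i)) (g k) *\<^sub>R R (g k))) = G.cov (bl (\<phi> i)) k)" for h
      by (rule exI[of _ "h - (\<Sum>k<N. G.cov (g k) h *\<^sub>R g k)"])
         (simp add: blinfun.diff_right blinfun.diff_left blinfun.sum_right blinfun.sum_left blinfun.scaleR_right
           blinfun.scaleR_left R(2) G.cov_bilinear G.cov_sum mult.commute)
  qed
  have bound: "norm (R (bl \<phi>)) \<le> C * nrm (kernel_fun K \<phi>)" if \<phi>: "\<phi> \<in> coord_functionals" for \<phi>
  proof (cases "nrm (kernel_fun K \<phi>) = 0")
    case True
    then have "kernel_fun K \<phi> = 0" using nrm_eq_0 kf(1)[OF \<phi>] by blast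
    then have "emb (R (bl \<phi>)) = emb 0" using emb_R_bl[OF \<phi>] linear_0[OF lin] by simp
    then have "R (bl \<phi>) = 0" using inj by (auto simp: inj_def)
    then show ?thesis using True by simp
  next
    case False
    define \<nu> where "\<nu> = nrm (kernel_fun K \<phi>)"
    have \<nu>: "\<nu> > 0" using False nrm_nonneg[OF kf(1)[OF \<phi>]] by (simp add: \<nu>_def)
    define \<psi> where "\<psi> = (\<lambda>x. (1 / \<nu>) * \<phi> x)"
    have \<psi>: "\<psi> \<in> coord_functionals" unfolding \<psi>_def by (rule coord_functionals_scale[OF \<phi>])
    have kp: "kernel_fun K \<psi> = (1 / \<nu>) *\<^sub>R kernel_fun K \<phi>" by (simp only: \<psi>_def kernel_fun_scale)
    have o: "G.cov (bl \<psi>) (bl \<psi>) = 1"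
      unfolding cov_ip[OF \<psi> \<psi>] kp using \<nu> kf(1)[OF \<phi>]
      by (simp add: ip_scale_left ip_scale_right nrm_sq[OF kf(1)[OF \<phi>], symmetric] \<nu>_def[symmetric] power2_eq_square)
    have "emb (R (bl \<psi>)) = emb ((1 / \<nu>) *\<^sub>R R (bl \<phi>))"
      using emb_R_bl[OF \<psi>] emb_R_bl[OF \<phi>] kp linear_scale[OF lin, of "1 / \<nu>" "R (bl \<phi>)"] by simp
    then have e: "R (bl \<psi>) = (1 / \<nu>) *\<^sub>R R (bl \<phi>)" using inj by (auto simp: inj_def)
    have "ennreal ((norm (R (bl \<psi>)))\<^sup>2) = (\<integral>\<^sup>+x. ennreal ((blinfun_apply (bl \<psi>) x)\<^sup>2) * ennreal ((norm (R (bl \<psi>)))\<^sup>2) \<partial>\<gamma>)"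
    proof -
      have "(\<integral>\<^sup>+x. ennreal ((blinfun_apply (bl \<psi>) x)\<^sup>2) \<partial>\<gamma>) = ennreal (\<integral>x. (blinfun_apply (bl \<psi>) x)\<^sup>2 \<partial>\<gamma>)"
        by (rule nn_integral_eq_integral) (use cgauss_properties(1)[OF G.prob_\<gamma> G.cgauss_blinfun] in auto)
      also have "\<dots> = 1" using o by (simp add: G.cov_square)
      finally show ?thesis by (subst nn_integral_multc) auto
    qed
    also have "\<dots> = (\<integral>\<^sup>+x. ennreal ((norm (\<Sum>i<Suc 0. blinfun_apply (bl \<psi>) x *\<^sub>R
        (R (bl \<psi>) - (\<Sum>k<(0::nat). G.cov (bl \<psi>) 0 *\<^sub>R R 0))))\<^sup>2) \<partial>\<gamma>)"
      by (simp add: power_mult_distrib ennreal_mult)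
    also have "\<dots> \<le> (\<integral>\<^sup>+x. ennreal ((norm (x - (\<Sum>k<(0::nat). blinfun_apply 0 x *\<^sub>R R 0)))\<^sup>2) \<partial>\<gamma>)"
      by (rule domination[of "Suc 0" "\<lambda>_. \<psi>" "\<lambda>_. 0" 0]) (use \<psi> o in auto)
    finally have "(norm (R (bl \<psi>)))\<^sup>2 \<le> C\<^sup>2" by (simp add: C(2))
    then have "norm (R (bl \<psi>)) \<le> C" using C(1) by (rule power2_le_imp_le)
    then show ?thesis using \<nu> by (simp add: e \<nu>_def[symmetric] field_simps)
  qed
  have dense: "\<exists>\<phi>\<in>coord_functionals. nrm (h - kernel_fun K \<phi>) < e" if "h \<in> H" "e > 0" for h e
    using K.kernel_funs_dense that unfolding H_def ip_def by blast
  \<comment> \<open>By \<open>bound\<close>, kernel functions converging to \<open>h\<close> in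
    \<open>H\<close> come from a Cauchy sequence in \<open>'x\<close>. Evaluations are continuous on
    both sides, so the limit in \<open>'x\<close> is the function \<open>h\<close>.\<close>
  have range: "\<exists>x. emb x = h \<and> norm x \<le> C * nrm h" if h: "h \<in> H" for h
  proof -
    have "\<exists>\<phi>\<in>coord_functionals. nrm (h - kernel_fun K \<phi>) < 1 / real (Suc n)" for n
      by (rule dense[OF h]) simp
    then obtain \<phi> where \<phi>: "\<And>n. \<phi> n \<in> coord_functionals"
      "\<And>n. nrm (h - kernel_fun K (\<phi> n)) < 1 / real (Suc n)" by metis
    define k where "k = (\<lambda>n. kernel_fun K (\<phi> n))"
    define x where "x = (\<lambda>n. R (bl (\<phi> n)))"
    have kH: "k n \<in> H" for n unfolding k_def by (rule kf(1)[OF \<phi>(1)])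
    have ex: "emb (x n) = k n" for n unfolding x_def k_def by (rule emb_R_bl[OF \<phi>(1)])
    have lim: "(\<lambda>n. nrm (k n - h)) \<longlonglongrightarrow> 0"
    proof (rule Lim_null_comparison)
      show "\<forall>\<^sub>F n in sequentially. norm (nrm (k n - h)) \<le> 1 / real (Suc n)"
        using \<phi>(2) nrm_diff_commute[OF h kH] kH h by (auto simp: k_def intro!: always_eventually less_imp_le)
    qed (rule LIMSEQ_Suc[OF lim_1_over_n])
    have xb: "norm (x m - x n) \<le> C * nrm (k m - k n)" for m n
    proof -
      have \<psi>: "(\<lambda>z. \<phi> m z - \<phi> n z) \<in> coord_functionals" by (intro coord_functionals_diff \<phi>)
      have "emb (R (bl (\<lambda>z. \<phi> m z - \<phi> n z))) = emb (x m - x n)"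
        by (simp only: emb_R_bl[OF \<psi>] kernel_fun_diff linear_diff[OF lin] ex k_def)
      then have "R (bl (\<lambda>z. \<phi> m z - \<phi> n z)) = x m - x n" using inj by (auto simp: inj_def)
      then show ?thesis using bound[OF \<psi>] by (simp only: kernel_fun_diff k_def)
    qed
    have "Cauchy x"
    proof (rule CauchyI)
      fix e :: real assume e: "e > 0"
      define d where "d = e / (2 * (C + 1))"
      have d: "d > 0" "2 * C * d < e" using e C(1) by (auto simp: d_def field_simps)
      obtain N where "\<forall>n\<ge>N. norm (nrm (k n - h) - 0) < d"
        using LIMSEQ_D[OF lim d(1)] by auto
      then have N: "nrm (k n - h) < d" if "n \<ge> N" for n using that by (auto simp: abs_less_iff)
      have "norm (x m - x n) < e" if "m \<ge> N" "n \<ge> N" for m n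
      proof -
        have "nrm (k m - k n) \<le> 2 * d"
          using nrm_triangle_diff[OF kH h kH, of m n] N[OF that(1)] N[OF that(2)] nrm_diff_commute[OF h kH, of n] by simp
        then have "C * nrm (k m - k n) \<le> C * (2 * d)" using C(1) by (rule mult_left_mono)
        then show ?thesis using xb[of m n] d(2) by linarith
      qed
      then show "\<exists>M. \<forall>m\<ge>M. \<forall>n\<ge>M. norm (x m - x n) < e" by blast
    qed
    then obtain y where y: "x \<longlonglongrightarrow> y" by (auto simp: Cauchy_convergent_iff convergent_def)
    have "emb y t = h t" for t
    proof -
      have "(\<lambda>n. blinfun_apply (\<delta> t) (x n)) \<longlonglongrightarrow> blinfun_apply (\<delta> t) y" by (intro tendsto_intros y)
      then have "(\<lambda>n. k n t) \<longlonglongrightarrow> emb y t" by (simp add: \<delta> ex)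
      moreover have "(\<lambda>n. k n t) \<longlonglongrightarrow> h t"
        using ip_tendsto[OF kH h Kt(1) lim, of t] Kt(2)[OF kH] Kt(2)[OF h] by simp
      ultimately show ?thesis by (rule LIMSEQ_unique)
    qed
    then have "emb y = h" by (rule ext)
    moreover have "norm y \<le> C * nrm h"
    proof (rule LIMSEQ_le)
      show "(\<lambda>n. norm (x n)) \<longlonglongrightarrow> norm y" by (intro tendsto_intros y)
      have "(\<lambda>n. nrm (k n) - nrm h) \<longlonglongrightarrow> 0"
        using nrm_triangle_rev[OF kH h] by (intro Lim_null_comparison[OF _ lim]) auto
      then have "(\<lambda>n. nrm (k n)) \<longlonglongrightarrow> nrm h" by (simp add: LIM_zero_iff)
      then show "(\<lambda>n. C * nrm (k n)) \<longlonglongrightarrow> C * nrm h" by (intro tendsto_intros)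
      show "\<exists>N. \<forall>n\<ge>N. norm (x n) \<le> C * nrm (k n)"
        using bound[OF \<phi>(1)] by (auto simp: x_def k_def)
    qed
    ultimately show ?thesis by blast
  qed
  have HA: "emb (A h) = h" "norm (A h) \<le> C * nrm h" if "h \<in> H" for h
    using range[OF that] A_emb by auto
  have A: "bounded_linear_on H ip A"
    unfolding bounded_linear_on_def
  proof (intro conjI ballI allI exI)
    fix x y assume xy: "x \<in> H" "y \<in> H"
    have "emb (A (x + y)) = emb (A x + A y)"
      using HA(1)[OF mem(2)[OF xy]] HA(1)[OF xy(1)] HA(1)[OF xy(2)] linear_add[OF lin, of "A x" "A y"] by simp
    then show "A (x + y) = A x + A y" using inj by (auto simp: inj_def)
  next
    fix c x assume x: "x \<in> H"
    have "emb (A (c *\<^sub>R x)) = emb (c *\<^sub>R A x)"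
      using HA(1)[OF mem(3)[OF x, of c]] HA(1)[OF x] linear_scale[OF lin, of c "A x"] by simp
    then show "A (c *\<^sub>R x) = c *\<^sub>R A x" using inj by (auto simp: inj_def)
  next
    show "norm (A x) \<le> C * norm_of ip x" if "x \<in> H" for x using HA(2)[OF that] .
  qed
  note linA = bounded_linear_onD[OF A]
  have kf_subspace: "subspace (kernel_fun K ` coord_functionals)"
    unfolding subspace_def
  proof (intro conjI ballI allI)
    show "0 \<in> kernel_fun K ` coord_functionals"
      using kernel_fun_zero coord_functionals_zero by (intro image_eqI[of _ _ "\<lambda>x. 0"]) auto
  next
    fix x y assume "x \<in> kernel_fun K ` coord_functionals" "y \<in> kernel_fun K ` coord_functionals"
    then obtain \<phi> \<psi> where *: "\<phi> \<in> coord_functionals" "\<psi> \<in> coord_functionals" "x = kernel_fun K \<phi>" "y = kernel_fun K \<psi>" by blast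
    show "x + y \<in> kernel_fun K ` coord_functionals"
      unfolding *(3,4) kernel_fun_add[symmetric] by (intro imageI coord_functionals_add *)
  next
    fix c x assume "x \<in> kernel_fun K ` coord_functionals"
    then obtain \<phi> where *: "\<phi> \<in> coord_functionals" "x = kernel_fun K \<phi>" by blast
    show "c *\<^sub>R x \<in> kernel_fun K ` coord_functionals"
      unfolding *(2) kernel_fun_scale[symmetric] by (intro imageI coord_functionals_scale *)
  qed
  \<comment> \<open>For systems of kernel functions the bound is \<open>domination\<close>. Any
    other orthonormal system is a limit of such systems, along which the operator converges, and
    Fatou's lemma preserves the bound.\<close>
  have gamma_bound: "gamma_norm M \<xi> H ip (\<lambda>h. A h - (\<Sum>k<N. ip h (kernel_fun K (\<psi> k)) *\<^sub>R A (kernel_fun K (\<psi> k)))) \<le> ereal c"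
    if \<psi>: "\<And>k. k < N \<Longrightarrow> \<psi> k \<in> coord_functionals" and c: "0 \<le> c"
      and le: "(\<integral>\<^sup>+x. ennreal ((norm (x - (\<Sum>k<N. blinfun_apply (bl (\<psi> k)) x *\<^sub>R R (bl (\<psi> k)))))\<^sup>2) \<partial>\<gamma>) \<le> ennreal (c\<^sup>2)"
    for N :: nat and \<psi> c
  proof (rule gamma_norm_le[OF std c])
    define V where "V = (\<lambda>h. A h - (\<Sum>k<N. ip h (kernel_fun K (\<psi> k)) *\<^sub>R A (kernel_fun K (\<psi> k))))"
    fix n h assume h: "orthonormal_system H ip n h"
    then have hH: "h i \<in> H" if "i < n" for i using that by (simp add: orthonormal_system_def)
    have Vlim: "(\<lambda>m. V (x m)) \<longlonglongrightarrow> V l" if "\<And>m. x m \<in> H" "l \<in> H" "(\<lambda>m. nrm (x m - l)) \<longlonglongrightarrow> 0" for x l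
      unfolding V_def using \<psi> kf(1)
      by (intro tendsto_diff tendsto_sum tendsto_scaleR tendsto_const bounded_linear_on_tendsto[OF A] ip_tendsto that) auto
    have "\<exists>h'. orthonormal_system H ip n h' \<and> (\<forall>i<n. h' i \<in> kernel_fun K ` coord_functionals \<and> nrm (h i - h' i) < 1 / real (Suc m))" for m
      by (rule orthonormal_system_approx[OF kf_subspace _ _ h]) (use kf(1) dense in auto)
    then obtain h' where h': "\<And>m. orthonormal_system H ip n (h' m)" "\<And>m i. i < n \<Longrightarrow> h' m i \<in> kernel_fun K ` coord_functionals"
      "\<And>m i. i < n \<Longrightarrow> nrm (h i - h' m i) < 1 / real (Suc m)" by metis
    have h'H: "h' m i \<in> H" if i: "i < n" for m i
    proof -
      obtain \<phi> where "\<phi> \<in> coord_functionals" "h' m i = kernel_fun K \<phi>" using h'(2)[OF i, of m] by blast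
      then show ?thesis using kf(1) by simp
    qed
    have h'lim: "(\<lambda>m. nrm (h' m i - h i)) \<longlonglongrightarrow> 0" if i: "i < n" for i
    proof (rule Lim_null_comparison)
      show "\<forall>\<^sub>F m in sequentially. norm (nrm (h' m i - h i)) \<le> 1 / real (Suc m)"
        using h'(3)[OF i] nrm_diff_commute[OF hH[OF i] h'H[OF i]] h'H[OF i] hH[OF i]
        by (auto intro!: always_eventually less_imp_le)
    qed (rule LIMSEQ_Suc[OF lim_1_over_n])
    have \<xi>: "gauss_orthonormal M n \<xi>"
      using std_gaussian_sequence_orthonormal[OF std, of "\<lambda>i. i" n] by simp
    have "(\<integral>\<^sup>+\<omega>. ennreal ((norm (\<Sum>k<n. \<xi> k \<omega> *\<^sub>R V (h k)))\<^sup>2) \<partial>M) \<le> ennreal (c\<^sup>2)"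
    proof (rule nn_integral_norm_Fatou[where y="\<lambda>m \<omega>. \<Sum>k<n. \<xi> k \<omega> *\<^sub>R V (h' m k)" and z="\<lambda>\<omega>. \<Sum>k<n. \<xi> k \<omega> *\<^sub>R V (h k)"])
      show "(\<lambda>\<omega>. \<Sum>k<n. \<xi> k \<omega> *\<^sub>R V (h' m k)) \<in> borel_measurable M" for m
        using gauss_orthonormal_measurable[OF \<xi>] by (intro measurable_lincomb) auto
      show "(\<lambda>m. \<Sum>k<n. \<xi> k \<omega> *\<^sub>R V (h' m k)) \<longlonglongrightarrow> (\<Sum>k<n. \<xi> k \<omega> *\<^sub>R V (h k))" for \<omega>
        by (intro tendsto_intros Vlim) (use h'H hH h'lim in auto)
      fix m
      have "\<exists>\<phi>. \<phi> \<in> coord_functionals \<and> h' m i = kernel_fun K \<phi>" if "i < n" for i using h'(2)[OF that] by auto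
      then obtain \<phi> where \<phi>: "\<And>i. i < n \<Longrightarrow> \<phi> i \<in> coord_functionals" "\<And>i. i < n \<Longrightarrow> h' m i = kernel_fun K (\<phi> i)" by metis
      have o: "G.cov (bl (\<phi> i)) (bl (\<phi> j)) = (if i = j then 1 else 0)" if "i < n" "j < n" for i j
        using h'(1)[of m] that cov_ip[OF \<phi>(1) \<phi>(1), of i j] \<phi>(2) by (simp add: orthonormal_system_def)
      have Vh: "V (h' m i) = R (bl (\<phi> i)) - (\<Sum>k<N. G.cov (bl (\<phi> i)) (bl (\<psi> k)) *\<^sub>R R (bl (\<psi> k)))" if i: "i < n" for i
        unfolding V_def \<phi>(2)[OF i] A_kf[OF \<phi>(1)[OF i]] using A_kf[OF \<psi>] cov_ip[OF \<phi>(1)[OF i] \<psi>] by simp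
      have "(\<integral>\<^sup>+\<omega>. ennreal ((norm (\<Sum>k<n. \<xi> k \<omega> *\<^sub>R V (h' m k)))\<^sup>2) \<partial>M) =
        (\<integral>\<^sup>+x. ennreal ((norm (\<Sum>k<n. blinfun_apply (bl (\<phi> k)) x *\<^sub>R V (h' m k)))\<^sup>2) \<partial>\<gamma>)"
        by (rule gauss_orthonormal_nn_integral[OF M G.prob_\<gamma> \<xi> G.gauss_orthonormal_blinfun[OF o]])
      also have "\<dots> = (\<integral>\<^sup>+x. ennreal ((norm (\<Sum>i<n. blinfun_apply (bl (\<phi> i)) x *\<^sub>R
        (R (bl (\<phi> i)) - (\<Sum>k<N. G.cov (bl (\<phi> i)) (bl (\<psi> k)) *\<^sub>R R (bl (\<psi> k))))))\<^sup>2) \<partial>\<gamma>)"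
        using Vh by simp
      also have "\<dots> \<le> ennreal (c\<^sup>2)"
        using order_trans[OF domination[OF \<phi>(1) o] le] .
      finally show "(\<integral>\<^sup>+\<omega>. ennreal ((norm (\<Sum>k<n. \<xi> k \<omega> *\<^sub>R V (h' m k)))\<^sup>2) \<partial>M) \<le> ennreal (c\<^sup>2)" .
    qed
    then show "(\<integral>\<^sup>+\<omega>. ennreal ((norm (\<Sum>k<n. \<xi> k \<omega> *\<^sub>R (A (h k) - (\<Sum>j<N. ip (h k) (kernel_fun K (\<psi> j)) *\<^sub>R A (kernel_fun K (\<psi> j))))))\<^sup>2) \<partial>M) \<le> ennreal (c\<^sup>2)"
      by (simp only: V_def)
  qed
  have normA: "gamma_norm M \<xi> H ip A \<le> ereal C"
    using gamma_bound[of 0 "\<lambda>_. undefined" C] C by simp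
  have span_bl: "\<exists>\<psi>\<in>coord_functionals. g = bl \<psi>" if gs: "g \<in> span (range f)" for g
  proof -
    let ?S = "{g. \<exists>\<psi>\<in>coord_functionals. \<forall>x. blinfun_apply g x = \<psi> (emb x)}"
    have "range f \<subseteq> ?S"
    proof
      fix g assume "g \<in> range f"
      then obtain t where "g = \<delta> t" using f(1) by blast
      then show "g \<in> ?S" using coord_functionals_eval[of t] by (auto simp: \<delta> intro!: bexI[of _ "\<lambda>x. x t"])
    qed
    moreover have "subspace ?S"
      unfolding subspace_def
    proof (intro conjI ballI allI)
      show "0 \<in> ?S" using coord_functionals_zero by (auto intro!: bexI[of _ "\<lambda>x. 0"])
    next
      fix g h assume "g \<in> ?S" "h \<in> ?S"
      then obtain \<phi> \<psi> where "\<phi> \<in> coord_functionals" "\<psi> \<in> coord_functionals"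
        "\<forall>x. blinfun_apply g x = \<phi> (emb x)" "\<forall>x. blinfun_apply h x = \<psi> (emb x)" by blast
      then show "g + h \<in> ?S" using coord_functionals_add[of \<phi> \<psi>]
        by (auto simp: blinfun.add_left intro!: bexI[of _ "\<lambda>x. \<phi> x + \<psi> x"])
    next
      fix c g assume "g \<in> ?S"
      then obtain \<phi> where "\<phi> \<in> coord_functionals" "\<forall>x. blinfun_apply g x = \<phi> (emb x)" by blast
      then show "c *\<^sub>R g \<in> ?S" using coord_functionals_scale[of \<phi> c]
        by (auto simp: blinfun.scaleR_left intro!: bexI[of _ "\<lambda>x. c * \<phi> x"])
    qed
    ultimately have "span (range f) \<subseteq> ?S" by (rule span_minimal)
    then obtain \<psi> where \<psi>: "\<psi> \<in> coord_functionals" "\<And>x. blinfun_apply g x = \<psi> (emb x)" using gs by blast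
    have "g = bl \<psi>" by (rule blinfun_eqI) (simp add: \<psi>(2) bl[OF \<psi>(1)])
    then show ?thesis using \<psi>(1) by blast
  qed
  have approx: "\<exists>B\<in>gamma_space M \<xi> H ip. finite_rank_on H B \<and> gamma_norm M \<xi> H ip (\<lambda>x. A x - B x) < ereal e" if e: "e > 0" for e
  proof -
    have "(e/2)\<^sup>2 > 0" using e by simp
    then obtain N :: nat and g where g: "\<And>k. k < N \<Longrightarrow> g k \<in> span (range f)"
      "(\<integral>\<^sup>+x. ennreal ((norm (x - (\<Sum>k<N. blinfun_apply (g k) x *\<^sub>R R (g k))))\<^sup>2) \<partial>\<gamma>) \<le> ennreal ((e/2)\<^sup>2)"
      using G.finite_rank_approximation[of R, OF R] by blast
    have "\<exists>\<psi>. \<psi> \<in> coord_functionals \<and> g k = bl \<psi>" if "k < N" for k using span_bl[OF g(1)[OF that]] by blast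
    then obtain \<psi> where \<psi>: "\<And>k. k < N \<Longrightarrow> \<psi> k \<in> coord_functionals" "\<And>k. k < N \<Longrightarrow> g k = bl (\<psi> k)" by metis
    \<comment> \<open>The counterpart on \<open>H\<close> of the regression on \<gamma>: the
      functional \<open>g k\<close> becomes the inner product with its kernel function.\<close>
    define B where "B = (\<lambda>h. \<Sum>k<N. ip h (kernel_fun K (\<psi> k)) *\<^sub>R A (kernel_fun K (\<psi> k)))"
    have kH: "kernel_fun K (\<psi> k) \<in> H" if "k < N" for k using kf(1)[OF \<psi>(1)[OF that]] .
    have near: "gamma_norm M \<xi> H ip (\<lambda>x. A x - B x) \<le> ereal (e/2)"
      unfolding B_def
    proof (rule gamma_bound[OF \<psi>(1)])
      have "(\<Sum>k<N. blinfun_apply (bl (\<psi> k)) x *\<^sub>R R (bl (\<psi> k))) = (\<Sum>k<N. blinfun_apply (g k) x *\<^sub>R R (g k))" for x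
        using \<psi>(2) by simp
      then show "(\<integral>\<^sup>+x. ennreal ((norm (x - (\<Sum>k<N. blinfun_apply (bl (\<psi> k)) x *\<^sub>R R (bl (\<psi> k)))))\<^sup>2) \<partial>\<gamma>) \<le> ennreal ((e/2)\<^sup>2)"
        using g(2) by simp
    qed (use e in auto)
    have B: "bounded_linear_on H ip B"
      unfolding bounded_linear_on_def
    proof (intro conjI ballI allI exI)
      show "B (x + y) = B x + B y" if "x \<in> H" "y \<in> H" for x y
        using that kH by (simp add: B_def ip_add_left scaleR_add_left sum.distrib)
      show "B (c *\<^sub>R x) = c *\<^sub>R B x" if "x \<in> H" for c x
        using that kH by (simp add: B_def ip_scale_left scaleR_sum_right)
      show "norm (B x) \<le> (\<Sum>k<N. nrm (kernel_fun K (\<psi> k)) * norm (A (kernel_fun K (\<psi> k)))) * norm_of ip x" if x: "x \<in> H" for x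
      proof -
        have "norm (B x) \<le> (\<Sum>k<N. norm (ip x (kernel_fun K (\<psi> k)) *\<^sub>R A (kernel_fun K (\<psi> k))))"
          unfolding B_def by (rule norm_sum)
        also have "\<dots> \<le> (\<Sum>k<N. (nrm x * nrm (kernel_fun K (\<psi> k))) * norm (A (kernel_fun K (\<psi> k))))"
        proof (rule sum_mono)
          fix k assume "k \<in> {..<N}"
          then have "\<bar>ip x (kernel_fun K (\<psi> k))\<bar> \<le> nrm x * nrm (kernel_fun K (\<psi> k))"
            using kH x by (intro Cauchy_Schwarz) auto
          then show "norm (ip x (kernel_fun K (\<psi> k)) *\<^sub>R A (kernel_fun K (\<psi> k))) \<le>
            (nrm x * nrm (kernel_fun K (\<psi> k))) * norm (A (kernel_fun K (\<psi> k)))"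
            by (simp add: mult_right_mono)
        qed
        finally show ?thesis by (simp add: sum_distrib_left mult_ac)
      qed
    qed
    have "finite_rank_on H B"
      unfolding finite_rank_on_def
    proof (intro exI conjI)
      show "finite ((\<lambda>k. A (kernel_fun K (\<psi> k))) ` {..<N})" by simp
      show "B ` H \<subseteq> span ((\<lambda>k. A (kernel_fun K (\<psi> k))) ` {..<N})"
        unfolding B_def by (auto intro!: span_sum span_scale intro: span_base)
    qed
    \<comment> \<open>The approximants must have finite \<gamma>-norm themselves. Writing
      \<open>B\<close> as \<open>A - (A - B)\<close>, this follows from the bounds for
      \<open>A\<close> and for the error.\<close>
    moreover have "gamma_norm M \<xi> H ip B \<le> ereal (sqrt (2 * C\<^sup>2 + 2 * (e/2)\<^sup>2))"
    proof (rule gamma_norm_le[OF std])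
      fix n h assume h: "orthonormal_system H ip n h"
      have \<xi>: "gauss_orthonormal M n \<xi>"
        using std_gaussian_sequence_orthonormal[OF std, of "\<lambda>i. i" n] by simp
      define a where "a = (\<lambda>\<omega>. \<Sum>k<n. \<xi> k \<omega> *\<^sub>R A (h k))"
      define b where "b = (\<lambda>\<omega>. \<Sum>k<n. \<xi> k \<omega> *\<^sub>R (A (h k) - B (h k)))"
      have [measurable]: "a \<in> borel_measurable M" "b \<in> borel_measurable M" unfolding a_def b_def
        using gauss_orthonormal_measurable[OF \<xi>] by (auto intro!: measurable_lincomb)
      have "(\<Sum>k<n. \<xi> k \<omega> *\<^sub>R B (h k)) = a \<omega> - b \<omega>" for \<omega>
        by (simp add: a_def b_def sum_subtractf[symmetric] scaleR_diff_right)
      then have "(\<integral>\<^sup>+\<omega>. ennreal ((norm (\<Sum>k<n. \<xi> k \<omega> *\<^sub>R B (h k)))\<^sup>2) \<partial>M) = (\<integral>\<^sup>+\<omega>. ennreal ((norm (a \<omega> - b \<omega>))\<^sup>2) \<partial>M)" by simp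
      also have "\<dots> \<le> (\<integral>\<^sup>+\<omega>. ennreal 2 * ennreal ((norm (a \<omega>))\<^sup>2) + ennreal 2 * ennreal ((norm (b \<omega>))\<^sup>2) \<partial>M)"
      proof (rule nn_integral_mono)
        fix \<omega>
        have "(norm (a \<omega> - b \<omega>))\<^sup>2 \<le> (norm (a \<omega>) + norm (b \<omega>))\<^sup>2" by (intro power_mono norm_triangle_ineq4) simp
        also have "\<dots> \<le> 2 * (norm (a \<omega>))\<^sup>2 + 2 * (norm (b \<omega>))\<^sup>2"
          using sum_squares_bound[of "norm (a \<omega>)" "norm (b \<omega>)"] by (simp add: power2_sum)
        finally have "ennreal ((norm (a \<omega> - b \<omega>))\<^sup>2) \<le> ennreal (2 * (norm (a \<omega>))\<^sup>2 + 2 * (norm (b \<omega>))\<^sup>2)" by (rule ennreal_leI)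
        also have "\<dots> = ennreal 2 * ennreal ((norm (a \<omega>))\<^sup>2) + ennreal 2 * ennreal ((norm (b \<omega>))\<^sup>2)"
          by (subst ennreal_plus, simp, simp, subst (1 2) ennreal_mult) auto
        finally show "ennreal ((norm (a \<omega> - b \<omega>))\<^sup>2) \<le> ennreal 2 * ennreal ((norm (a \<omega>))\<^sup>2) + ennreal 2 * ennreal ((norm (b \<omega>))\<^sup>2)" .
      qed
      also have "\<dots> = ennreal 2 * (\<integral>\<^sup>+\<omega>. ennreal ((norm (a \<omega>))\<^sup>2) \<partial>M) + ennreal 2 * (\<integral>\<^sup>+\<omega>. ennreal ((norm (b \<omega>))\<^sup>2) \<partial>M)"
        by (subst nn_integral_add) (auto simp: nn_integral_cmult)
      also have "\<dots> \<le> ennreal 2 * ennreal (C\<^sup>2) + ennreal 2 * ennreal ((e/2)\<^sup>2)"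
        unfolding a_def b_def
        using gamma_norm_bound(2)[OF std normA h M \<xi>] gamma_norm_bound(2)[OF std near h M \<xi>]
        by (intro add_mono mult_left_mono) auto
      also have "\<dots> = ennreal (2 * C\<^sup>2 + 2 * (e/2)\<^sup>2)"
        by (subst ennreal_plus, simp, simp, subst (1 2) ennreal_mult) auto
      also have "\<dots> = ennreal ((sqrt (2 * C\<^sup>2 + 2 * (e/2)\<^sup>2))\<^sup>2)" by simp
      finally show "(\<integral>\<^sup>+\<omega>. ennreal ((norm (\<Sum>k<n. \<xi> k \<omega> *\<^sub>R B (h k)))\<^sup>2) \<partial>M) \<le> ennreal ((sqrt (2 * C\<^sup>2 + 2 * (e/2)\<^sup>2))\<^sup>2)" .
    qed simp
    then have "gamma_norm M \<xi> H ip B < \<infinity>" by (rule le_less_trans) simp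
    then have "B \<in> gamma_space M \<xi> H ip"
      using B by (simp add: gamma_space_def)
    moreover have "gamma_norm M \<xi> H ip (\<lambda>x. A x - B x) < ereal e"
      using near by (rule le_less_trans) (use e in simp)
    ultimately show ?thesis by blast
  qed
  have "gamma_norm M \<xi> H ip A < \<infinity>" using normA by (rule le_less_trans) simp
  then have "A \<in> gamma_space M \<xi> H ip" using A by (simp add: gamma_space_def)
  then have "gamma_radonifying M \<xi> H ip A" using approx unfolding gamma_radonifying_def by blast
  moreover have "H \<subseteq> range emb" using HA(1) by (metis rangeI subsetI)
  ultimately show ?thesis by (simp add: H_def ip_def A_def)
qed

theorem theorem4p7:
  fixes emb :: "'x::banach \<Rightarrow> 't \<Rightarrow> real"
    and K :: "'t \<Rightarrow> 't \<Rightarrow> real"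
    and M :: "'w measure"
    and \<xi> :: "nat \<Rightarrow> 'w \<Rightarrow> real"
  assumes "rkbs emb"
    and "positive_definite K"
    and "std_gaussian_sequence M \<xi>"
  shows "(\<exists>\<gamma> :: 'x measure. centered_radon_gaussian \<gamma> \<and> covariance_function emb \<gamma> = K) \<longleftrightarrow>
    (rkhs_space K \<subseteq> range emb \<and>
     gamma_radonifying M \<xi> (rkhs_space K) (rkhs_inner K) (inv emb))"
  using covariance_imp_radonifying[OF assms] radonifying_imp_covariance[OF assms] by blast

end
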